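(* Let $G$ be a finite group and $\mathbb{K}$ a field. Then, as an algebra, $$H^*(LBG;\mathbb{K})\cong\mathrm{Cotor}^*_{\mathbb{K}[G]^\vee}\big(\mathbb{K},(\mathbb{K}[G]_{\mathrm{ad}})^\vee\big),$$ where $\mathbb{K}[G]_{\mathrm{ad}}$ denotes the adjoint representation of $G$. Especially, if $G$ is abelian, then $H^*(LBG;\mathbb{K})\cong H^*(G;\mathbb{K})^{\oplus|G|}$ as an algebra.
   Context: $LBG$ is the space of continuous maps from $S^1$ to the classifying space $BG=EG/G$. $\mathbb{K}[G]^\vee$ is the dual Hopf algebra of the group ring. $\mathbb{K}[G]_{\mathrm{ad}}$ is the vector space $\mathbb{K}[G]$ with the conjugation action $h\cdot g=hgh^{-1}$; its dual $(\mathbb{K}[G]_{\mathrm{ad}})^\vee$, the algebra of $\mathbb{K}$-valued functions on the set $G$ under pointwise multiplication, is the corresponding left $\mathbb{K}[G]^\vee$-comodule algebra. $\mathrm{Cotor}$ is the derived functor of the cotensor product ($\mathbb{K}$ the trivial right comodule), with the algebra structure coming from the cobar complex. In the abelian case $H^*(G;\mathbb{K})$ denotes group cohomology and the direct sum is a product of algebras. *)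

theory Defs
  imports "HOL-Homology.Homology" "HOL-Algebra.Group_Action"
begin

section \<open>Graded algebras and the cohomology of cochain algebras\<close>

text \<open>The ground field is the type \<open>'k\<close>; a variable \<open>K :: 'k itself\<close> names it in terms.\<close>

record ('k, 'a) graded_algebra =
  component :: "nat \<Rightarrow> 'a set"
  gadd :: "nat \<Rightarrow> 'a \<Rightarrow> 'a \<Rightarrow> 'a"
  gscale :: "nat \<Rightarrow> 'k \<Rightarrow> 'a \<Rightarrow> 'a"
  gmult :: "nat \<Rightarrow> nat \<Rightarrow> 'a \<Rightarrow> 'a \<Rightarrow> 'a"
  gone :: 'a

definition graded_algebra_iso ::
  "('k, 'a) graded_algebra \<Rightarrow> ('k, 'b) graded_algebra \<Rightarrow> bool" where
  "graded_algebra_iso A B \<longleftrightarrow>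
    (\<exists>f :: nat \<Rightarrow> 'a \<Rightarrow> 'b.
      (\<forall>n. bij_betw (f n) (component A n) (component B n)) \<and>
      (\<forall>n. \<forall>x\<in>component A n. \<forall>y\<in>component A n.
          f n (gadd A n x y) = gadd B n (f n x) (f n y)) \<and>
      (\<forall>n c. \<forall>x\<in>component A n. f n (gscale A n c x) = gscale B n c (f n x)) \<and>
      (\<forall>p q. \<forall>x\<in>component A p. \<forall>y\<in>component A q.
          f (p + q) (gmult A p q x y) = gmult B p q (f p x) (f q y)) \<and>
      f 0 (gone A) = gone B)"

text \<open>The product of \<open>k\<close> copies of \<open>A\<close> in the category of graded algebras.\<close>

definition graded_power ::
  "nat \<Rightarrow> ('k, 'a) graded_algebra \<Rightarrow> ('k, nat \<Rightarrow> 'a) graded_algebra" where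
  "graded_power k A =
    \<lparr>component = (\<lambda>n. {..<k} \<rightarrow>\<^sub>E component A n),
     gadd = (\<lambda>n x y. \<lambda>i\<in>{..<k}. gadd A n (x i) (y i)),
     gscale = (\<lambda>n c x. \<lambda>i\<in>{..<k}. gscale A n c (x i)),
     gmult = (\<lambda>p q x y. \<lambda>i\<in>{..<k}. gmult A p q (x i) (y i)),
     gone = (\<lambda>i\<in>{..<k}. gone A)\<rparr>"

text \<open>The cochain complexes below consist of \<open>'k\<close>-valued functions with pointwise linear
  structure. A cochain of degree \<open>n\<close> vanishes outside the basis elements of degree \<open>n\<close>,
  which makes its representation as a total function unique.\<close>

record ('s, 'k) cochain_algebra =
  cochains :: "nat \<Rightarrow> ('s \<Rightarrow> 'k) set"
  diff :: "nat \<Rightarrow> ('s \<Rightarrow> 'k) \<Rightarrow> 's \<Rightarrow> 'k"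
  cup :: "nat \<Rightarrow> nat \<Rightarrow> ('s \<Rightarrow> 'k) \<Rightarrow> ('s \<Rightarrow> 'k) \<Rightarrow> 's \<Rightarrow> 'k"
  cunit :: "'s \<Rightarrow> 'k"

definition cocycles :: "('s, 'k::field) cochain_algebra \<Rightarrow> nat \<Rightarrow> ('s \<Rightarrow> 'k) set" where
  "cocycles C n = {u \<in> cochains C n. diff C n u = (\<lambda>_. 0)}"

definition coboundaries :: "('s, 'k::field) cochain_algebra \<Rightarrow> nat \<Rightarrow> ('s \<Rightarrow> 'k) set" where
  "coboundaries C n = (case n of 0 \<Rightarrow> {\<lambda>_. 0} | Suc m \<Rightarrow> diff C m ` cochains C m)"

definition cohomology_class ::
  "('s, 'k::field) cochain_algebra \<Rightarrow> nat \<Rightarrow> ('s \<Rightarrow> 'k) \<Rightarrow> ('s \<Rightarrow> 'k) set" where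
  "cohomology_class C n u = {\<lambda>s. u s + b s | b. b \<in> coboundaries C n}"

text \<open>Operations on classes are given by unions over representatives, as for cosets
  in HOL-Algebra.\<close>

definition cohomology ::
  "('s, 'k::field) cochain_algebra \<Rightarrow> ('k, ('s \<Rightarrow> 'k) set) graded_algebra" where
  "cohomology C =
    \<lparr>component = (\<lambda>n. cohomology_class C n ` cocycles C n),
     gadd = (\<lambda>n X Y. \<Union>u\<in>X. \<Union>v\<in>Y. cohomology_class C n (\<lambda>s. u s + v s)),
     gscale = (\<lambda>n c X. \<Union>u\<in>X. cohomology_class C n (\<lambda>s. c * u s)),
     gmult = (\<lambda>p q X Y. \<Union>u\<in>X. \<Union>v\<in>Y. cohomology_class C (p + q) (cup C p q u v)),
     gone = cohomology_class C 0 (cunit C)\<rparr>"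


section \<open>Singular cohomology\<close>

definition front_face :: "nat \<Rightarrow> ((nat \<Rightarrow> real) \<Rightarrow> 'a) \<Rightarrow> (nat \<Rightarrow> real) \<Rightarrow> 'a" where
  "front_face p \<sigma> = restrict \<sigma> (standard_simplex p)"

definition back_face :: "nat \<Rightarrow> nat \<Rightarrow> ((nat \<Rightarrow> real) \<Rightarrow> 'a) \<Rightarrow> (nat \<Rightarrow> real) \<Rightarrow> 'a" where
  "back_face p q \<sigma> =
    restrict (\<lambda>t. \<sigma> (\<lambda>i. if i < p then 0 else t (i - p))) (standard_simplex q)"

definition singular_cochains ::
  "'k::field itself \<Rightarrow> 'a topology \<Rightarrow> ((nat \<Rightarrow> real) \<Rightarrow> 'a, 'k) cochain_algebra" where
  "singular_cochains K X =
    \<lparr>cochains = (\<lambda>n. {u. \<forall>\<sigma>. \<not> singular_simplex n X \<sigma> \<longrightarrow> u \<sigma> = 0}),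
     diff = (\<lambda>n u \<sigma>. if singular_simplex (Suc n) X \<sigma>
                      then \<Sum>i\<le>Suc n. (-1) ^ i * u (singular_face (Suc n) i \<sigma>) else 0),
     cup = (\<lambda>p q u v \<sigma>. if singular_simplex (p + q) X \<sigma>
                         then u (front_face p \<sigma>) * v (back_face p q \<sigma>) else 0),
     cunit = (\<lambda>\<sigma>. if singular_simplex 0 X \<sigma> then 1 else 0)\<rparr>"

definition singular_cohomology ::
  "'k::field itself \<Rightarrow> 'a topology \<Rightarrow> ('k, (((nat \<Rightarrow> real) \<Rightarrow> 'a) \<Rightarrow> 'k) set) graded_algebra" where
  "singular_cohomology K X = cohomology (singular_cochains K X)"


section \<open>The free loop space of the classifying space\<close>

text \<open>The space of continuous maps with the compact-open topology.\<close>

definition mapping_space :: "'a topology \<Rightarrow> 'b topology \<Rightarrow> ('a \<Rightarrow> 'b) topology" where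
  "mapping_space X Y = topology_generated_by
    {{f \<in> extensional (topspace X). continuous_map X Y f \<and> f ` C \<subseteq> U} | C U.
       compactin X C \<and> openin Y U}"

definition free_loop_space :: "'a topology \<Rightarrow> (complex \<Rightarrow> 'a) topology" where
  "free_loop_space X = mapping_space (top_of_set (sphere 0 1)) X"

text \<open>The orbit set with the quotient topology.\<close>

definition orbit_space ::
  "('g, 'm) monoid_scheme \<Rightarrow> 'e topology \<Rightarrow> ('g \<Rightarrow> 'e \<Rightarrow> 'e) \<Rightarrow> 'e set topology" where
  "orbit_space G E \<phi> =
    topology (\<lambda>U. U \<subseteq> orbits G (topspace E) \<phi> \<and> openin E {x \<in> topspace E. orbit G \<phi> x \<in> U})"

text \<open>\<open>E\<close> is a model of \<open>EG\<close> for the discrete group \<open>G\<close>: a contractible space with a \<open>G\<close>-action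
  whose projection \<open>E \<rightarrow> E/G\<close> is a principal \<open>G\<close>-bundle, i.e. every point has a neighbourhood
  that is disjoint from its translates. The empty space counts as contractible in the library
  and has to be excluded.\<close>

definition universal_space ::
  "('g, 'm) monoid_scheme \<Rightarrow> 'e topology \<Rightarrow> ('g \<Rightarrow> 'e \<Rightarrow> 'e) \<Rightarrow> bool" where
  "universal_space G E \<phi> \<longleftrightarrow>
    topspace E \<noteq> {} \<and> contractible_space E \<and>
    group_action G (topspace E) \<phi> \<and> (\<forall>g\<in>carrier G. continuous_map E E (\<phi> g)) \<and>
    (\<forall>x\<in>topspace E. \<exists>U. openin E U \<and> x \<in> U \<and>
       (\<forall>g\<in>carrier G. g \<noteq> \<one>\<^bsub>G\<^esub> \<longrightarrow> \<phi> g ` U \<inter> U = {}))"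

lemma topspace_mapping_space:
  "topspace (mapping_space X Y) = {f \<in> extensional (topspace X). continuous_map X Y f}"
proof
  have "{f \<in> extensional (topspace X). continuous_map X Y f \<and> f ` {} \<subseteq> {}}
      \<in> {{f \<in> extensional (topspace X). continuous_map X Y f \<and> f ` C \<subseteq> U} | C U.
       compactin X C \<and> openin Y U}"
    by blast
  then show "{f \<in> extensional (topspace X). continuous_map X Y f} \<subseteq> topspace (mapping_space X Y)"
    unfolding mapping_space_def topology_generated_by_topspace by auto
qed (auto simp: mapping_space_def)

lemma openin_orbit_space:
  "openin (orbit_space G E \<phi>) U \<longleftrightarrow>
    U \<subseteq> orbits G (topspace E) \<phi> \<and> openin E {x \<in> topspace E. orbit G \<phi> x \<in> U}"
proof -
  let ?L = "\<lambda>U. U \<subseteq> orbits G (topspace E) \<phi> \<and> openin E {x \<in> topspace E. orbit G \<phi> x \<in> U}"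
  have "istopology ?L"
    unfolding istopology_def
  proof (intro conjI allI impI)
    fix S T assume "?L S" "?L T"
    moreover have "{x \<in> topspace E. orbit G \<phi> x \<in> S \<inter> T} =
        {x \<in> topspace E. orbit G \<phi> x \<in> S} \<inter> {x \<in> topspace E. orbit G \<phi> x \<in> T}"
      by blast
    ultimately show "S \<inter> T \<subseteq> orbits G (topspace E) \<phi>"
        "openin E {x \<in> topspace E. orbit G \<phi> x \<in> S \<inter> T}"
      by auto
  next
    fix \<K> assume "\<forall>S\<in>\<K>. ?L S"
    moreover have "{x \<in> topspace E. orbit G \<phi> x \<in> \<Union>\<K>} =
        (\<Union>S\<in>\<K>. {x \<in> topspace E. orbit G \<phi> x \<in> S})"
      by blast
    ultimately show "\<Union>\<K> \<subseteq> orbits G (topspace E) \<phi>"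
        "openin E {x \<in> topspace E. orbit G \<phi> x \<in> \<Union>\<K>}"
      by auto
  qed
  then show ?thesis
    by (simp add: orbit_space_def)
qed

lemma topspace_orbit_space:
  "topspace (orbit_space G E \<phi>) = orbits G (topspace E) \<phi>"
proof
  have "{x \<in> topspace E. orbit G \<phi> x \<in> orbits G (topspace E) \<phi>} = topspace E"
    by (auto simp: orbits_def)
  then have "openin (orbit_space G E \<phi>) (orbits G (topspace E) \<phi>)"
    by (simp add: openin_orbit_space)
  then show "orbits G (topspace E) \<phi> \<subseteq> topspace (orbit_space G E \<phi>)"
    by (rule openin_subset)
qed (auto simp: topspace_def openin_orbit_space)

lemma quotient_map_orbit: "quotient_map E (orbit_space G E \<phi>) (orbit G \<phi>)"
  by (auto simp: quotient_map_def topspace_orbit_space openin_orbit_space orbits_def)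


section \<open>Finite-dimensional Hopf algebras and comodule algebras\<close>

text \<open>A finite-dimensional vector space is given by a finite basis \<open>X\<close>; its elements are the
  functions \<open>'x \<Rightarrow> 'k\<close> vanishing outside \<open>X\<close>, \<open>f\<close> standing for \<open>\<Sum>\<^sub>x f(x) x\<close>. Then
  \<open>X \<times> Y\<close> is a basis of the tensor product of the spaces with bases \<open>X\<close> and \<open>Y\<close>, and
  lists of length \<open>n\<close> over \<open>X\<close> form a basis of the \<open>n\<close>-th tensor power. A linear map \<open>T\<close>
  acts on one tensor factor by being applied to the function of the corresponding argument,
  e.g. \<open>(T \<otimes> id) w (y, z) = T (\<lambda>x. w (x, z)) y\<close>.\<close>

record ('x, 'k) hopf_algebra =
  basis :: "'x set"
  hmult :: "('x \<times> 'x \<Rightarrow> 'k) \<Rightarrow> 'x \<Rightarrow> 'k"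
  hunit :: "'x \<Rightarrow> 'k"
  comult :: "('x \<Rightarrow> 'k) \<Rightarrow> 'x \<times> 'x \<Rightarrow> 'k"
  counit :: "('x \<Rightarrow> 'k) \<Rightarrow> 'k"
  antipode :: "('x \<Rightarrow> 'k) \<Rightarrow> 'x \<Rightarrow> 'k"

text \<open>A left \<open>H\<close>-comodule algebra \<open>A\<close>, with coaction \<open>A \<rightarrow> H \<otimes> A\<close>.\<close>

record ('x, 'y, 'k) comodule_algebra =
  abasis :: "'y set"
  amult :: "('y \<times> 'y \<Rightarrow> 'k) \<Rightarrow> 'y \<Rightarrow> 'k"
  aunit :: "'y \<Rightarrow> 'k"
  coact :: "('y \<Rightarrow> 'k) \<Rightarrow> 'x \<times> 'y \<Rightarrow> 'k"

definition basis_vector :: "'x \<Rightarrow> 'x \<Rightarrow> 'k::field" where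
  "basis_vector x = (\<lambda>y. if y = x then 1 else 0)"

text \<open>The transpose of a linear map from the space with basis \<open>X\<close> to the space with basis \<open>Y\<close>.
  A functional \<open>f\<close> is written in the dual basis, i.e. it is the function of its values on basis
  vectors; its pull-back takes the value \<open>f (T x)\<close> at the basis vector \<open>x\<close>.\<close>

definition dual_map ::
  "'x set \<Rightarrow> 'y set \<Rightarrow> (('x \<Rightarrow> 'k::field) \<Rightarrow> 'y \<Rightarrow> 'k) \<Rightarrow> ('y \<Rightarrow> 'k) \<Rightarrow> 'x \<Rightarrow> 'k" where
  "dual_map X Y T f = (\<lambda>x. if x \<in> X then \<Sum>y\<in>Y. f y * T (basis_vector x) y else 0)"

definition dual_hopf_algebra :: "('x, 'k::field) hopf_algebra \<Rightarrow> ('x, 'k) hopf_algebra" where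
  "dual_hopf_algebra H = (let X = basis H in
    \<lparr>basis = X,
     hmult = dual_map X (X \<times> X) (comult H),
     hunit = (\<lambda>x. if x \<in> X then counit H (basis_vector x) else 0),
     comult = dual_map (X \<times> X) X (hmult H),
     counit = (\<lambda>f. \<Sum>x\<in>X. f x * hunit H x),
     antipode = dual_map X X (antipode H)\<rparr>)"

definition group_algebra ::
  "'k::field itself \<Rightarrow> ('g, 'm) monoid_scheme \<Rightarrow> ('g, 'k) hopf_algebra" where
  "group_algebra K G =
    \<lparr>basis = carrier G,
     hmult = (\<lambda>w z. \<Sum>(x, y) | x \<in> carrier G \<and> y \<in> carrier G \<and> x \<otimes>\<^bsub>G\<^esub> y = z. w (x, y)),
     hunit = basis_vector \<one>\<^bsub>G\<^esub>,
     comult = (\<lambda>f (x, y). if x = y then f x else 0),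
     counit = (\<lambda>f. \<Sum>x\<in>carrier G. f x),
     antipode = (\<lambda>f x. if x \<in> carrier G then f (inv\<^bsub>G\<^esub> x) else 0)\<rparr>"

text \<open>The action map \<open>K[G] \<otimes> K[G] \<rightarrow> K[G]\<close>, \<open>h \<otimes> g \<mapsto> h g h\<inverse>\<close>, of the adjoint representation.\<close>

definition adjoint_action ::
  "'k::field itself \<Rightarrow> ('g, 'm) monoid_scheme \<Rightarrow> ('g \<times> 'g \<Rightarrow> 'k) \<Rightarrow> 'g \<Rightarrow> 'k" where
  "adjoint_action K G w = (\<lambda>z. \<Sum>(h, g) | h \<in> carrier G \<and> g \<in> carrier G \<and>
      h \<otimes>\<^bsub>G\<^esub> g \<otimes>\<^bsub>G\<^esub> inv\<^bsub>G\<^esub> h = z. w (h, g))"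

text \<open>Functions on \<open>G\<close> with pointwise multiplication; dualising the left \<open>K[G]\<close>-action gives
  the left coaction of the dual of \<open>K[G]\<close>.\<close>

definition adjoint_dual ::
  "'k::field itself \<Rightarrow> ('g, 'm) monoid_scheme \<Rightarrow> ('g, 'g, 'k) comodule_algebra" where
  "adjoint_dual K G =
    \<lparr>abasis = carrier G,
     amult = (\<lambda>w x. w (x, x)),
     aunit = (\<lambda>x. if x \<in> carrier G then 1 else 0),
     coact = dual_map (carrier G \<times> carrier G) (carrier G) (adjoint_action K G)\<rparr>"


section \<open>The cobar complex and Cotor\<close>

text \<open>The cobar complex of the trivial right comodule \<open>K\<close> (with coaction \<open>1 \<mapsto> 1 \<otimes> 1\<close>)
  and a left comodule algebra \<open>A\<close> over \<open>H\<close> has \<open>H\<^sup>\<otimes>\<^sup>n \<otimes> A\<close> in degree \<open>n\<close>, with basis the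
  pairs of a list of length \<open>n\<close> and a basis element of \<open>A\<close>. The \<open>i\<close>-th coface inserts the
  unit of \<open>H\<close> on the left (\<open>i = 0\<close>), applies the comultiplication to the \<open>i\<close>-th factor
  (\<open>1 \<le> i \<le> n\<close>), or applies the coaction to \<open>A\<close> (\<open>i = n + 1\<close>).\<close>

definition cobar_coface ::
  "('x, 'k::field) hopf_algebra \<Rightarrow> ('x, 'y, 'k) comodule_algebra \<Rightarrow> nat \<Rightarrow> nat \<Rightarrow>
    ('x list \<times> 'y \<Rightarrow> 'k) \<Rightarrow> 'x list \<times> 'y \<Rightarrow> 'k" where
  "cobar_coface H A n i u = (\<lambda>(hs, y).
     if i = 0 then hunit H (hd hs) * u (tl hs, y)
     else if i \<le> n then
       comult H (\<lambda>x. u (take (i - 1) hs @ x # drop (i + 1) hs, y)) (hs ! (i - 1), hs ! i)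
     else coact A (\<lambda>z. u (butlast hs, z)) (last hs, y))"

text \<open>The product of \<open>a \<in> A\<close> with \<open>[y\<^sub>1 | \<dots> | y\<^sub>q] b\<close>, namely
  \<open>[a\<^sub>(\<^sub>-\<^sub>q\<^sub>) y\<^sub>1 | \<dots> | a\<^sub>(\<^sub>-\<^sub>1\<^sub>) y\<^sub>q] a\<^sub>(\<^sub>0\<^sub>) b\<close> where \<open>a\<^sub>(\<^sub>-\<^sub>q\<^sub>) \<otimes> \<dots> \<otimes> a\<^sub>(\<^sub>-\<^sub>1\<^sub>) \<otimes> a\<^sub>(\<^sub>0\<^sub>)\<close> is the \<open>q\<close>-fold
  coaction on \<open>a\<close>, obtained by moving \<open>a\<close> past one factor \<open>y\<^sub>i\<close> after the other.\<close>

primrec cobar_act ::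
  "('x, 'k::field) hopf_algebra \<Rightarrow> ('x, 'y, 'k) comodule_algebra \<Rightarrow>
    'x list \<Rightarrow> ('y \<Rightarrow> 'k) \<Rightarrow> ('x list \<times> 'y \<Rightarrow> 'k) \<Rightarrow> 'y \<Rightarrow> 'k" where
  "cobar_act H A [] a v y = amult A (\<lambda>(z, z'). a z * v ([], z')) y"
| "cobar_act H A (h # hs) a v y =
     hmult H (\<lambda>(x, x'). cobar_act H A hs (\<lambda>z. coact A a (x, z)) (\<lambda>(ks, z). v (x' # ks, z)) y) h"

definition cobar_complex ::
  "('x, 'k::field) hopf_algebra \<Rightarrow> ('x, 'y, 'k) comodule_algebra \<Rightarrow>
    ('x list \<times> 'y, 'k) cochain_algebra" where
  "cobar_complex H A =
    \<lparr>cochains = (\<lambda>n. {u. \<forall>hs y. \<not> (length hs = n \<and> set hs \<subseteq> basis H \<and> y \<in> abasis A)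
                            \<longrightarrow> u (hs, y) = 0}),
     diff = (\<lambda>n u (hs, y). if length hs = Suc n
               then \<Sum>i\<le>Suc n. (-1) ^ i * cobar_coface H A n i u (hs, y) else 0),
     cup = (\<lambda>p q u v (hs, y). if length hs = p + q
               then cobar_act H A (drop p hs) (\<lambda>z. u (take p hs, z)) v y else 0),
     cunit = (\<lambda>(hs, y). if hs = [] then aunit A y else 0)\<rparr>"

text \<open>\<open>Cotor\<^sub>H(K, A)\<close>: over a field the cobar complex is the cotensor product of \<open>K\<close> with the
  canonical injective resolution of \<open>A\<close>.\<close>

definition Cotor ::
  "('x, 'k::field) hopf_algebra \<Rightarrow> ('x, 'y, 'k) comodule_algebra \<Rightarrow>
    ('k, ('x list \<times> 'y \<Rightarrow> 'k) set) graded_algebra" where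
  "Cotor H A = cohomology (cobar_complex H A)"


section \<open>Group cohomology with trivial coefficients\<close>

definition group_coface ::
  "('g, 'm) monoid_scheme \<Rightarrow> nat \<Rightarrow> nat \<Rightarrow> 'g list \<Rightarrow> 'g list" where
  "group_coface G n i gs =
     (if i = 0 then tl gs
      else if i \<le> n then take (i - 1) gs @ (gs ! (i - 1) \<otimes>\<^bsub>G\<^esub> gs ! i) # drop (i + 1) gs
      else butlast gs)"

definition group_cochains ::
  "'k::field itself \<Rightarrow> ('g, 'm) monoid_scheme \<Rightarrow> ('g list, 'k) cochain_algebra" where
  "group_cochains K G =
    \<lparr>cochains = (\<lambda>n. {u. \<forall>gs. \<not> (length gs = n \<and> set gs \<subseteq> carrier G) \<longrightarrow> u gs = 0}),
     diff = (\<lambda>n u gs. if length gs = Suc n \<and> set gs \<subseteq> carrier G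
               then \<Sum>i\<le>Suc n. (-1) ^ i * u (group_coface G n i gs) else 0),
     cup = (\<lambda>p q u v gs. if length gs = p + q then u (take p gs) * v (drop p gs) else 0),
     cunit = (\<lambda>gs. if gs = [] then 1 else 0)\<rparr>"

definition group_cohomology ::
  "'k::field itself \<Rightarrow> ('g, 'm) monoid_scheme \<Rightarrow> ('k, ('g list \<Rightarrow> 'k) set) graded_algebra" where
  "group_cohomology K G = cohomology (group_cochains K G)"

end

theory Submission
  imports Defs "HOL-Analysis.Complex_Transcendental" "HOL-Analysis.Abstract_Topological_Spaces"
begin

text \<open>
  Let \<open>E\<close> be the contractible total space and \<open>B = E/G\<close>. By the exponential law a singular simplex of
  the free loop space of \<open>B\<close> is a map on \<open>\<Delta>\<^sup>n \<times> S\<^sup>1\<close>, hence a map on the contractible space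
  \<open>\<Delta>\<^sup>n \<times> [0, 1]\<close>. It lifts to a map \<open>\<sigma>\<close> into \<open>E\<close> with \<open>\<sigma> (t, 1) = g \<sigma> (t, 0)\<close> for a single monodromy
  \<open>g \<in> G\<close>, and the lift is unique up to the action of \<open>G\<close>, which conjugates \<open>g\<close>
  (\<open>lift_from_contractible\<close>, \<open>lifts_differ_by_group_element\<close>). So the singular simplices of the
  free loop space are the \<open>G\<close>-orbits of the pairs \<open>(g, \<sigma>)\<close>.

  Choose a map of sets \<open>c: E \<rightarrow> G\<close> that is \<open>G\<close>-equivariant, and let \<open>c\<^sub>i\<close> be the colour of the \<open>i\<close>-th vertex
  \<open>\<sigma> (e\<^sub>i, 0)\<close>. The pair \<open>(g, \<sigma>)\<close> is sent to \<open>([c\<^sub>0\<inverse> c\<^sub>1 | \<dots> | c\<^sub>n\<^sub>-\<^sub>1\<inverse> c\<^sub>n], c\<^sub>n\<inverse> g c\<^sub>n)\<close>. This is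
  \<open>G\<close>-invariant and compatible with all faces, and its target is the nerve of the groupoid of \<open>G\<close> acting on
  itself by conjugation. The cochain algebra of that nerve is the cobar complex of the dual of the
  adjoint representation (\<open>diff_adjoint_cobar\<close>, \<open>cup_adjoint_cobar\<close>). Pulling back cochains is therefore a
  morphism of differential graded algebras, with no homotopies involved.

  It induces an isomorphism because the pairs with a given monodromy form a contractible object. A
  contraction of \<open>E\<close> gives a contraction of the space of paths from \<open>x\<close> to \<open>g x\<close>, hence a cone
  operator that commutes with faces (locale \<open>coned_cover\<close>, verified for loops by means of
  \<open>spread\<close> and \<open>cone_map\<close>). Iterated cones whose vertices have prescribed colours provide a section
  of the map to the nerve, and a prism operator which deforms every simplex into the model simplex with
  the same colours (\<open>prism_homotopy\<close>). The prism operator is equivariant, so it descends to the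
  free loop space and shows that the section is inverse to the map on cohomology
  (\<open>singular_cohomology_iso_adjoint_cotor\<close>).

  If \<open>G\<close> is abelian, conjugation is trivial, and the nerve is the disjoint union of \<open>|G|\<close> copies of the
  nerve of \<open>G\<close>; so its cochain algebra is the product of \<open>|G|\<close> copies of the group cochains, and
  cohomology commutes with products (\<open>adjoint_cobar_iso_power\<close>).
\<close>

section \<open>Differential graded algebras and their cohomology\<close>

text \<open>A differential graded algebra in the concrete form of cochains on a set of basis elements. Additivity
  of the cup product and the Leibniz rule make the product on cohomology well defined.\<close>

locale dga =
  fixes C :: "('s, 'k::field) cochain_algebra"
  assumes zero_cochain: "(\<lambda>_. 0) \<in> cochains C n"
    and add_cochain: "\<lbrakk>u \<in> cochains C n; v \<in> cochains C n\<rbrakk> \<Longrightarrow> (\<lambda>s. u s + v s) \<in> cochains C n"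
    and scale_cochain: "u \<in> cochains C n \<Longrightarrow> (\<lambda>s. c * u s) \<in> cochains C n"
    and diff_cochain: "u \<in> cochains C n \<Longrightarrow> diff C n u \<in> cochains C (Suc n)"
    and diff_add: "\<lbrakk>u \<in> cochains C n; v \<in> cochains C n\<rbrakk> \<Longrightarrow>
      diff C n (\<lambda>s. u s + v s) = (\<lambda>s. diff C n u s + diff C n v s)"
    and diff_scale: "u \<in> cochains C n \<Longrightarrow> diff C n (\<lambda>s. c * u s) = (\<lambda>s. c * diff C n u s)"
    and diff_diff: "u \<in> cochains C n \<Longrightarrow> diff C (Suc n) (diff C n u) = (\<lambda>_. 0)"
    and cup_cochain: "\<lbrakk>u \<in> cochains C p; v \<in> cochains C q\<rbrakk> \<Longrightarrow> cup C p q u v \<in> cochains C (p + q)"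
    and cup_add_left: "\<lbrakk>u \<in> cochains C p; u' \<in> cochains C p; v \<in> cochains C q\<rbrakk> \<Longrightarrow>
      cup C p q (\<lambda>s. u s + u' s) v = (\<lambda>s. cup C p q u v s + cup C p q u' v s)"
    and cup_add_right: "\<lbrakk>u \<in> cochains C p; v \<in> cochains C q; v' \<in> cochains C q\<rbrakk> \<Longrightarrow>
      cup C p q u (\<lambda>s. v s + v' s) = (\<lambda>s. cup C p q u v s + cup C p q u v' s)"
    and leibniz: "\<lbrakk>u \<in> cochains C p; v \<in> cochains C q\<rbrakk> \<Longrightarrow>
      diff C (p + q) (cup C p q u v) =
        (\<lambda>s. cup C (Suc p) q (diff C p u) v s + (-1) ^ p * cup C p (Suc q) u (diff C q v) s)"
    and cunit_cocycle: "cunit C \<in> cocycles C 0"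
begin

lemma diff_zero: "diff C n (\<lambda>_. 0) = (\<lambda>_. 0)"
  using diff_scale[OF zero_cochain, of n 0] by simp

lemma cup_zero_left: "v \<in> cochains C q \<Longrightarrow> cup C p q (\<lambda>_. 0) v = (\<lambda>_. 0)"
  using cup_add_left[OF zero_cochain zero_cochain, of v q p]
  unfolding fun_eq_iff by (metis add_0 add_right_cancel)

lemma cup_zero_right: "u \<in> cochains C p \<Longrightarrow> cup C p q u (\<lambda>_. 0) = (\<lambda>_. 0)"
  using cup_add_right[OF _ zero_cochain zero_cochain, of u p q]
  unfolding fun_eq_iff by (metis add_0 add_right_cancel)

lemma cocycle_cochain: "u \<in> cocycles C n \<Longrightarrow> u \<in> cochains C n"
  by (simp add: cocycles_def)

lemma add_cocycle: "\<lbrakk>u \<in> cocycles C n; v \<in> cocycles C n\<rbrakk> \<Longrightarrow> (\<lambda>s. u s + v s) \<in> cocycles C n"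
  by (simp add: cocycles_def add_cochain diff_add)

lemma scale_cocycle: "u \<in> cocycles C n \<Longrightarrow> (\<lambda>s. c * u s) \<in> cocycles C n"
  by (simp add: cocycles_def scale_cochain diff_scale)

lemma cup_cocycle:
  "\<lbrakk>u \<in> cocycles C p; v \<in> cocycles C q\<rbrakk> \<Longrightarrow> cup C p q u v \<in> cocycles C (p + q)"
  by (simp add: cocycles_def cup_cochain leibniz cup_zero_left cup_zero_right)

lemma coboundary_cocycle: "b \<in> coboundaries C n \<Longrightarrow> b \<in> cocycles C n"
  by (auto simp: coboundaries_def cocycles_def zero_cochain diff_zero diff_cochain diff_diff
      split: nat.splits)

lemma zero_coboundary: "(\<lambda>_. 0) \<in> coboundaries C n"
  by (auto simp: coboundaries_def intro!: image_eqI[OF _ zero_cochain] split: nat.splits)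
     (simp add: diff_zero)

lemma add_coboundary:
  "\<lbrakk>a \<in> coboundaries C n; b \<in> coboundaries C n\<rbrakk> \<Longrightarrow> (\<lambda>s. a s + b s) \<in> coboundaries C n"
  by (auto simp: coboundaries_def diff_add[symmetric] add_cochain split: nat.splits)

lemma scale_coboundary: "b \<in> coboundaries C n \<Longrightarrow> (\<lambda>s. c * b s) \<in> coboundaries C n"
  by (auto simp: coboundaries_def diff_scale[symmetric] scale_cochain split: nat.splits)

text \<open>By the Leibniz rule, coboundaries form an ideal in the algebra of cocycles. In degree 0 the only
  coboundary is 0, so that case has to be treated apart.\<close>

lemma cup_coboundary_left:
  assumes "b \<in> coboundaries C p" "v \<in> cocycles C q"
  shows "cup C p q b v \<in> coboundaries C (p + q)"
proof (cases p)
  case 0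
  with assms show ?thesis
    by (simp add: coboundaries_def[of _ 0] cup_zero_left cocycle_cochain zero_coboundary)
next
  case (Suc m)
  with assms obtain a where a: "a \<in> cochains C m" "b = diff C m a"
    by (auto simp: coboundaries_def)
  with assms(2) have "diff C (m + q) (cup C m q a v) = cup C p q b v"
    by (simp add: leibniz cocycles_def cup_zero_right Suc)
  moreover have "cup C m q a v \<in> cochains C (m + q)"
    using a(1) assms(2) by (simp add: cup_cochain cocycle_cochain)
  ultimately show ?thesis
    using Suc by (simp add: coboundaries_def) (metis imageI)
qed

lemma cup_coboundary_right:
  assumes "u \<in> cocycles C p" "b \<in> coboundaries C q"
  shows "cup C p q u b \<in> coboundaries C (p + q)"
proof (cases q)
  case 0
  with assms show ?thesis
    by (simp add: coboundaries_def[of _ 0] cup_zero_right cocycle_cochain zero_coboundary)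
next
  case (Suc m)
  with assms obtain a where a: "a \<in> cochains C m" "b = diff C m a"
    by (auto simp: coboundaries_def)
  with assms(1) have "diff C (p + m) (cup C p m u a) = (\<lambda>s. (-1) ^ p * cup C p q u b s)"
    by (simp add: leibniz cocycles_def cup_zero_left diff_cochain Suc)
  moreover have "diff C (p + m) (cup C p m u a) \<in> coboundaries C (p + q)"
    using a assms(1) Suc by (auto simp: coboundaries_def cocycle_cochain intro!: cup_cochain)
  ultimately have "(\<lambda>s. (-1) ^ p * cup C p q u b s) \<in> coboundaries C (p + q)"
    by simp
  from scale_coboundary[OF this, of "(-1) ^ p"] show ?thesis
    by (simp flip: mult.assoc power_mult_distrib)
qed

lemma cohomology_class_eq_iff:
  "cohomology_class C n u = cohomology_class C n v \<longleftrightarrow> (\<lambda>s. u s - v s) \<in> coboundaries C n"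
proof
  assume "cohomology_class C n u = cohomology_class C n v"
  moreover have "u \<in> cohomology_class C n u"
    using zero_coboundary by (fastforce simp: cohomology_class_def)
  ultimately show "(\<lambda>s. u s - v s) \<in> coboundaries C n"
    by (auto simp: cohomology_class_def)
next
  assume *: "(\<lambda>s. u s - v s) \<in> coboundaries C n"
  have "\<exists>b'. (\<lambda>s. u s + b s) = (\<lambda>s. v s + b' s) \<and> b' \<in> coboundaries C n"
    if "b \<in> coboundaries C n" for b
    using add_coboundary[OF * that] by (intro exI[of _ "\<lambda>s. (u s - v s) + b s"]) auto
  moreover have "\<exists>b'. (\<lambda>s. v s + b s) = (\<lambda>s. u s + b' s) \<and> b' \<in> coboundaries C n"
    if "b \<in> coboundaries C n" for b
    using add_coboundary[OF scale_coboundary[OF *, of "-1"] that]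
    by (intro exI[of _ "\<lambda>s. -1 * (u s - v s) + b s"]) auto
  ultimately show "cohomology_class C n u = cohomology_class C n v"
    by (auto simp: cohomology_class_def)
qed

lemma self_in_cohomology_class: "u \<in> cohomology_class C n u"
  using zero_coboundary by (fastforce simp: cohomology_class_def)

lemma mem_cohomology_class:
  "v \<in> cohomology_class C n u \<longleftrightarrow> (\<lambda>s. v s - u s) \<in> coboundaries C n"
  by (force simp: cohomology_class_def intro: exI[of _ "\<lambda>s. v s - u s"])

lemma cocycle_of_class:
  assumes "u \<in> cocycles C n" "v \<in> cohomology_class C n u"
  shows "v \<in> cocycles C n"
  using assms by (auto simp: cohomology_class_def intro: add_cocycle coboundary_cocycle)

lemma component_cohomology: "component (cohomology C) n = cohomology_class C n ` cocycles C n"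
  by (simp add: cohomology_def)

lemma gone_cohomology: "gone (cohomology C) = cohomology_class C 0 (cunit C)"
  by (simp add: cohomology_def)

text \<open>The operations on classes are unions over all representatives. They collapse to a single class
  because the class of the result does not depend on the representatives.\<close>

lemma Union_classes_eq:
  assumes "\<And>u'. u' \<in> cohomology_class C n u \<Longrightarrow> F u' = X"
  shows "(\<Union>u'\<in>cohomology_class C n u. F u') = X"
  by (rule UN_constant_eq[OF self_in_cohomology_class]) (use assms in blast)

lemma gadd_cohomology:
  "gadd (cohomology C) n (cohomology_class C n u) (cohomology_class C n v) =
    cohomology_class C n (\<lambda>s. u s + v s)"
proof -
  have "cohomology_class C n (\<lambda>s. u' s + v' s) = cohomology_class C n (\<lambda>s. u s + v s)"
    if "u' \<in> cohomology_class C n u" "v' \<in> cohomology_class C n v" for u' v'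
    using that add_coboundary[of "\<lambda>s. u' s - u s" n "\<lambda>s. v' s - v s"]
    by (simp add: cohomology_class_eq_iff mem_cohomology_class algebra_simps)
  then show ?thesis
    unfolding cohomology_def by (auto intro!: Union_classes_eq simp only: graded_algebra.simps)
qed

lemma gscale_cohomology:
  "gscale (cohomology C) n c (cohomology_class C n u) = cohomology_class C n (\<lambda>s. c * u s)"
proof -
  have "cohomology_class C n (\<lambda>s. c * u' s) = cohomology_class C n (\<lambda>s. c * u s)"
    if "u' \<in> cohomology_class C n u" for u'
    using that scale_coboundary[of "\<lambda>s. u' s - u s" n c]
    by (simp add: cohomology_class_eq_iff mem_cohomology_class algebra_simps)
  then show ?thesis
    unfolding cohomology_def by (auto intro!: Union_classes_eq simp only: graded_algebra.simps)
qed

lemma gmult_cohomology: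
  assumes u: "u \<in> cocycles C p" and v: "v \<in> cocycles C q"
  shows "gmult (cohomology C) p q (cohomology_class C p u) (cohomology_class C q v) =
    cohomology_class C (p + q) (cup C p q u v)"
proof -
  have "cohomology_class C (p + q) (cup C p q u' v') = cohomology_class C (p + q) (cup C p q u v)"
    if u': "u' \<in> cohomology_class C p u" and v': "v' \<in> cohomology_class C q v" for u' v'
  proof -
    from u' v' obtain a b where a: "a \<in> coboundaries C p" "u' = (\<lambda>s. u s + a s)"
      and b: "b \<in> coboundaries C q" "v' = (\<lambda>s. v s + b s)"
      by (auto simp: cohomology_class_def)
    have "v' \<in> cocycles C q"
      using v v' cocycle_of_class by blast
    then have "cup C p q u' v' =
        (\<lambda>s. (cup C p q u v s + cup C p q u b s) + cup C p q a v' s)"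
      using a(1) b(1) u v
      by (simp add: a(2) cup_add_left coboundary_cocycle cocycle_cochain)
         (simp add: b(2) cup_add_right coboundary_cocycle cocycle_cochain)
    moreover have "(\<lambda>s. cup C p q u b s + cup C p q a v' s) \<in> coboundaries C (p + q)"
      using a(1) b(1) u \<open>v' \<in> cocycles C q\<close>
      by (simp add: add_coboundary cup_coboundary_left cup_coboundary_right)
    ultimately show ?thesis
      by (simp add: cohomology_class_eq_iff algebra_simps)
  qed
  then show ?thesis
    unfolding cohomology_def by (auto intro!: Union_classes_eq simp only: graded_algebra.simps)
qed

text \<open>A first isomorphism theorem: the cohomology algebra is determined by any surjection from
  the algebra of cocycles whose kernel consists of the coboundaries.\<close>

theorem cohomology_iso_if_presented:
  fixes B :: "('k, 'b) graded_algebra" and \<phi> :: "nat \<Rightarrow> ('s \<Rightarrow> 'k) \<Rightarrow> 'b"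
  assumes surj: "\<And>n. \<phi> n ` cocycles C n = component B n"
    and ker: "\<And>n u v. \<lbrakk>u \<in> cocycles C n; v \<in> cocycles C n\<rbrakk> \<Longrightarrow>
      \<phi> n u = \<phi> n v \<longleftrightarrow> (\<lambda>s. u s - v s) \<in> coboundaries C n"
    and add: "\<And>n u v. \<lbrakk>u \<in> cocycles C n; v \<in> cocycles C n\<rbrakk> \<Longrightarrow>
      \<phi> n (\<lambda>s. u s + v s) = gadd B n (\<phi> n u) (\<phi> n v)"
    and scale: "\<And>n c u. u \<in> cocycles C n \<Longrightarrow> \<phi> n (\<lambda>s. c * u s) = gscale B n c (\<phi> n u)"
    and mult: "\<And>p q u v. \<lbrakk>u \<in> cocycles C p; v \<in> cocycles C q\<rbrakk> \<Longrightarrow>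
      \<phi> (p + q) (cup C p q u v) = gmult B p q (\<phi> p u) (\<phi> q v)"
    and one: "\<phi> 0 (cunit C) = gone B"
  shows "graded_algebra_iso (cohomology C) B"
proof -
  define f where "f n X = \<phi> n (SOME u. u \<in> X)" for n X
  have f: "f n (cohomology_class C n u) = \<phi> n u" if u: "u \<in> cocycles C n" for n u
  proof -
    have "(SOME w. w \<in> cohomology_class C n u) \<in> cohomology_class C n u"
      by (rule someI[where P = "\<lambda>w. w \<in> _", OF self_in_cohomology_class])
    with u show ?thesis
      unfolding f_def by (metis cocycle_of_class ker mem_cohomology_class)
  qed
  have "inj_on (f n) (component (cohomology C) n)" for n
    by (auto simp: inj_on_def component_cohomology f ker cohomology_class_eq_iff)
  moreover have "f n ` component (cohomology C) n = component B n" for n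
    by (simp add: component_cohomology image_image f flip: surj cong: image_cong_simp)
  ultimately have "bij_betw (f n) (component (cohomology C) n) (component B n)" for n
    by (simp add: bij_betw_def)
  then show ?thesis
    unfolding graded_algebra_iso_def
    by (intro exI[of _ f])
      (auto simp: component_cohomology gone_cohomology gadd_cohomology gscale_cohomology
        gmult_cohomology f add_cocycle scale_cocycle cup_cocycle cunit_cocycle add scale mult one)
qed

end

text \<open>Each axiom is an equation between cochains, so it can be verified after an injective map that
  commutes with the operations. In this way only the singular cochains need a direct proof of the
  Leibniz rule.\<close>

lemma dga_pullback:
  fixes C :: "('s, 'k::field) cochain_algebra" and D :: "('t, 'k) cochain_algebra"
    and f :: "nat \<Rightarrow> ('s \<Rightarrow> 'k) \<Rightarrow> 't \<Rightarrow> 'k"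
  assumes D: "dga D"
    and inj: "\<And>n. inj_on (f n) (cochains C n)"
    and cochain: "\<And>n u. u \<in> cochains C n \<Longrightarrow> f n u \<in> cochains D n"
    and f_zero: "\<And>n. f n (\<lambda>_. 0) = (\<lambda>_. 0)"
    and f_add: "\<And>n u v. \<lbrakk>u \<in> cochains C n; v \<in> cochains C n\<rbrakk> \<Longrightarrow>
      f n (\<lambda>s. u s + v s) = (\<lambda>s. f n u s + f n v s)"
    and f_scale: "\<And>n c u. u \<in> cochains C n \<Longrightarrow> f n (\<lambda>s. c * u s) = (\<lambda>s. c * f n u s)"
    and f_diff: "\<And>n u. u \<in> cochains C n \<Longrightarrow> f (Suc n) (diff C n u) = diff D n (f n u)"
    and f_cup: "\<And>p q u v. \<lbrakk>u \<in> cochains C p; v \<in> cochains C q\<rbrakk> \<Longrightarrow>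
      f (p + q) (cup C p q u v) = cup D p q (f p u) (f q v)"
    and f_unit: "f 0 (cunit C) = cunit D"
    and closed: "\<And>n. (\<lambda>_. 0) \<in> cochains C n"
      "\<And>n u v. \<lbrakk>u \<in> cochains C n; v \<in> cochains C n\<rbrakk> \<Longrightarrow> (\<lambda>s. u s + v s) \<in> cochains C n"
      "\<And>n u c. u \<in> cochains C n \<Longrightarrow> (\<lambda>s. c * u s) \<in> cochains C n"
      "\<And>n u. u \<in> cochains C n \<Longrightarrow> diff C n u \<in> cochains C (Suc n)"
      "\<And>p q u v. \<lbrakk>u \<in> cochains C p; v \<in> cochains C q\<rbrakk> \<Longrightarrow> cup C p q u v \<in> cochains C (p + q)"
      "cunit C \<in> cochains C 0"
  shows "dga C"
proof -
  interpret D: dga D by (rule D)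
  note eqI = inj_onD[OF inj]
  show ?thesis
  proof
    fix n u v c
    assume u: "u \<in> cochains C n"
    show "diff C n (\<lambda>s. c * u s) = (\<lambda>s. c * diff C n u s)"
      using u by (intro eqI[of "Suc n"])
        (simp_all add: f_diff f_scale closed D.diff_scale cochain)
    show "diff C (Suc n) (diff C n u) = (\<lambda>_. 0)"
      using u by (intro eqI[of "Suc (Suc n)"])
        (simp_all add: f_diff f_zero closed D.diff_diff cochain)
    assume v: "v \<in> cochains C n"
    show "diff C n (\<lambda>s. u s + v s) = (\<lambda>s. diff C n u s + diff C n v s)"
      using u v by (intro eqI[of "Suc n"])
        (simp_all add: f_diff f_add closed D.diff_add cochain)
  next
    fix p q u u' v
    assume "u \<in> cochains C p" "u' \<in> cochains C p" "v \<in> cochains C q"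
    then show "cup C p q (\<lambda>s. u s + u' s) v = (\<lambda>s. cup C p q u v s + cup C p q u' v s)"
      by (intro eqI[of "p + q"]) (simp_all add: f_cup f_add closed D.cup_add_left cochain)
  next
    fix p q u v v'
    assume "u \<in> cochains C p" "v \<in> cochains C q" "v' \<in> cochains C q"
    then show "cup C p q u (\<lambda>s. v s + v' s) = (\<lambda>s. cup C p q u v s + cup C p q u v' s)"
      by (intro eqI[of "p + q"]) (simp_all add: f_cup f_add closed D.cup_add_right cochain)
  next
    fix p q u v
    assume uv: "u \<in> cochains C p" "v \<in> cochains C q"
    have *: "cup C (Suc p) q (diff C p u) v \<in> cochains C (Suc (p + q))"
        "cup C p (Suc q) u (diff C q v) \<in> cochains C (Suc (p + q))"
      using closed(5)[of "diff C p u" "Suc p" v q] closed(5)[of u p "diff C q v" "Suc q"] uv closed(4)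
      by simp_all
    have **: "f (Suc (p + q)) (cup C (Suc p) q (diff C p u) v) = cup D (Suc p) q (diff D p (f p u)) (f q v)"
        "f (Suc (p + q)) (cup C p (Suc q) u (diff C q v)) = cup D p (Suc q) (f p u) (diff D q (f q v))"
      using f_cup[of "diff C p u" "Suc p" v q] f_cup[of u p "diff C q v" "Suc q"] uv closed(4)
      by (simp_all add: f_diff)
    show "diff C (p + q) (cup C p q u v) =
        (\<lambda>s. cup C (Suc p) q (diff C p u) v s + (-1) ^ p * cup C p (Suc q) u (diff C q v) s)"
      using uv * ** closed
      by (intro eqI[of "Suc (p + q)"])
        (simp_all add: f_diff f_cup f_add f_scale D.leibniz cochain)
  next
    have "diff C 0 (cunit C) = (\<lambda>_. 0)"
      using closed(6,1,4) D.cunit_cocycle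
      by (intro eqI[of "Suc 0"]) (simp_all add: f_diff f_zero f_unit cocycles_def)
    then show "cunit C \<in> cocycles C 0"
      by (simp add: cocycles_def closed)
  qed (use closed in auto)
qed

definition graded_isomorphism where
  "graded_isomorphism A B f \<longleftrightarrow>
    (\<forall>n. bij_betw (f n) (component A n) (component B n)) \<and>
    (\<forall>n. \<forall>x\<in>component A n. \<forall>y\<in>component A n. f n (gadd A n x y) = gadd B n (f n x) (f n y)) \<and>
    (\<forall>n c. \<forall>x\<in>component A n. f n (gscale A n c x) = gscale B n c (f n x)) \<and>
    (\<forall>p q. \<forall>x\<in>component A p. \<forall>y\<in>component A q.
      f (p + q) (gmult A p q x y) = gmult B p q (f p x) (f q y)) \<and>
    f 0 (gone A) = gone B"

lemma graded_algebra_iso_iff: "graded_algebra_iso A B \<longleftrightarrow> (\<exists>f. graded_isomorphism A B f)"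
  by (simp only: graded_algebra_iso_def graded_isomorphism_def)

lemma graded_isomorphismD:
  assumes "graded_isomorphism A B f"
  shows "bij_betw (f n) (component A n) (component B n)"
    "\<lbrakk>x \<in> component A n; y \<in> component A n\<rbrakk> \<Longrightarrow> f n (gadd A n x y) = gadd B n (f n x) (f n y)"
    "x \<in> component A n \<Longrightarrow> f n (gscale A n c x) = gscale B n c (f n x)"
    "\<lbrakk>x \<in> component A p; y \<in> component A q\<rbrakk> \<Longrightarrow>
      f (p + q) (gmult A p q x y) = gmult B p q (f p x) (f q y)"
    "f 0 (gone A) = gone B"
  using assms unfolding graded_isomorphism_def by blast+

lemma graded_algebra_iso_trans:
  assumes "graded_algebra_iso A B" "graded_algebra_iso B C"
  shows "graded_algebra_iso A C"
proof -
  from assms obtain f g where "graded_isomorphism A B f" "graded_isomorphism B C g"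
    unfolding graded_algebra_iso_iff by (elim exE)
  note f = graded_isomorphismD[OF this(1)] and g = graded_isomorphismD[OF this(2)]
  have "f n x \<in> component B n" if "x \<in> component A n" for n x
    using f(1) that by (rule bij_betwE[rule_format])
  then have "graded_isomorphism A C (\<lambda>n. g n \<circ> f n)"
    unfolding graded_isomorphism_def
    by (intro conjI allI ballI bij_betw_trans[OF f(1) g(1)]; simp only: comp_apply f(2-5) g(2-5))
  then show ?thesis
    unfolding graded_algebra_iso_iff by blast
qed

text \<open>The inverse of a bijective homomorphism is a homomorphism because the source is closed under its
  operations; this is a property of the cohomology of a differential graded algebra, not of an arbitrary
  record of operations.\<close>

lemma (in dga) cohomology_iso_sym:
  assumes "graded_algebra_iso (cohomology C) B"
  shows "graded_algebra_iso B (cohomology C)"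
proof -
  let ?A = "cohomology C"
  from assms obtain f where "graded_isomorphism ?A B f"
    unfolding graded_algebra_iso_iff by (elim exE)
  note f = graded_isomorphismD[OF this]
  define g where "g n = inv_into (component ?A n) (f n)" for n
  have closed: "gadd ?A n x y \<in> component ?A n" "gscale ?A n c x \<in> component ?A n"
    if "x \<in> component ?A n" "y \<in> component ?A n" for n c x y
    using that by (auto simp: component_cohomology gadd_cohomology gscale_cohomology
        add_cocycle scale_cocycle)
  have closed_mult: "gmult ?A p q x y \<in> component ?A (p + q)"
    if "x \<in> component ?A p" "y \<in> component ?A q" for p q x y
    using that by (auto simp: component_cohomology gmult_cohomology cup_cocycle)
  have closed_one: "gone ?A \<in> component ?A 0"
    by (simp add: component_cohomology gone_cohomology cunit_cocycle)
  have g: "bij_betw (g n) (component B n) (component ?A n)" for n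
    unfolding g_def by (rule bij_betw_inv_into[OF f(1)])
  have gf: "g n (f n x) = x" if "x \<in> component ?A n" for n x
    unfolding g_def using f(1) that by (simp add: bij_betw_def)
  have fg: "\<exists>x\<in>component ?A n. f n x = y" if "y \<in> component B n" for n y
    using f(1)[of n] that by (metis bij_betw_def imageE)
  have "graded_isomorphism B ?A g"
    unfolding graded_isomorphism_def
  proof (intro conjI allI ballI)
    fix n x y assume "x \<in> component B n" "y \<in> component B n"
    then obtain a b where "a \<in> component ?A n" "f n a = x" "b \<in> component ?A n" "f n b = y"
      using fg by meson
    then show "g n (gadd B n x y) = gadd ?A n (g n x) (g n y)"
      by (metis closed(1) f(2) gf)
  next
    fix n c x assume "x \<in> component B n"
    then obtain a where "a \<in> component ?A n" "f n a = x"
      using fg by meson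
    then show "g n (gscale B n c x) = gscale ?A n c (g n x)"
      by (metis closed(2) f(3) gf)
  next
    fix p q x y assume "x \<in> component B p" "y \<in> component B q"
    then obtain a b where "a \<in> component ?A p" "f p a = x" "b \<in> component ?A q" "f q b = y"
      using fg by meson
    then show "g (p + q) (gmult B p q x y) = gmult ?A p q (g p x) (g q y)"
      by (metis closed_mult f(4) gf)
  next
    show "g 0 (gone B) = gone ?A"
      by (metis closed_one f(5) gf)
  qed (rule g)
  then show ?thesis
    unfolding graded_algebra_iso_iff by blast
qed

text \<open>The retraction \<open>g\<close> is a chain map inverting \<open>f\<close> on classes: \<open>g f = id\<close> holds strictly, and every
  cocycle \<open>v\<close> is cohomologous to \<open>f (g v)\<close>.\<close>

theorem cohomology_iso_if_deformation_retract:
  fixes C :: "('s, 'k::field) cochain_algebra" and D :: "('t, 'k) cochain_algebra"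
    and f :: "nat \<Rightarrow> ('s \<Rightarrow> 'k) \<Rightarrow> 't \<Rightarrow> 'k" and g :: "nat \<Rightarrow> ('t \<Rightarrow> 'k) \<Rightarrow> 's \<Rightarrow> 'k"
  assumes C: "dga C" and D: "dga D"
    and cochain: "\<And>n u. u \<in> cochains C n \<Longrightarrow> f n u \<in> cochains D n"
    and f_add: "\<And>n u v. \<lbrakk>u \<in> cochains C n; v \<in> cochains C n\<rbrakk> \<Longrightarrow>
      f n (\<lambda>s. u s + v s) = (\<lambda>s. f n u s + f n v s)"
    and f_scale: "\<And>n c u. u \<in> cochains C n \<Longrightarrow> f n (\<lambda>s. c * u s) = (\<lambda>s. c * f n u s)"
    and f_diff: "\<And>n u. u \<in> cochains C n \<Longrightarrow> f (Suc n) (diff C n u) = diff D n (f n u)"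
    and f_cup: "\<And>p q u v. \<lbrakk>u \<in> cochains C p; v \<in> cochains C q\<rbrakk> \<Longrightarrow>
      f (p + q) (cup C p q u v) = cup D p q (f p u) (f q v)"
    and f_unit: "f 0 (cunit C) = cunit D"
    and g_cochain: "\<And>n v. v \<in> cochains D n \<Longrightarrow> g n v \<in> cochains C n"
    and g_diff: "\<And>n v. v \<in> cochains D n \<Longrightarrow> g (Suc n) (diff D n v) = diff C n (g n v)"
    and g_zero: "\<And>n. g n (\<lambda>_. 0) = (\<lambda>_. 0)"
    and gf: "\<And>n u. u \<in> cochains C n \<Longrightarrow> g n (f n u) = u"
    and fg: "\<And>n v. v \<in> cocycles D n \<Longrightarrow> (\<lambda>s. v s - f n (g n v) s) \<in> coboundaries D n"
  shows "graded_algebra_iso (cohomology C) (cohomology D)"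
proof -
  interpret C: dga C by (rule C)
  interpret D: dga D by (rule D)
  have f_zero: "f n (\<lambda>_. 0) = (\<lambda>_. 0)" for n
    using f_scale[OF C.zero_cochain, of n 0] by simp
  have f_cocycle: "f n u \<in> cocycles D n" if "u \<in> cocycles C n" for n u
    using that f_diff[of u n] by (simp add: cocycles_def cochain f_zero)
  have g_cocycle: "g n v \<in> cocycles C n" if "v \<in> cocycles D n" for n v
    using that g_diff[of v n] by (simp add: cocycles_def g_cochain g_zero)
  have f_coboundary: "f n u \<in> coboundaries D n" if "u \<in> coboundaries C n" for n u
    using that by (auto simp: coboundaries_def cochain f_zero f_diff split: nat.splits)
  have g_coboundary: "g n u \<in> coboundaries C n" if "u \<in> coboundaries D n" for n u
    using that by (auto simp: coboundaries_def g_cochain g_zero g_diff split: nat.splits)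
  show ?thesis
  proof (rule C.cohomology_iso_if_presented[where \<phi> = "\<lambda>n u. cohomology_class D n (f n u)"])
    fix n
    have "\<exists>u\<in>cocycles C n. cohomology_class D n v = cohomology_class D n (f n u)"
      if "v \<in> cocycles D n" for v
      using fg[OF that] g_cocycle[OF that] by (auto simp: D.cohomology_class_eq_iff)
    then show "(\<lambda>u. cohomology_class D n (f n u)) ` cocycles C n = component (cohomology D) n"
      by (auto simp: D.component_cohomology f_cocycle)
  next
    fix n u v assume uv: "u \<in> cocycles C n" "v \<in> cocycles C n"
    have "(\<lambda>s. f n u s - f n v s) = f n (\<lambda>s. u s - v s)"
      using f_add[OF C.cocycle_cochain[OF uv(1)] C.scale_cochain[OF C.cocycle_cochain[OF uv(2)], of "-1"]]
        f_scale[OF C.cocycle_cochain[OF uv(2)], of "-1"] by simp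
    moreover have "(\<lambda>s. u s - v s) \<in> cochains C n"
      using C.add_cochain[OF C.cocycle_cochain[OF uv(1)] C.scale_cochain[OF C.cocycle_cochain[OF uv(2)], of "-1"]]
      by simp
    ultimately show "cohomology_class D n (f n u) = cohomology_class D n (f n v) \<longleftrightarrow>
        (\<lambda>s. u s - v s) \<in> coboundaries C n"
      using f_coboundary g_coboundary gf by (metis D.cohomology_class_eq_iff)
  qed (simp_all add: f_add f_scale f_cup f_unit f_cocycle C.cocycle_cochain D.gadd_cohomology
      D.gscale_cohomology D.gmult_cohomology D.gone_cohomology)
qed

section \<open>The singular cochain algebra\<close>

text \<open>The inclusion of the standard \<open>q\<close>-simplex as the back face of the standard \<open>(p + q)\<close>-simplex.\<close>

definition shift_coords :: "nat \<Rightarrow> (nat \<Rightarrow> real) \<Rightarrow> nat \<Rightarrow> real" where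
  "shift_coords p t = (\<lambda>i. if i < p then 0 else t (i - p))"

lemma shift_coords_simplex:
  assumes "t \<in> standard_simplex q"
  shows "shift_coords p t \<in> standard_simplex (p + q)"
proof -
  have "(\<Sum>i\<le>p + q. shift_coords p t i) = (\<Sum>i\<in>{p..p + q}. shift_coords p t i)"
    by (rule sum.mono_neutral_right) (auto simp: shift_coords_def)
  also have "\<dots> = (\<Sum>i\<le>q. t i)"
    by (rule sum.reindex_bij_witness[of _ "\<lambda>i. i + p" "\<lambda>i. i - p"]) (auto simp: shift_coords_def)
  finally show ?thesis
    using assms by (auto simp: standard_simplex_def shift_coords_def)
qed

lemma back_face_apply:
  "t \<in> standard_simplex q \<Longrightarrow> back_face p q \<sigma> t = \<sigma> (shift_coords p t)"
  by (simp add: back_face_def shift_coords_def)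

lemma singular_face_apply:
  "t \<in> standard_simplex n \<Longrightarrow> singular_face (Suc n) i \<sigma> t = \<sigma> (simplical_face i t)"
  by (simp add: singular_face_def)

lemma simplical_face_simplex:
  "\<lbrakk>t \<in> standard_simplex n; i \<le> Suc n\<rbrakk> \<Longrightarrow> simplical_face i t \<in> standard_simplex (Suc n)"
  using simplical_face_in_standard_simplex[of "Suc n" i t] by simp

lemma standard_simplex_eq_0: "\<lbrakk>t \<in> standard_simplex n; n < i\<rbrakk> \<Longrightarrow> t i = 0"
  by (simp add: standard_simplex_def)

lemma singular_face_outside: "t \<notin> standard_simplex n \<Longrightarrow> singular_face (Suc n) i \<sigma> t = undefined"
  by (simp add: singular_face_def)

text \<open>The semi-simplicial identities. This one gives \<open>\<delta>\<delta> = 0\<close>; the following ones describe how faces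
  interact with front and back faces and give the Leibniz rule.\<close>

lemma singular_face_singular_face:
  assumes "i \<le> j" "j \<le> Suc n"
  shows "singular_face (Suc n) i (singular_face (Suc (Suc n)) (Suc j) \<sigma>) =
    singular_face (Suc n) j (singular_face (Suc (Suc n)) i \<sigma>)"
proof
  fix t :: "nat \<Rightarrow> real"
  have "simplical_face (Suc j) (simplical_face i t) = simplical_face i (simplical_face j t)"
    using assms by (auto simp: simplical_face_def fun_eq_iff)
  then show "singular_face (Suc n) i (singular_face (Suc (Suc n)) (Suc j) \<sigma>) t =
      singular_face (Suc n) j (singular_face (Suc (Suc n)) i \<sigma>) t"
    using assms
    by (cases "t \<in> standard_simplex n")
      (simp_all add: singular_face_apply simplical_face_simplex singular_face_outside)
qed

lemma front_face_singular_face_low: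
  assumes "i \<le> Suc p" "p \<le> n"
  shows "front_face p (singular_face (Suc n) i \<sigma>) = singular_face (Suc p) i (front_face (Suc p) \<sigma>)"
proof
  fix t
  show "front_face p (singular_face (Suc n) i \<sigma>) t = singular_face (Suc p) i (front_face (Suc p) \<sigma>) t"
    using assms standard_simplex_mono[of p n]
    by (cases "t \<in> standard_simplex p")
      (auto simp: front_face_def singular_face_apply simplical_face_simplex singular_face_outside)
qed

lemma front_face_singular_face_high:
  assumes "p < i" "p \<le> n"
  shows "front_face p (singular_face (Suc n) i \<sigma>) = front_face p \<sigma>"
proof
  fix t
  have "simplical_face i t = t" if "t \<in> standard_simplex p"
    using that assms standard_simplex_eq_0[OF that] by (auto simp: simplical_face_def fun_eq_iff)
  then show "front_face p (singular_face (Suc n) i \<sigma>) t = front_face p \<sigma> t"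
    using assms standard_simplex_mono[of p n]
    by (cases "t \<in> standard_simplex p") (auto simp: front_face_def singular_face_apply)
qed

lemma back_face_singular_face_low:
  assumes "i \<le> p"
  shows "back_face p q (singular_face (Suc (p + q)) i \<sigma>) = back_face (Suc p) q \<sigma>"
proof
  fix t
  have "simplical_face i (shift_coords p t) = shift_coords (Suc p) t"
    using assms by (auto simp: simplical_face_def shift_coords_def fun_eq_iff)
  then show "back_face p q (singular_face (Suc (p + q)) i \<sigma>) t = back_face (Suc p) q \<sigma> t"
    by (cases "t \<in> standard_simplex q")
      (simp_all add: back_face_apply singular_face_apply shift_coords_simplex, simp add: back_face_def)
qed

lemma back_face_singular_face_high:
  assumes "j \<le> Suc q"
  shows "back_face p q (singular_face (Suc (p + q)) (p + j) \<sigma>) =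
    singular_face (Suc q) j (back_face p (Suc q) \<sigma>)"
proof
  fix t
  have "simplical_face (p + j) (shift_coords p t) = shift_coords p (simplical_face j t)"
  proof
    fix i
    consider "i < p" | k where "i = p + k"
      by (metis le_Suc_ex not_le)
    then show "simplical_face (p + j) (shift_coords p t) i = shift_coords p (simplical_face j t) i"
      by cases (auto simp: simplical_face_def shift_coords_def)
  qed
  with assms show "back_face p q (singular_face (Suc (p + q)) (p + j) \<sigma>) t =
      singular_face (Suc q) j (back_face p (Suc q) \<sigma>) t"
    by (cases "t \<in> standard_simplex q")
      (simp_all add: back_face_apply singular_face_apply shift_coords_simplex simplical_face_simplex
        singular_face_outside, simp add: back_face_def)
qed

lemma singular_face_front_face: "singular_face (Suc p) (Suc p) (front_face (Suc p) \<sigma>) = front_face p \<sigma>"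
  by (metis front_face_singular_face_high front_face_singular_face_low le_refl lessI)

lemma singular_face_back_face: "singular_face (Suc q) 0 (back_face p (Suc q) \<sigma>) = back_face (Suc p) q \<sigma>"
  using back_face_singular_face_high[of 0 q p \<sigma>] back_face_singular_face_low[of p p q \<sigma>] by simp

lemma singular_simplex_face:
  "\<lbrakk>singular_simplex (Suc n) X \<sigma>; i \<le> Suc n\<rbrakk> \<Longrightarrow> singular_simplex n X (singular_face (Suc n) i \<sigma>)"
  using singular_simplex_singular_face[of "Suc n" X \<sigma> i] by simp

lemma singular_simplex_front_face:
  assumes "singular_simplex (p + q) X \<sigma>"
  shows "singular_simplex p X (front_face p \<sigma>)"
  using assms
proof (induction q arbitrary: \<sigma>)
  case 0
  then show ?case
    by (simp add: front_face_def singular_simplex_def extensional_restrict)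
next
  case (Suc q)
  then have "singular_simplex p X (front_face p (singular_face (Suc (p + q)) (Suc (p + q)) \<sigma>))"
    using singular_simplex_face[of "p + q" X \<sigma> "Suc (p + q)"] by simp
  then show ?case
    by (simp add: front_face_singular_face_high)
qed

lemma singular_simplex_back_face:
  assumes "singular_simplex (p + q) X \<sigma>"
  shows "singular_simplex q X (back_face p q \<sigma>)"
  using assms
proof (induction p arbitrary: \<sigma>)
  case 0
  moreover from 0 have "back_face 0 q \<sigma> = \<sigma>"
    by (simp add: back_face_def singular_simplex_def extensional_restrict)
  ultimately show ?case
    by simp
next
  case (Suc p)
  then have "singular_simplex q X (back_face p q (singular_face (Suc (p + q)) 0 \<sigma>))"
    using singular_simplex_face[of "p + q" X \<sigma> 0] by simp
  then show ?case
    by (simp add: back_face_singular_face_low)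
qed

text \<open>The index pairs \<open>(i, j)\<close> with \<open>j < i\<close> are exactly the \<open>(j' + 1, i')\<close> with \<open>i' \<le> j'\<close>, and this
  correspondence preserves the summand up to sign.\<close>

lemma alternating_double_sum_eq_0:
  fixes a :: "nat \<Rightarrow> nat \<Rightarrow> 'k::comm_ring_1"
  assumes "\<And>i j. \<lbrakk>i \<le> j; j \<le> m\<rbrakk> \<Longrightarrow> a (Suc j) i = a i j"
  shows "(\<Sum>i\<le>Suc m. (-1) ^ i * (\<Sum>j\<le>m. (-1) ^ j * a i j)) = 0"
proof -
  let ?f = "\<lambda>(i, j). (-1) ^ i * ((-1) ^ j * a i j)"
  let ?U = "{(i, j). i \<le> j \<and> j \<le> m}" and ?L = "{(i, j). j < i \<and> i \<le> Suc m}"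
  have fin: "finite ?U" "finite ?L"
    by (rule finite_subset[of _ "{..Suc m} \<times> {..Suc m}"]; force)+
  have "(\<Sum>i\<le>Suc m. (-1) ^ i * (\<Sum>j\<le>m. (-1) ^ j * a i j)) = sum ?f ({..Suc m} \<times> {..m})"
    by (simp add: sum_distrib_left sum.cartesian_product)
  also have "{..Suc m} \<times> {..m} = ?U \<union> ?L"
    by auto
  also have "sum ?f (?U \<union> ?L) = sum ?f ?U + sum ?f ?L"
    by (rule sum.union_disjoint[OF fin]) auto
  also have "?L = (\<lambda>(i, j). (Suc j, i)) ` ?U"
  proof -
    have "(i, j) \<in> (\<lambda>(i, j). (Suc j, i)) ` ?U" if "j < i" "i \<le> Suc m" for i j
      using that by (intro image_eqI[of _ _ "(j, i - 1)"]) auto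
    then show ?thesis
      by auto
  qed
  also have "sum ?f ((\<lambda>(i, j). (Suc j, i)) ` ?U) = (\<Sum>x\<in>?U. ?f ((\<lambda>(i, j). (Suc j, i)) x))"
    by (subst sum.reindex) (auto simp: inj_on_def)
  also have "\<dots> = (\<Sum>x\<in>?U. - ?f x)"
    by (intro sum.cong) (auto simp: assms)
  finally show ?thesis
    by (simp add: sum_negf)
qed

lemma sum_atMost_add:
  fixes f :: "nat \<Rightarrow> 'k::comm_monoid_add"
  shows "(\<Sum>i\<le>Suc (p + q). f i) = (\<Sum>i\<le>p. f i) + (\<Sum>j\<le>q. f (Suc (p + j)))"
  by (induction q) (simp_all add: add.assoc)

text \<open>For the Leibniz rule, the faces \<open>0, \<dots>, p\<close> of a \<open>(p + q + 1)\<close>-simplex act on its front part and the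
  remaining ones on its back part. The last face of the front part and the zeroth face of the back
  part occur on the right-hand side only; they give the same product with opposite signs.\<close>

theorem dga_singular_cochains: "dga (singular_cochains (K :: 'k::field itself) X)"
proof
  fix n :: nat and u :: "((nat \<Rightarrow> real) \<Rightarrow> 'a) \<Rightarrow> 'k"
  let ?C = "singular_cochains K X"
  show "diff ?C (Suc n) (diff ?C n u) = (\<lambda>_. 0)"
  proof
    fix \<sigma>
    show "diff ?C (Suc n) (diff ?C n u) \<sigma> = 0"
      using alternating_double_sum_eq_0[of "Suc n"
          "\<lambda>i j. u (singular_face (Suc n) j (singular_face (Suc (Suc n)) i \<sigma>))"]
      by (simp add: singular_cochains_def singular_simplex_face singular_face_singular_face
          del: sum.atMost_Suc)
  qed
next
  fix p q :: nat and u v :: "((nat \<Rightarrow> real) \<Rightarrow> 'a) \<Rightarrow> 'k"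
  let ?C = "singular_cochains K X"
  show "diff ?C (p + q) (cup ?C p q u v) =
      (\<lambda>s. cup ?C (Suc p) q (diff ?C p u) v s + (-1) ^ p * cup ?C p (Suc q) u (diff ?C q v) s)"
  proof
    fix \<sigma>
    show "diff ?C (p + q) (cup ?C p q u v) \<sigma> =
        cup ?C (Suc p) q (diff ?C p u) v \<sigma> + (-1) ^ p * cup ?C p (Suc q) u (diff ?C q v) \<sigma>"
    proof (cases "singular_simplex (Suc (p + q)) X \<sigma>")
      case True
      let ?d = "\<lambda>i. singular_face (Suc (p + q)) i \<sigma>"
      let ?F = "front_face p \<sigma>" and ?B = "back_face (Suc p) q \<sigma>"
      have sf: "singular_simplex (Suc p) X (front_face (Suc p) \<sigma>)"
        using True singular_simplex_front_face[of "Suc p" q] by simp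
      have sb: "singular_simplex (Suc q) X (back_face p (Suc q) \<sigma>)"
        using True singular_simplex_back_face[of p "Suc q"] by simp
      have "diff ?C (p + q) (cup ?C p q u v) \<sigma> =
          (\<Sum>i\<le>Suc (p + q). (-1) ^ i * (u (front_face p (?d i)) * v (back_face p q (?d i))))"
        using True by (simp add: singular_cochains_def singular_simplex_face del: sum.atMost_Suc)
      also have "\<dots> = (\<Sum>i\<le>p. (-1) ^ i * (u (singular_face (Suc p) i (front_face (Suc p) \<sigma>)) * v ?B)) +
          (\<Sum>j\<le>q. (-1) ^ Suc (p + j) * (u ?F * v (singular_face (Suc q) (Suc j) (back_face p (Suc q) \<sigma>))))"
        unfolding sum_atMost_add
        using back_face_singular_face_high[of "Suc _" q p \<sigma>]
        by (intro arg_cong2[of _ _ _ _ "(+)"] sum.cong refl)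
          (simp_all add: front_face_singular_face_low front_face_singular_face_high
            back_face_singular_face_low)
      also have "\<dots> = (\<Sum>i\<le>Suc p. (-1) ^ i * (u (singular_face (Suc p) i (front_face (Suc p) \<sigma>)) * v ?B)) +
          (-1) ^ p * (\<Sum>j\<le>Suc q. (-1) ^ j * (u ?F * v (singular_face (Suc q) j (back_face p (Suc q) \<sigma>))))"
        by (subst (2) sum.atMost_Suc_shift)
          (simp add: singular_face_front_face singular_face_back_face sum_distrib_left
            sum_negf power_add algebra_simps)
      also have "\<dots> = cup ?C (Suc p) q (diff ?C p u) v \<sigma> + (-1) ^ p * cup ?C p (Suc q) u (diff ?C q v) \<sigma>"
        using True sf sb
        by (simp add: singular_cochains_def sum_distrib_left sum_distrib_right algebra_simps
            del: sum.atMost_Suc)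
      finally show ?thesis .
    qed (simp add: singular_cochains_def)
  qed
next
  let ?C = "singular_cochains K X"
  have "diff ?C 0 (cunit ?C) = (\<lambda>_. 0)"
    by (auto simp: singular_cochains_def singular_simplex_face fun_eq_iff)
  then show "cunit ?C \<in> cocycles ?C 0"
    by (simp add: cocycles_def singular_cochains_def)
qed (simp_all add: singular_cochains_def fun_eq_iff distrib_left distrib_right sum.distrib
    sum_distrib_left mult.left_commute singular_simplex_front_face singular_simplex_back_face
    del: sum.atMost_Suc)

section \<open>The cobar complex of the adjoint representation\<close>

abbreviation adjoint_cobar ::
  "'k::field itself \<Rightarrow> ('g, 'm) monoid_scheme \<Rightarrow> ('g list \<times> 'g, 'k) cochain_algebra" where
  "adjoint_cobar K G \<equiv> cobar_complex (dual_hopf_algebra (group_algebra K G)) (adjoint_dual K G)"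

text \<open>A pair \<open>([h\<^sub>1, \<dots>, h\<^sub>n], y)\<close> is a chain of \<open>n\<close> composable morphisms in the groupoid of \<open>G\<close> acting on
  itself by conjugation, with \<open>y\<close> the object at its last vertex. This is why only the face that
  omits the last vertex changes \<open>y\<close>. The cobar complex turns out to be the cochain algebra of this
  nerve.\<close>

definition bar_simplices :: "('g, 'm) monoid_scheme \<Rightarrow> nat \<Rightarrow> ('g list \<times> 'g) set" where
  "bar_simplices G n = {(hs, y). length hs = n \<and> set hs \<subseteq> carrier G \<and> y \<in> carrier G}"

definition conj_coface ::
  "('g, 'm) monoid_scheme \<Rightarrow> nat \<Rightarrow> nat \<Rightarrow> 'g list \<times> 'g \<Rightarrow> 'g list \<times> 'g" where
  "conj_coface G n i = (\<lambda>(hs, y). (group_coface G n i hs,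
     if i = Suc n then last hs \<otimes>\<^bsub>G\<^esub> y \<otimes>\<^bsub>G\<^esub> inv\<^bsub>G\<^esub> (last hs) else y))"

text \<open>The matrix entry of the linear extension of a binary operation \<open>m\<close>; it serves both the
  multiplication of the group algebra and the adjoint action.\<close>

lemma sum_basis_vector_fibre:
  assumes "finite X" "a \<in> X" "b \<in> X"
  shows "sum (basis_vector (a, b)) {(x, y). x \<in> X \<and> y \<in> X \<and> m x y = z} =
    (if m a b = z then 1 else (0 :: 'k::field))"
proof -
  have "finite {(x, y). x \<in> X \<and> y \<in> X \<and> m x y = z}"
    by (rule finite_subset[of _ "X \<times> X"]) (use assms in auto)
  then show ?thesis
    using assms by (simp add: basis_vector_def[abs_def] sum.delta)
qed

context group
begin

definition gprod :: "'a list \<Rightarrow> 'a" where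
  "gprod hs = foldr (\<otimes>) hs \<one>"

lemma gprod_simps [simp]: "gprod [] = \<one>" "gprod (h # hs) = h \<otimes> gprod hs"
  by (simp_all add: gprod_def)

lemma gprod_closed [simp]: "set hs \<subseteq> carrier G \<Longrightarrow> gprod hs \<in> carrier G"
  by (induction hs) auto

definition conj :: "'a \<Rightarrow> 'a \<Rightarrow> 'a" where
  "conj h y = h \<otimes> y \<otimes> inv h"

lemma conj_closed [simp]: "\<lbrakk>h \<in> carrier G; y \<in> carrier G\<rbrakk> \<Longrightarrow> conj h y \<in> carrier G"
  by (simp add: conj_def)

lemma conj_one [simp]: "y \<in> carrier G \<Longrightarrow> conj \<one> y = y"
  by (simp add: conj_def)

lemma conj_conj:
  "\<lbrakk>g \<in> carrier G; h \<in> carrier G; y \<in> carrier G\<rbrakk> \<Longrightarrow> conj g (conj h y) = conj (g \<otimes> h) y"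
  by (simp add: conj_def m_assoc inv_mult_group)

lemma group_coface_closed:
  assumes "length hs = Suc n" "set hs \<subseteq> carrier G" "i \<le> Suc n"
  shows "length (group_coface G n i hs) = n" "set (group_coface G n i hs) \<subseteq> carrier G"
proof -
  show "length (group_coface G n i hs) = n"
    using assms by (auto simp: group_coface_def)
  have "set (take (i - 1) hs) \<subseteq> carrier G" "set (drop (i + 1) hs) \<subseteq> carrier G"
      "set (tl hs) \<subseteq> carrier G" "set (butlast hs) \<subseteq> carrier G"
    using assms(2) set_take_subset set_drop_subset by (fast dest: list.set_sel(2) in_set_butlastD
        | cases hs; auto dest: in_set_butlastD)+
  moreover have "hs ! (i - 1) \<in> carrier G" "hs ! i \<in> carrier G" if "i \<le> n"
    using assms that by auto
  ultimately show "set (group_coface G n i hs) \<subseteq> carrier G"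
    by (auto simp: group_coface_def)
qed

lemma conj_coface_closed:
  assumes "s \<in> bar_simplices G (Suc n)" "i \<le> Suc n"
  shows "conj_coface G n i s \<in> bar_simplices G n"
proof -
  obtain hs y where s: "s = (hs, y)" "length hs = Suc n" "set hs \<subseteq> carrier G" "y \<in> carrier G"
    using assms(1) by (auto simp: bar_simplices_def)
  then have "last hs \<in> carrier G"
    by (metis last_in_set length_0_conv nat.distinct(1) subsetD)
  then show ?thesis
    using s assms(2) group_coface_closed[of hs n i] by (simp add: conj_coface_def bar_simplices_def)
qed

context
  fixes K :: "'k::field itself"
  assumes fin: "finite (carrier G)"
begin

abbreviation (input) "HG \<equiv> dual_hopf_algebra (group_algebra K G)"
abbreviation (input) "AG \<equiv> adjoint_dual K G"

lemma dual_group_algebra_basis: "basis HG = carrier G" "abasis AG = carrier G"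
  by (simp_all add: dual_hopf_algebra_def group_algebra_def adjoint_dual_def Let_def)

text \<open>The dual of the group algebra is the algebra of functions on \<open>G\<close>: the group-like comultiplication
  dualises to the pointwise product, and the multiplication of \<open>G\<close> to \<open>f \<mapsto> ((a, b) \<mapsto> f (a b))\<close>.\<close>

lemma hmult_dual_group_algebra: "hmult HG w x = (if x \<in> carrier G then w (x, x) else 0)"
proof (cases "x \<in> carrier G")
  case True
  have "hmult HG w x = (\<Sum>p\<in>carrier G \<times> carrier G. if p = (x, x) then w p else 0)"
    unfolding dual_hopf_algebra_def group_algebra_def dual_map_def Let_def
    using True by (auto intro!: sum.cong simp: basis_vector_def)
  then show ?thesis
    using True fin by (simp add: sum.delta)
qed (simp add: dual_hopf_algebra_def group_algebra_def dual_map_def Let_def)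

lemma hunit_dual_group_algebra: "hunit HG x = (if x \<in> carrier G then 1 else 0)"
  using fin by (simp add: dual_hopf_algebra_def group_algebra_def Let_def basis_vector_def sum.delta)

lemma comult_dual_group_algebra:
  "comult HG f (a, b) = (if a \<in> carrier G \<and> b \<in> carrier G then f (a \<otimes> b) else 0)"
proof (cases "a \<in> carrier G \<and> b \<in> carrier G")
  case True
  then have "comult HG f (a, b) = (\<Sum>z\<in>carrier G. if a \<otimes> b = z then f z else 0)"
    by (simp add: dual_hopf_algebra_def group_algebra_def dual_map_def Let_def
        sum_basis_vector_fibre[OF fin, of _ _ "(\<otimes>)"] if_distrib[of "(*) _"] cong: if_cong)
  then show ?thesis
    using True fin by (simp add: sum.delta')
qed (auto simp: dual_hopf_algebra_def group_algebra_def dual_map_def Let_def)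

lemma coact_adjoint_dual:
  "coact AG f (h, y) = (if h \<in> carrier G \<and> y \<in> carrier G then f (conj h y) else 0)"
proof (cases "h \<in> carrier G \<and> y \<in> carrier G")
  case True
  then have "coact AG f (h, y) = (\<Sum>z\<in>carrier G. if conj h y = z then f z else 0)"
    by (simp add: adjoint_dual_def adjoint_action_def dual_map_def conj_def
        sum_basis_vector_fibre[OF fin, of _ _ "\<lambda>h g. h \<otimes> g \<otimes> inv h"] if_distrib[of "(*) _"]
        cong: if_cong)
  then show ?thesis
    using True fin by (simp add: sum.delta')
qed (auto simp: adjoint_dual_def dual_map_def)

lemma cochains_adjoint_cobar: "cochains (adjoint_cobar K G) n = {u. \<forall>s. s \<notin> bar_simplices G n \<longrightarrow> u s = 0}"
  by (auto simp: cobar_complex_def dual_group_algebra_basis bar_simplices_def)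

lemma cobar_coface_adjoint:
  assumes u: "u \<in> cochains (adjoint_cobar K G) n" and hs: "length hs = Suc n" and i: "i \<le> Suc n"
  shows "cobar_coface HG AG n i u (hs, y) =
    (if set hs \<subseteq> carrier G \<and> y \<in> carrier G then u (conj_coface G n i (hs, y)) else 0)"
proof -
  have u0: "u (ks, z) = 0" if "\<not> (set ks \<subseteq> carrier G \<and> z \<in> carrier G)" for ks z
    using u that by (auto simp: cochains_adjoint_cobar bar_simplices_def)
  consider "i = 0" | "0 < i" "i \<le> n" | "i = Suc n"
    using i by linarith
  then show ?thesis
  proof cases
    case 1
    with hs show ?thesis
      by (cases hs) (auto simp: cobar_coface_def hunit_dual_group_algebra conj_coface_def
          group_coface_def u0)
  next
    case 2
    then obtain j where j: "i = Suc j"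
      by (metis gr0_implies_Suc)
    have "hs = take j hs @ hs ! j # hs ! i # drop (Suc i) hs"
      using 2 hs j id_take_nth_drop[of j hs] Cons_nth_drop_Suc[of i hs]
      by (simp del: take_Suc_conv_app_nth)
    then have set: "set hs = set (take j hs) \<union> {hs ! j, hs ! i} \<union> set (drop (Suc i) hs)"
      by (metis Un_insert_left Un_insert_right insert_is_Un list.simps(15) set_append sup_bot.right_neutral)
    show ?thesis
    proof (cases "set hs \<subseteq> carrier G \<and> y \<in> carrier G")
      case True
      with 2 set show ?thesis
        by (simp add: cobar_coface_def comult_dual_group_algebra conj_coface_def group_coface_def j)
    next
      case False
      then have "u (take j hs @ hs ! j \<otimes> hs ! i # drop (Suc i) hs, y) = 0"
          if "hs ! j \<in> carrier G" "hs ! i \<in> carrier G"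
        using that set by (intro u0) auto
      with False 2 show ?thesis
        by (auto simp: cobar_coface_def comult_dual_group_algebra j)
    qed
  next
    case 3
    have "set hs = insert (last hs) (set (butlast hs))"
      using hs by (cases hs rule: rev_cases) auto
    with 3 show ?thesis
      by (auto simp: cobar_coface_def coact_adjoint_dual conj_coface_def
          group_coface_def u0 conj_def)
  qed
qed

lemma diff_adjoint_cobar:
  assumes u: "u \<in> cochains (adjoint_cobar K G) n"
  shows "diff (adjoint_cobar K G) n u s =
    (if s \<in> bar_simplices G (Suc n) then \<Sum>i\<le>Suc n. (-1) ^ i * u (conj_coface G n i s) else 0)"
proof (cases s)
  case (Pair hs y)
  with cobar_coface_adjoint[OF u, of hs] show ?thesis
    by (cases "set hs \<subseteq> carrier G \<and> y \<in> carrier G")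
      (auto simp: cobar_complex_def bar_simplices_def intro!: sum.neutral split: if_splits
        simp del: sum.atMost_Suc)
qed

text \<open>Moving a function \<open>a\<close> past the factor \<open>h\<close> replaces it by \<open>z \<mapsto> a (h z h\<inverse>)\<close>, so after all factors
  the argument is conjugated by their product.\<close>

lemma cobar_act_adjoint:
  assumes "set hs \<subseteq> carrier G" "y \<in> carrier G"
  shows "cobar_act HG AG hs a v y = a (conj (gprod hs) y) * v (hs, y)"
  using assms
proof (induction hs arbitrary: a v)
  case (Cons h hs)
  then show ?case
    by (simp add: hmult_dual_group_algebra coact_adjoint_dual conj_conj)
qed (simp add: adjoint_dual_def)

lemma cobar_act_adjoint_outside:
  assumes "\<not> (set hs \<subseteq> carrier G \<and> y \<in> carrier G)" "\<And>ks. y \<notin> carrier G \<Longrightarrow> v (ks, y) = 0"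
  shows "cobar_act HG AG hs a v y = 0"
  using assms
proof (induction hs arbitrary: a v)
  case (Cons h hs)
  then show ?case
    by (auto simp: hmult_dual_group_algebra)
qed (simp add: adjoint_dual_def)

lemma cup_adjoint_cobar:
  assumes u: "u \<in> cochains (adjoint_cobar K G) p" and v: "v \<in> cochains (adjoint_cobar K G) q"
  shows "cup (adjoint_cobar K G) p q u v (hs, y) =
    (if (hs, y) \<in> bar_simplices G (p + q)
     then u (take p hs, conj (gprod (drop p hs)) y) * v (drop p hs, y) else 0)"
proof -
  have set: "set hs = set (take p hs) \<union> set (drop p hs)"
    by (metis append_take_drop_id set_append)
  have u0: "u (ks, z) = 0" if "\<not> set ks \<subseteq> carrier G" for ks z
    using u that by (auto simp: cochains_adjoint_cobar bar_simplices_def)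
  have v0: "v (ks, z) = 0" if "z \<notin> carrier G" for ks z
    using v that by (auto simp: cochains_adjoint_cobar bar_simplices_def)
  show ?thesis
  proof (cases "set hs \<subseteq> carrier G \<and> y \<in> carrier G")
    case True
    with set show ?thesis
      by (simp add: cobar_complex_def bar_simplices_def cobar_act_adjoint)
  next
    case False
    have "cobar_act HG AG (drop p hs) (\<lambda>z. u (take p hs, z)) v y = 0"
    proof (cases "set (drop p hs) \<subseteq> carrier G \<and> y \<in> carrier G")
      case True
      with False set have "\<not> set (take p hs) \<subseteq> carrier G"
        by auto
      with True show ?thesis
        by (simp add: cobar_act_adjoint u0)
    next
      case False
      then show ?thesis
        by (rule cobar_act_adjoint_outside) (rule v0)
    qed
    with False show ?thesis
      by (auto simp: cobar_complex_def bar_simplices_def)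
  qed
qed

lemma cunit_adjoint_cobar:
  "cunit (adjoint_cobar K G) s = (if s \<in> bar_simplices G 0 then 1 else 0)"
  by (cases s) (auto simp: cobar_complex_def adjoint_dual_def bar_simplices_def)

end

end

section \<open>Coned covers of the singular simplices\<close>

text \<open>The combinatorial structure of the lifted loops. The sets \<open>X n\<close> carry faces and an action of \<open>G\<close>
  whose orbits are the fibres of a projection onto the singular \<open>n\<close>-simplices of \<open>L\<close>. The monodromy
  \<open>mon\<close> is constant along faces and is conjugated by the action; \<open>col i\<close> is an equivariant labelling
  of the \<open>i\<close>-th vertex by an element of \<open>G\<close>. The cone on \<open>x\<close> is the join of \<open>x\<close> with a new vertex of
  colour \<open>\<one>\<close> in front: its zeroth face is \<open>x\<close> and its other faces are the cones on the faces of
  \<open>x\<close>, where the cone on the empty simplex is the vertex \<open>apex (mon x)\<close>. Compatibility of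
  cones with faces is a simplicial form of contractibility of each part of constant monodromy.\<close>

locale coned_cover = group G for G (structure) +
  fixes L :: "'l topology"
    and X :: "nat \<Rightarrow> 'x set"
    and face :: "nat \<Rightarrow> nat \<Rightarrow> 'x \<Rightarrow> 'x"
    and act :: "nat \<Rightarrow> 'a \<Rightarrow> 'x \<Rightarrow> 'x"
    and mon :: "'x \<Rightarrow> 'a"
    and col :: "nat \<Rightarrow> 'x \<Rightarrow> 'a"
    and cone :: "nat \<Rightarrow> 'x \<Rightarrow> 'x"
    and apex :: "'a \<Rightarrow> 'x"
    and proj :: "nat \<Rightarrow> 'x \<Rightarrow> (nat \<Rightarrow> real) \<Rightarrow> 'l"
  assumes face_closed: "\<lbrakk>x \<in> X (Suc n); i \<le> Suc n\<rbrakk> \<Longrightarrow> face (Suc n) i x \<in> X n"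
    and face_face_0: "\<lbrakk>x \<in> X (Suc (Suc n)); i \<le> Suc n\<rbrakk> \<Longrightarrow>
      face (Suc n) 0 (face (Suc (Suc n)) (Suc i) x) = face (Suc n) i (face (Suc (Suc n)) 0 x)"
    and act_closed: "\<lbrakk>x \<in> X n; g \<in> carrier G\<rbrakk> \<Longrightarrow> act n g x \<in> X n"
    and act_one: "x \<in> X n \<Longrightarrow> act n \<one> x = x"
    and act_act: "\<lbrakk>x \<in> X n; g \<in> carrier G; h \<in> carrier G\<rbrakk> \<Longrightarrow> act n g (act n h x) = act n (g \<otimes> h) x"
    and face_act: "\<lbrakk>x \<in> X (Suc n); g \<in> carrier G; i \<le> Suc n\<rbrakk> \<Longrightarrow>
      face (Suc n) i (act (Suc n) g x) = act n g (face (Suc n) i x)"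
    and mon_closed: "x \<in> X n \<Longrightarrow> mon x \<in> carrier G"
    and mon_face: "\<lbrakk>x \<in> X (Suc n); i \<le> Suc n\<rbrakk> \<Longrightarrow> mon (face (Suc n) i x) = mon x"
    and mon_act: "\<lbrakk>x \<in> X n; g \<in> carrier G\<rbrakk> \<Longrightarrow> mon (act n g x) = conj g (mon x)"
    and col_closed: "\<lbrakk>x \<in> X n; i \<le> n\<rbrakk> \<Longrightarrow> col i x \<in> carrier G"
    and col_face: "\<lbrakk>x \<in> X (Suc n); j \<le> Suc n; i \<le> n\<rbrakk> \<Longrightarrow>
      col i (face (Suc n) j x) = col (if i < j then i else Suc i) x"
    and col_act: "\<lbrakk>x \<in> X n; g \<in> carrier G; i \<le> n\<rbrakk> \<Longrightarrow> col i (act n g x) = g \<otimes> col i x"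
    and cone_closed: "x \<in> X n \<Longrightarrow> cone n x \<in> X (Suc n)"
    and mon_cone: "x \<in> X n \<Longrightarrow> mon (cone n x) = mon x"
    and face_0_cone: "x \<in> X n \<Longrightarrow> face (Suc n) 0 (cone n x) = x"
    and face_Suc_cone: "\<lbrakk>x \<in> X (Suc n); i \<le> Suc n\<rbrakk> \<Longrightarrow>
      face (Suc (Suc n)) (Suc i) (cone (Suc n) x) = cone n (face (Suc n) i x)"
    and face_1_cone: "x \<in> X 0 \<Longrightarrow> face (Suc 0) (Suc 0) (cone 0 x) = apex (mon x)"
    and col_0_cone: "x \<in> X n \<Longrightarrow> col 0 (cone n x) = \<one>"
    and apex_closed: "g \<in> carrier G \<Longrightarrow> apex g \<in> X 0"
    and mon_apex: "g \<in> carrier G \<Longrightarrow> mon (apex g) = g"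
    and proj_simplex: "x \<in> X n \<Longrightarrow> singular_simplex n L (proj n x)"
    and proj_surj: "singular_simplex n L \<sigma> \<Longrightarrow> \<exists>x\<in>X n. proj n x = \<sigma>"
    and proj_eq_imp: "\<lbrakk>x \<in> X n; y \<in> X n; proj n x = proj n y\<rbrakk> \<Longrightarrow> \<exists>g\<in>carrier G. y = act n g x"
    and proj_act: "\<lbrakk>x \<in> X n; g \<in> carrier G\<rbrakk> \<Longrightarrow> proj n (act n g x) = proj n x"
    and proj_face: "\<lbrakk>x \<in> X (Suc n); i \<le> Suc n\<rbrakk> \<Longrightarrow>
      proj n (face (Suc n) i x) = singular_face (Suc n) i (proj (Suc n) x)"
begin

subsection \<open>The map to the bar construction\<close>

text \<open>Two consecutive vertices of colours \<open>c, d\<close> give \<open>c\<inverse> d\<close>, and the monodromy is transported to the last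
  vertex. Both are invariant under \<open>G\<close>, so this descends to the singular simplices of \<open>L\<close>.\<close>

definition theta :: "nat \<Rightarrow> 'x \<Rightarrow> 'a list \<times> 'a" where
  "theta n x = (map (\<lambda>i. inv (col i x) \<otimes> col (Suc i) x) [0..<n], conj (inv (col n x)) (mon x))"

lemma inv_mult_cancel: "\<lbrakk>x \<in> carrier G; y \<in> carrier G; z \<in> carrier G\<rbrakk> \<Longrightarrow>
    (inv x \<otimes> y) \<otimes> (inv y \<otimes> z) = inv x \<otimes> z"
  by (metis inv_closed m_assoc m_closed r_inv l_one)

lemma theta_closed: "x \<in> X n \<Longrightarrow> theta n x \<in> bar_simplices G n"
  by (auto simp: theta_def bar_simplices_def col_closed mon_closed)

lemma theta_act:
  assumes "x \<in> X n" "g \<in> carrier G"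
  shows "theta n (act n g x) = theta n x"
proof -
  have "inv (g \<otimes> a) \<otimes> (g \<otimes> b) = inv a \<otimes> b" if "a \<in> carrier G" "b \<in> carrier G" for a b
  proof -
    have "inv g \<otimes> (g \<otimes> b) = b"
      using assms(2) that by (simp flip: m_assoc)
    with assms(2) that show ?thesis
      by (simp add: inv_mult_group m_assoc)
  qed
  with assms show ?thesis
    by (auto simp: theta_def col_act mon_act col_closed conj_conj mon_closed inv_mult_group m_assoc)
qed

text \<open>Omitting an inner vertex of colour \<open>d\<close> between \<open>c\<close> and \<open>e\<close> multiplies its two labels,
  \<open>(c\<inverse> d) (d\<inverse> e) = c\<inverse> e\<close>; omitting the last one transports the monodromy back along the last edge.\<close>

lemma theta_face:
  assumes x: "x \<in> X (Suc n)" and i: "i \<le> Suc n"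
  shows "theta n (face (Suc n) i x) = conj_coface G n i (theta (Suc n) x)"
proof -
  let ?h = "\<lambda>i. inv (col i x) \<otimes> col (Suc i) x"
  have fst: "map (\<lambda>j. inv (col j (face (Suc n) i x)) \<otimes> col (Suc j) (face (Suc n) i x)) [0..<n] =
      group_coface G n i (map ?h [0..<Suc n])" (is "?l = ?r")
  proof (rule nth_equalityI)
    show len: "length ?l = length ?r"
      using i by (auto simp: group_coface_def)
    fix j assume "j < length ?l"
    then have j: "j < n"
      by simp
    have l: "?l ! j = inv (col (if j < i then j else Suc j) x) \<otimes>
        col (if Suc j < i then Suc j else Suc (Suc j)) x"
      using x i j by (simp add: col_face)
    consider "i = 0" | "0 < i" "i \<le> n" | "i = Suc n"
      using i by linarith
    then show "?l ! j = ?r ! j"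
    proof cases
      case 1
      with j show ?thesis
        unfolding l by (simp add: group_coface_def nth_tl del: upt_Suc)
    next
      case 2
      consider "Suc j < i" | "j = i - 1" | "i \<le> j"
        by linarith
      then show ?thesis
      proof cases
        case 1
        then have "j < i - 1"
          by simp
        with 1 2 j show ?thesis
          unfolding l by (simp add: group_coface_def nth_append del: upt_Suc)
      next
        case j': 2
        with 2 obtain k where k: "i = Suc k" "j = k"
          by (metis diff_Suc_1 gr0_implies_Suc)
        with 2 j x show ?thesis
          unfolding l by (simp add: group_coface_def nth_append inv_mult_cancel col_closed del: upt_Suc)
      next
        case 3
        with 2 j show ?thesis
          unfolding l by (auto simp: group_coface_def nth_append nth_Cons' Suc_diff_le simp del: upt_Suc)
      qed
    next
      case 3
      with j show ?thesis
        unfolding l by (simp add: group_coface_def nth_butlast del: upt_Suc)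
    qed
  qed
  have "conj (inv (col n (face (Suc n) i x))) (mon x) =
      (if i = Suc n then conj (inv (col n x) \<otimes> col (Suc n) x) (conj (inv (col (Suc n) x)) (mon x))
       else conj (inv (col (Suc n) x)) (mon x))"
    using x i by (auto simp: col_face conj_conj col_closed mon_closed m_assoc)
  with fst show ?thesis
    using x i by (simp add: theta_def conj_coface_def mon_face conj_def del: upt_Suc) (simp add: upt_Suc)
qed

text \<open>Front faces lift because they are iterated last faces; back faces are iterated zeroth faces.\<close>

lemma front_face_proj:
  assumes "x \<in> X (p + q)"
  shows "\<exists>z\<in>X p. proj p z = front_face p (proj (p + q) x) \<and> mon z = mon x \<and> (\<forall>i\<le>p. col i z = col i x)"
  using assms
proof (induction q arbitrary: x)
  case 0
  moreover have "front_face p (proj p x) = proj p x" if "x \<in> X p"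
    using proj_simplex[OF that] by (simp add: front_face_def singular_simplex_def extensional_restrict)
  ultimately show ?case
    by auto
next
  case (Suc q)
  let ?y = "face (Suc (p + q)) (Suc (p + q)) x"
  have "?y \<in> X (p + q)"
    using Suc.prems by (simp add: face_closed)
  from Suc.IH[OF this] Suc.prems show ?case
    by (simp add: proj_face front_face_singular_face_high mon_face col_face)
qed

lemma back_face_proj:
  assumes "x \<in> X (p + q)"
  shows "\<exists>z\<in>X q. proj q z = back_face p q (proj (p + q) x) \<and> mon z = mon x \<and>
    (\<forall>i\<le>q. col i z = col (p + i) x)"
  using assms
proof (induction p arbitrary: x)
  case 0
  moreover have "back_face 0 q (proj q x) = proj q x" if "x \<in> X q"
    using proj_simplex[OF that] by (simp add: back_face_def singular_simplex_def extensional_restrict)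
  ultimately show ?case
    by auto
next
  case (Suc p)
  let ?y = "face (Suc (p + q)) 0 x"
  have "?y \<in> X (p + q)"
    using Suc.prems by (simp add: face_closed)
  from Suc.IH[OF this] Suc.prems show ?case
    by (simp add: proj_face back_face_singular_face_low mon_face col_face)
qed

subsection \<open>The map from the bar construction\<close>

text \<open>A section of \<open>theta\<close>: the simplex with vertex colours \<open>1, h\<^sub>1, h\<^sub>1 h\<^sub>2, \<dots>\<close> is built by coning from the
  last vertex to the first. Normalising the first colour to \<open>1\<close> picks one simplex in each orbit.\<close>

primrec psi :: "'a list \<Rightarrow> 'a \<Rightarrow> 'x" where
  "psi [] y = apex y"
| "psi (h # hs) y = cone (length hs) (act (length hs) h (psi hs y))"

lemma psi_closed: "\<lbrakk>set hs \<subseteq> carrier G; y \<in> carrier G\<rbrakk> \<Longrightarrow> psi hs y \<in> X (length hs)"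
  by (induction hs) (simp_all add: apex_closed cone_closed act_closed)

lemma col_0_apex:
  assumes "g \<in> carrier G"
  shows "col 0 (apex g) = \<one>"
  using face_1_cone[OF apex_closed[OF assms]] col_face[OF cone_closed[OF apex_closed[OF assms]], of "Suc 0" 0]
    col_0_cone[OF apex_closed[OF assms]] by (simp add: mon_apex assms)

lemma col_0_psi: "\<lbrakk>set hs \<subseteq> carrier G; y \<in> carrier G\<rbrakk> \<Longrightarrow> col 0 (psi hs y) = \<one>"
  by (cases hs) (simp_all add: col_0_apex col_0_cone act_closed psi_closed)

lemma col_Suc_cone: "\<lbrakk>x \<in> X n; i \<le> n\<rbrakk> \<Longrightarrow> col (Suc i) (cone n x) = col i x"
  using col_face[OF cone_closed, of x n 0 i] by (simp add: face_0_cone)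

lemma theta_psi: "\<lbrakk>set hs \<subseteq> carrier G; y \<in> carrier G\<rbrakk> \<Longrightarrow> theta (length hs) (psi hs y) = (hs, y)"
proof (induction hs)
  case Nil
  then show ?case
    by (simp add: theta_def col_0_apex mon_apex)
next
  case (Cons h hs)
  let ?n = "length hs"
  let ?z = "act ?n h (psi hs y)"
  have c: "psi hs y \<in> X ?n" "?z \<in> X ?n" "h \<in> carrier G"
    using Cons.prems by (simp_all add: psi_closed act_closed)
  have "theta ?n (psi hs y) = (hs, y)"
    using Cons by simp
  then have z: "theta ?n ?z = (hs, y)"
    using c by (simp add: theta_act)
  have "map (\<lambda>i. inv (col i (cone ?n ?z)) \<otimes> col (Suc i) (cone ?n ?z)) [0..<Suc ?n] =
      h # map (\<lambda>i. inv (col i ?z) \<otimes> col (Suc i) ?z) [0..<?n]"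
  proof (rule nth_equalityI)
    fix i assume "i < length (map (\<lambda>i. inv (col i (cone ?n ?z)) \<otimes> col (Suc i) (cone ?n ?z)) [0..<Suc ?n])"
    then show "map (\<lambda>i. inv (col i (cone ?n ?z)) \<otimes> col (Suc i) (cone ?n ?z)) [0..<Suc ?n] ! i =
        (h # map (\<lambda>i. inv (col i ?z) \<otimes> col (Suc i) ?z) [0..<?n]) ! i"
      using c Cons.prems
      by (cases i) (simp_all add: col_0_cone col_Suc_cone col_act col_0_psi del: upt_Suc)
  qed simp
  with z c show ?case
    by (simp add: theta_def mon_cone col_Suc_cone del: upt_Suc)
qed

text \<open>The faces of \<open>psi hs y\<close> other than the zeroth are again normalised, so they agree with \<open>psi\<close> of the
  coface on the nose. The zeroth face loses the vertex of colour \<open>1\<close> and agrees only up to the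
  action, that is, after projection.\<close>

lemma face_psi:
  assumes "length hs = Suc n" "set hs \<subseteq> carrier G" "y \<in> carrier G" "0 < i" "i \<le> Suc n"
  shows "face (Suc n) i (psi hs y) = case_prod psi (conj_coface G n i (hs, y))"
  using assms
proof (induction n arbitrary: hs i)
  case 0
  then obtain h where "hs = [h]" "i = Suc 0"
    by (auto simp: length_Suc_conv)
  with 0 show ?case
    by (simp add: face_1_cone act_closed apex_closed mon_act mon_apex conj_coface_def
        group_coface_def conj_def)
next
  case (Suc n)
  then obtain h h' ks j where hs: "hs = h # h' # ks" and i: "i = Suc j" and ks: "length ks = n"
    by (auto simp: length_Suc_conv gr0_conv_Suc)
  have c: "psi (h' # ks) y \<in> X (Suc n)" "psi ks y \<in> X n" "h \<in> carrier G" "h' \<in> carrier G"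
    using Suc.prems hs ks psi_closed[of "h' # ks" y] psi_closed[of ks y] by simp_all
  have "face (Suc (Suc n)) i (psi hs y) = cone n (act n h (face (Suc n) j (psi (h' # ks) y)))"
    using c Suc.prems unfolding hs i psi.simps(2)[of h]
    by (simp add: face_Suc_cone face_act act_closed ks del: psi.simps)
  also have "\<dots> = case_prod psi (conj_coface G (Suc n) i (hs, y))"
  proof (cases j)
    case 0
    with c show ?thesis
      by (simp add: hs i ks face_0_cone act_closed act_act conj_coface_def group_coface_def)
  next
    case (Suc k)
    then have "face (Suc n) j (psi (h' # ks) y) = case_prod psi (conj_coface G n j (h' # ks, y))"
      using Suc.IH[of "h' # ks" j] Suc.prems hs i ks by simp
    moreover have "length (group_coface G n j (h' # ks)) = n"
      using group_coface_closed(1)[of "h' # ks" n j] Suc.prems hs i ks by simp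
    moreover have "group_coface G (Suc n) i hs = h # group_coface G n j (h' # ks)"
      using Suc by (auto simp: hs i ks group_coface_def)
    ultimately show ?thesis
      by (simp add: conj_coface_def i hs)
  qed
  finally show ?case .
qed

lemma proj_face_psi:
  assumes "(hs, y) \<in> bar_simplices G (Suc n)" "i \<le> Suc n"
  shows "proj n (face (Suc n) i (psi hs y)) = proj n (case_prod psi (conj_coface G n i (hs, y)))"
proof (cases "i = 0")
  case True
  from assms(1) obtain h ks where "hs = h # ks" "length ks = n"
    by (cases hs) (auto simp: bar_simplices_def)
  with True assms show ?thesis
    using psi_closed[of ks y]
    by (simp add: bar_simplices_def face_0_cone act_closed proj_act conj_coface_def group_coface_def)
next
  case False
  with assms show ?thesis
    by (simp add: face_psi bar_simplices_def)
qed

subsection \<open>The cochain homotopy\<close>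

text \<open>The cone with a vertex of arbitrary colour \<open>c\<close>, obtained by conjugating the cone operator with the
  action of \<open>c\<close>, which moves the vertex of colour \<open>1\<close>.\<close>

definition gcone :: "nat \<Rightarrow> 'a \<Rightarrow> 'x \<Rightarrow> 'x" where
  "gcone n c x = act (Suc n) c (cone n (act n (inv c) x))"

lemma gcone_closed: "\<lbrakk>x \<in> X n; c \<in> carrier G\<rbrakk> \<Longrightarrow> gcone n c x \<in> X (Suc n)"
  by (simp add: gcone_def act_closed cone_closed)

lemma act_inv_cancel: "\<lbrakk>x \<in> X n; c \<in> carrier G\<rbrakk> \<Longrightarrow> act n c (act n (inv c) x) = x"
  by (simp add: act_act act_one)

lemma face_0_gcone: "\<lbrakk>x \<in> X n; c \<in> carrier G\<rbrakk> \<Longrightarrow> face (Suc n) 0 (gcone n c x) = x"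
  by (simp add: gcone_def face_act cone_closed act_closed face_0_cone act_inv_cancel)

lemma face_Suc_gcone:
  "\<lbrakk>x \<in> X (Suc n); c \<in> carrier G; i \<le> Suc n\<rbrakk> \<Longrightarrow>
    face (Suc (Suc n)) (Suc i) (gcone (Suc n) c x) = gcone n c (face (Suc n) i x)"
  by (simp add: gcone_def face_act cone_closed act_closed face_Suc_cone)

lemma face_1_gcone:
  "\<lbrakk>x \<in> X 0; c \<in> carrier G\<rbrakk> \<Longrightarrow>
    face (Suc 0) (Suc 0) (gcone 0 c x) = act 0 c (apex (conj (inv c) (mon x)))"
  by (simp add: gcone_def face_act cone_closed act_closed face_1_cone mon_act)

lemma gcone_act:
  "\<lbrakk>x \<in> X n; c \<in> carrier G; g \<in> carrier G\<rbrakk> \<Longrightarrow> gcone n (g \<otimes> c) (act n g x) = act (Suc n) g (gcone n c x)"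
  by (simp add: gcone_def act_act act_closed cone_closed inv_mult_group m_assoc)

definition delta :: "nat \<Rightarrow> ('x \<Rightarrow> 'k::field) \<Rightarrow> 'x \<Rightarrow> 'k" where
  "delta n u x = (if n = 0 then 0 else \<Sum>i\<le>n. (-1) ^ i * u (face n i x))"

text \<open>If \<open>x\<close> has vertex colours \<open>c\<^sub>0, \<dots>, c\<^sub>n\<close>, unfolding the recursion gives the alternating sum over \<open>i\<close> of
  \<open>u\<close> at the join of the model vertices of colours \<open>c\<^sub>0, \<dots>, c\<^sub>i\<close> with the back face of \<open>x\<close> on the
  vertices \<open>i, \<dots>, n\<close>: the prism operator from \<open>x\<close> to the model simplex of the same colours.
  The index is shifted, so \<open>prism (Suc n)\<close> maps cochains on \<open>X (Suc n)\<close> to cochains on \<open>X n\<close>.\<close>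

primrec prism :: "nat \<Rightarrow> ('x \<Rightarrow> 'k::field) \<Rightarrow> 'x \<Rightarrow> 'k" where
  "prism 0 u x = 0"
| "prism (Suc n) u x =
     u (gcone n (col 0 x) x) - prism n (\<lambda>z. u (gcone n (col 0 x) z)) (face n 0 x)"

text \<open>The value of \<open>u\<close> at the model simplex with the colours and monodromy of \<open>x\<close>. As \<open>psi\<close> produces first
  colour \<open>1\<close>, its result is translated back by the first colour of \<open>x\<close>.\<close>

definition retract_cochain :: "nat \<Rightarrow> ('x \<Rightarrow> 'k::field) \<Rightarrow> 'x \<Rightarrow> 'k" where
  "retract_cochain n u x = u (act n (col 0 x) (case_prod psi (theta n x)))"

text \<open>Evaluating a coboundary on a cone: coning with a fixed vertex is a contracting homotopy.\<close>

lemma delta_gcone_0: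
  "\<lbrakk>x \<in> X 0; c \<in> carrier G\<rbrakk> \<Longrightarrow>
    delta (Suc 0) u (gcone 0 c x) = u x - u (act 0 c (apex (conj (inv c) (mon x))))"
  by (simp add: delta_def face_0_gcone face_1_gcone)

lemma delta_gcone_Suc:
  assumes "x \<in> X (Suc n)" "c \<in> carrier G"
  shows "delta (Suc (Suc n)) u (gcone (Suc n) c x) = u x - delta (Suc n) (\<lambda>z. u (gcone n c z)) x"
proof -
  have "delta (Suc (Suc n)) u (gcone (Suc n) c x) =
      u x + (\<Sum>i\<le>Suc n. (-1) ^ Suc i * u (gcone n c (face (Suc n) i x)))"
    unfolding delta_def sum.atMost_Suc_shift[of _ "Suc n"]
    using assms by (simp add: face_0_gcone face_Suc_gcone del: sum.atMost_Suc)
  then show ?thesis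
    by (simp add: delta_def sum_negf del: sum.atMost_Suc)
qed

lemma prism_cong:
  assumes "\<And>z. z \<in> X n \<Longrightarrow> u z = v z" "x \<in> X (n - 1)"
  shows "prism n u x = prism n v x"
  using assms
proof (induction n arbitrary: u v x)
  case (Suc n)
  have "prism n (\<lambda>z. u (gcone n (col 0 x) z)) (face n 0 x) = prism n (\<lambda>z. v (gcone n (col 0 x) z)) (face n 0 x)"
  proof (cases n)
    case (Suc m)
    with Suc.prems show ?thesis
      by (intro Suc.IH) (auto intro!: Suc.prems gcone_closed face_closed col_closed)
  qed simp
  with Suc.prems show ?case
    by (auto intro!: Suc.prems gcone_closed col_closed)
qed simp

lemma prism_diff: "prism n (\<lambda>z. u z - v z) x = prism n u x - prism n v x"
  by (induction n arbitrary: u v x) simp_all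

lemma prism_zero: "prism n (\<lambda>z. 0) x = 0"
  by (induction n arbitrary: x) simp_all

text \<open>The prism operator is equivariant, because the colours used for coning move along with \<open>x\<close>. Hence it
  sends invariant cochains to invariant cochains.\<close>

lemma prism_act:
  assumes "\<And>z. z \<in> X (Suc n) \<Longrightarrow> u (act (Suc n) g z) = v z" "x \<in> X n" "g \<in> carrier G"
  shows "prism (Suc n) u (act n g x) = prism (Suc n) v x"
  using assms
proof (induction n arbitrary: u v x)
  case 0
  then show ?case
    by (simp add: col_act col_closed gcone_act gcone_closed)
next
  case (Suc n)
  have "prism (Suc n) (\<lambda>z. u (gcone (Suc n) (g \<otimes> col 0 x) z)) (act n g (face (Suc n) 0 x)) =
      prism (Suc n) (\<lambda>z. v (gcone (Suc n) (col 0 x) z)) (face (Suc n) 0 x)"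
    using Suc.prems
    by (intro Suc.IH) (simp_all add: gcone_act col_closed face_closed gcone_closed)
  with Suc.prems show ?case
    by (simp add: col_act col_closed gcone_act gcone_closed face_act del: prism.simps(2)
        add: prism.simps(2)[of "Suc n"])
qed

text \<open>The induction peels off vertex 0, of colour \<open>c\<close>. Write \<open>v\<close> for \<open>u\<close> composed with the cone of colour
  \<open>c\<close>. All faces of \<open>x\<close> except the zeroth share this vertex, so that on them the recursion for the
  prism uses the same \<open>v\<close>; the remaining terms form the homotopy formula for \<open>v\<close> at the zeroth face.\<close>

lemma prism_homotopy:
  assumes "x \<in> X n"
  shows "prism (Suc n) (delta (Suc n) u) x + delta n (prism n u) x = u x - retract_cochain n u x"
  using assms
proof (induction n arbitrary: u x)
  case 0
  then show ?case
    by (simp add: delta_gcone_0 col_closed retract_cochain_def theta_def)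
       (simp add: delta_def)
next
  case (Suc n)
  define c where "c = col 0 x"
  define v where "v = (\<lambda>z. u (gcone n c z))"
  let ?y = "face (Suc n) 0 x"
  have c: "c \<in> carrier G" and y: "?y \<in> X n"
    using Suc.prems by (simp_all add: c_def col_closed face_closed)
  have "prism (Suc n) (\<lambda>z. delta (Suc (Suc n)) u (gcone (Suc n) c z)) ?y =
      prism (Suc n) (\<lambda>z. u z - delta (Suc n) v z) ?y"
    unfolding v_def using y c by (intro prism_cong) (auto simp: delta_gcone_Suc)
  \<comment> \<open>The prism of the coboundary, with the cone on vertex 0 split off.\<close>
  then have 1: "prism (Suc (Suc n)) (delta (Suc (Suc n)) u) x =
      u x - delta (Suc n) v x - (prism (Suc n) u ?y - prism (Suc n) (delta (Suc n) v) ?y)"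
    using Suc.prems c by (simp only: prism.simps(2)[of "Suc n"] prism_diff
        delta_gcone_Suc flip: c_def v_def)
  have face: "prism (Suc n) u (face (Suc n) (Suc i) x) =
      v (face (Suc n) (Suc i) x) - prism n v (face n 0 (face (Suc n) (Suc i) x))" if "i \<le> n" for i
    using that Suc.prems by (simp add: col_face v_def flip: c_def)
  have "delta n (prism n v) ?y = (\<Sum>i\<le>n. (-1) ^ i * prism n v (face n 0 (face (Suc n) (Suc i) x)))"
  proof (cases n)
    case (Suc m)
    with Suc.prems show ?thesis
      by (simp add: delta_def face_face_0 del: sum.atMost_Suc)
  qed (simp add: delta_def)
  \<comment> \<open>The coboundary of the prism, with the zeroth face split off.\<close>
  then have 2: "delta (Suc n) (prism (Suc n) u) x =
      prism (Suc n) u ?y + (delta (Suc n) v x - v ?y) + delta n (prism n v) ?y"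
    unfolding delta_def[of "Suc n"] sum.atMost_Suc_shift[of _ n]
    by (simp add: face sum_negf algebra_simps sum_subtractf del: prism.simps sum.atMost_Suc)
  have IH: "prism (Suc n) (delta (Suc n) v) ?y + delta n (prism n v) ?y = v ?y - retract_cochain n v ?y"
    by (rule Suc.IH[OF y])
  \<comment> \<open>The model simplex of \<open>x\<close> is the cone of colour \<open>c\<close> on that of the zeroth face.\<close>
  have 3: "retract_cochain (Suc n) u x = retract_cochain n v ?y"
  proof -
    let ?c = "col (Suc 0) x"
    obtain hs z where hs: "theta n ?y = (hs, z)"
      by fastforce
    have "theta (Suc n) x = ((inv c \<otimes> ?c) # hs, z)"
    proof -
      have "map (\<lambda>i. inv (col i x) \<otimes> col (Suc i) x) [0..<Suc n] =
          (inv c \<otimes> ?c) # map (\<lambda>i. inv (col (Suc i) x) \<otimes> col (Suc (Suc i)) x) [0..<n]"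
        by (simp add: c_def upt_conv_Cons map_Suc_upt[symmetric] del: upt_Suc map_upt_Suc map_Suc_upt)
      with hs Suc.prems show ?thesis
        by (auto simp: theta_def col_face mon_face simp del: upt_Suc cong: map_cong)
    qed
    moreover have "length hs = n" "psi hs z \<in> X n" "?c \<in> carrier G"
      using theta_closed[OF y] hs psi_closed[of hs z] Suc.prems
      by (auto simp: bar_simplices_def col_closed)
    ultimately show ?thesis
      using c hs Suc.prems
      by (simp add: retract_cochain_def v_def gcone_def act_act act_closed col_face flip: c_def)
  qed
  show ?case
    unfolding 1 2 3 using IH by (simp add: algebra_simps del: prism.simps)
qed


subsection \<open>Comparison of the cochain algebras\<close>

text \<open>Pull-back of cochains along \<open>theta\<close> and \<open>psi\<close>. A singular simplex is first lifted to \<open>X\<close>; the choice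
  of the lift does not matter as \<open>theta\<close> is invariant.\<close>

definition pull :: "nat \<Rightarrow> ('a list \<times> 'a \<Rightarrow> 'k::field) \<Rightarrow> ((nat \<Rightarrow> real) \<Rightarrow> 'l) \<Rightarrow> 'k" where
  "pull n w \<sigma> = (if singular_simplex n L \<sigma> then w (theta n (SOME x. x \<in> X n \<and> proj n x = \<sigma>)) else 0)"

definition push :: "nat \<Rightarrow> (((nat \<Rightarrow> real) \<Rightarrow> 'l) \<Rightarrow> 'k::field) \<Rightarrow> 'a list \<times> 'a \<Rightarrow> 'k" where
  "push n v s = (if s \<in> bar_simplices G n then v (proj n (case_prod psi s)) else 0)"

lemma invariant_choice:
  assumes "\<And>z g. \<lbrakk>z \<in> X n; g \<in> carrier G\<rbrakk> \<Longrightarrow> F (act n g z) = F z" "x \<in> X n"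
  shows "F (SOME z. z \<in> X n \<and> proj n z = proj n x) = F x"
proof -
  have "(SOME z. z \<in> X n \<and> proj n z = proj n x) \<in> X n \<and>
      proj n (SOME z. z \<in> X n \<and> proj n z = proj n x) = proj n x"
    by (rule someI[of "\<lambda>z. z \<in> X n \<and> proj n z = proj n x" x]) (use assms(2) in simp)
  then show ?thesis
    using assms proj_eq_imp[OF assms(2)] by metis
qed

lemma pull_proj: "x \<in> X n \<Longrightarrow> pull n w (proj n x) = w (theta n x)"
  using invariant_choice[of n "\<lambda>x. w (theta n x)" x] by (simp add: pull_def proj_simplex theta_act)

lemma pull_eqI:
  assumes "\<And>x. x \<in> X n \<Longrightarrow> w (theta n x) = v (proj n x)" "\<And>\<sigma>. \<not> singular_simplex n L \<sigma> \<Longrightarrow> v \<sigma> = 0"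
  shows "pull n w = v"
proof
  fix \<sigma>
  show "pull n w \<sigma> = v \<sigma>"
  proof (cases "singular_simplex n L \<sigma>")
    case True
    then show ?thesis
      using proj_surj[OF True] assms(1) pull_proj by metis
  qed (simp add: pull_def assms(2))
qed

context
  fixes K :: "'k::field itself"
  assumes fin: "finite (carrier G)"
begin

abbreviation (input) "CG \<equiv> adjoint_cobar K G"
abbreviation (input) "CL \<equiv> singular_cochains K L"

lemma mem_cochains_CL: "u \<in> cochains CL n \<longleftrightarrow> (\<forall>\<sigma>. \<not> singular_simplex n L \<sigma> \<longrightarrow> u \<sigma> = 0)"
  by (simp add: singular_cochains_def)

text \<open>The edges after vertex \<open>p\<close> multiply to \<open>c\<^sub>p\<inverse> c\<^sub>p\<^sub>+\<^sub>q\<close>, which transports the monodromy from the last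
  vertex to vertex \<open>p\<close>. This is the conjugation in the cup product of the cobar complex.\<close>

lemma theta_front:
  assumes "x \<in> X (p + q)" "z \<in> X p" "mon z = mon x" "\<And>i. i \<le> p \<Longrightarrow> col i z = col i x"
    and "theta (p + q) x = (hs, y)"
  shows "theta p z = (take p hs, conj (gprod (drop p hs)) y)"
proof -
  have hs: "hs = map (\<lambda>i. inv (col i x) \<otimes> col (Suc i) x) [0..<p + q]"
      and y: "y = conj (inv (col (p + q) x)) (mon x)"
    using assms(5) by (auto simp: theta_def)
  have "gprod (map (\<lambda>i. inv (col i x) \<otimes> col (Suc i) x) [p..<p + r]) = inv (col p x) \<otimes> col (p + r) x"
    if "r \<le> q" for r
    using that
  proof (induction "r" arbitrary: )
    case 0
    with assms(1) show ?case
      by (simp add: col_closed)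
  next
    case (Suc r)
    have app: "gprod (as @ [b]) = gprod as \<otimes> b" if "set as \<subseteq> carrier G" "b \<in> carrier G" for as b
      using that by (induction as) (simp_all add: m_assoc)
    have "gprod (map (\<lambda>i. inv (col i x) \<otimes> col (Suc i) x) [p..<p + r] @
          [inv (col (p + r) x) \<otimes> col (Suc (p + r)) x]) =
        (inv (col p x) \<otimes> col (p + r) x) \<otimes> (inv (col (p + r) x) \<otimes> col (Suc (p + r)) x)"
      using Suc assms(1) by (subst app) (auto simp: col_closed)
    with Suc.prems assms(1) show ?case
      by (simp add: inv_mult_cancel col_closed)
  qed
  from this[of q] have "gprod (drop p hs) = inv (col p x) \<otimes> col (p + q) x"
    by (simp add: hs drop_map)
  moreover have "take p hs = map (\<lambda>i. inv (col i z) \<otimes> col (Suc i) z) [0..<p]"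
    using assms(4) by (simp add: hs take_map)
  ultimately show ?thesis
    using assms(1,3,4) by (simp add: theta_def y conj_conj col_closed mon_closed m_assoc)
qed

lemma theta_back:
  assumes "x \<in> X (p + q)" "mon z = mon x" "\<And>i. i \<le> q \<Longrightarrow> col i z = col (p + i) x"
    and "theta (p + q) x = (hs, y)"
  shows "theta q z = (drop p hs, y)"
proof -
  have "map (\<lambda>i. inv (col i z) \<otimes> col (Suc i) z) [0..<q] = drop p hs"
    using assms(3,4) by (intro nth_equalityI) (auto simp: theta_def)
  then show ?thesis
    using assms by (auto simp: theta_def)
qed

lemma pull_cochain: "pull n w \<in> cochains CL n"
  by (simp add: mem_cochains_CL pull_def)

lemma pull_diff:
  assumes w: "w \<in> cochains CG n"
  shows "pull (Suc n) (diff CG n w) = diff CL n (pull n w)"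
proof (rule pull_eqI)
  fix x assume x: "x \<in> X (Suc n)"
  then show "diff CG n w (theta (Suc n) x) = diff CL n (pull n w) (proj (Suc n) x)"
    by (simp add: diff_adjoint_cobar[OF fin w] theta_closed singular_cochains_def proj_simplex
        pull_proj face_closed theta_face flip: proj_face del: sum.atMost_Suc)
qed (simp add: singular_cochains_def)

lemma pull_cup:
  assumes u: "u \<in> cochains CG p" and v: "v \<in> cochains CG q"
  shows "pull (p + q) (cup CG p q u v) = cup CL p q (pull p u) (pull q v)"
proof (rule pull_eqI)
  fix x assume x: "x \<in> X (p + q)"
  obtain hs y where hs: "theta (p + q) x = (hs, y)"
    by fastforce
  obtain a where a: "a \<in> X p" "proj p a = front_face p (proj (p + q) x)" "mon a = mon x"
      "\<And>i. i \<le> p \<Longrightarrow> col i a = col i x"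
    using front_face_proj[OF x] by blast
  obtain b where b: "b \<in> X q" "proj q b = back_face p q (proj (p + q) x)" "mon b = mon x"
      "\<And>i. i \<le> q \<Longrightarrow> col i b = col (p + i) x"
    using back_face_proj[OF x] by blast
  have "theta p a = (take p hs, conj (gprod (drop p hs)) y)" "theta q b = (drop p hs, y)"
    using theta_front[OF x a(1,3,4) hs] theta_back[OF x b(3,4) hs] by auto
  then have "pull p u (front_face p (proj (p + q) x)) = u (take p hs, conj (gprod (drop p hs)) y)"
      "pull q v (back_face p q (proj (p + q) x)) = v (drop p hs, y)"
    using a(1,2) b(1,2) by (metis pull_proj)+
  then show "cup CG p q u v (theta (p + q) x) = cup CL p q (pull p u) (pull q v) (proj (p + q) x)"
    using x theta_closed[OF x] unfolding hs cup_adjoint_cobar[OF fin u v]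
    by (simp add: singular_cochains_def proj_simplex)
qed (simp add: singular_cochains_def)

lemma pull_unit: "pull 0 (cunit CG) = cunit CL"
  by (rule pull_eqI)
    (simp_all add: cunit_adjoint_cobar[OF fin] theta_closed singular_cochains_def proj_simplex)

lemma push_cochain: "push n v \<in> cochains CG n"
  by (simp add: cochains_adjoint_cobar[OF fin] push_def)

lemma psi_bar_closed: "s \<in> bar_simplices G n \<Longrightarrow> case_prod psi s \<in> X n"
  using psi_closed by (auto simp: bar_simplices_def)

lemma push_pull:
  assumes "w \<in> cochains CG n"
  shows "push n (pull n w) = w"
proof
  fix s
  show "push n (pull n w) s = w s"
  proof (cases "s \<in> bar_simplices G n")
    case True
    then show ?thesis
      using theta_psi[of "fst s" "snd s"] psi_bar_closed[OF True]
      by (auto simp: push_def pull_proj bar_simplices_def)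
  next
    case False
    with assms show ?thesis
      by (cases s) (simp add: push_def cochains_adjoint_cobar[OF fin])
  qed
qed

lemma push_diff:
  assumes v: "v \<in> cochains CL n"
  shows "push (Suc n) (diff CL n v) = diff CG n (push n v)"
proof
  fix s
  show "push (Suc n) (diff CL n v) s = diff CG n (push n v) s"
  proof (cases "s \<in> bar_simplices G (Suc n)")
    case True
    have "singular_face (Suc n) i (proj (Suc n) (case_prod psi s)) =
        proj n (case_prod psi (conj_coface G n i s))" if "i \<le> Suc n" for i
      using proj_face[OF psi_bar_closed[OF True] that] proj_face_psi[of "fst s" "snd s" n i] True that
      by (simp add: case_prod_beta)
    with True show ?thesis
      by (simp add: diff_adjoint_cobar[OF fin push_cochain] push_def conj_coface_closed
          singular_cochains_def proj_simplex psi_bar_closed del: sum.atMost_Suc)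
  qed (simp add: diff_adjoint_cobar[OF fin push_cochain] push_def)
qed

lemma pull_push_proj:
  "x \<in> X n \<Longrightarrow> pull n (push n v) (proj n x) = retract_cochain n (\<lambda>z. v (proj n z)) x"
  by (simp add: pull_proj push_def theta_closed retract_cochain_def proj_act psi_bar_closed col_closed)

text \<open>The prism operator applied to the invariant cochain \<open>v \<circ> proj\<close> is invariant, hence a cochain on
  the singular simplices of \<open>L\<close>; for a cocycle \<open>v\<close> the homotopy formula says that
  its coboundary is the given difference.\<close>

lemma pull_push_homotopic:
  assumes v: "v \<in> cocycles CL n"
  shows "(\<lambda>\<sigma>. v \<sigma> - pull n (push n v) \<sigma>) \<in> coboundaries CL n"
proof -
  define u where "u = (\<lambda>z. v (proj n z))"
  have "delta (Suc n) u z = 0" if z: "z \<in> X (Suc n)" for z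
  proof -
    have "diff CL n v (proj (Suc n) z) = 0"
      using v by (simp add: cocycles_def)
    with z show ?thesis
      by (simp add: singular_cochains_def proj_simplex delta_def u_def proj_face del: sum.atMost_Suc)
  qed
  then have "prism (Suc n) (delta (Suc n) u) x = 0" if "x \<in> X n" for x
    using prism_cong[of "Suc n" "delta (Suc n) u" "\<lambda>z. 0" x] that prism_zero[of "Suc n" x]
    by (simp del: prism.simps)
  then have htpy: "v (proj n x) - pull n (push n v) (proj n x) = delta n (prism n u) x"
      if "x \<in> X n" for x
    using prism_homotopy[OF that, of u] that unfolding pull_push_proj[OF that]
    by (simp add: u_def del: prism.simps)
  \<comment> \<open>Cochains on the singular simplices may be compared after composition with the projection.\<close>
  have eqI: "(\<lambda>\<sigma>. v \<sigma> - pull n (push n v) \<sigma>) = b"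
    if "\<And>x. x \<in> X n \<Longrightarrow> delta n (prism n u) x = b (proj n x)"
      and "\<And>\<sigma>. \<not> singular_simplex n L \<sigma> \<Longrightarrow> b \<sigma> = 0" for b
  proof
    fix \<sigma>
    show "v \<sigma> - pull n (push n v) \<sigma> = b \<sigma>"
    proof (cases "singular_simplex n L \<sigma>")
      case True
      then show ?thesis
        using proj_surj[OF True] htpy that(1) by metis
    next
      case False
      then show ?thesis
        using v that(2) by (simp add: cocycles_def mem_cochains_CL pull_def)
    qed
  qed
  show ?thesis
  proof (cases n)
    case 0
    then have "(\<lambda>\<sigma>. v \<sigma> - pull n (push n v) \<sigma>) = (\<lambda>_. 0)"
      by (intro eqI) (simp_all add: delta_def)
    with 0 show ?thesis
      by (simp add: coboundaries_def)
  next
    case (Suc m)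
    define b where "b \<sigma> = (if singular_simplex m L \<sigma>
        then prism n u (SOME x. x \<in> X m \<and> proj m x = \<sigma>) else 0)" for \<sigma>
    have b: "b (proj m x) = prism n u x" if "x \<in> X m" for x
    proof -
      have "prism n u (act m g z) = prism n u z" if "z \<in> X m" "g \<in> carrier G" for z g
        unfolding Suc using that by (intro prism_act) (simp_all add: u_def Suc proj_act)
      from invariant_choice[OF this \<open>x \<in> X m\<close>] that show ?thesis
        by (simp add: b_def proj_simplex)
    qed
    have "(\<lambda>\<sigma>. v \<sigma> - pull n (push n v) \<sigma>) = diff CL m b"
    proof (rule eqI)
      fix x assume x: "x \<in> X n"
      then show "delta n (prism n u) x = diff CL m b (proj n x)"
        by (simp add: Suc delta_def singular_cochains_def proj_simplex b[unfolded Suc] face_closed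
            flip: proj_face del: sum.atMost_Suc prism.simps)
    qed (simp add: singular_cochains_def Suc)
    moreover have "b \<in> cochains CL m"
      by (simp add: mem_cochains_CL b_def)
    ultimately show ?thesis
      by (simp add: coboundaries_def Suc)
  qed
qed

lemma dga_adjoint_cobar: "dga CG"
proof (rule dga_pullback[where f = pull and D = CL])
  show "dga CL"
    by (rule dga_singular_cochains)
  show "inj_on (pull n) (cochains CG n)" for n
    by (rule inj_on_inverseI[where g = "push n"]) (rule push_pull)
  show "pull n (\<lambda>s. u s + v s) = (\<lambda>s. pull n u s + pull n v s)" for n u v
    by (auto simp: pull_def)
  show "diff CG n u \<in> cochains CG (Suc n)" if "u \<in> cochains CG n" for n u
    using that by (simp add: cochains_adjoint_cobar[OF fin] diff_adjoint_cobar[OF fin])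
  show "cup CG p q u v \<in> cochains CG (p + q)" if "u \<in> cochains CG p" "v \<in> cochains CG q" for p q u v
    using cup_adjoint_cobar[OF fin that] by (auto simp: cochains_adjoint_cobar[OF fin])
qed (auto simp: pull_cochain pull_diff pull_cup pull_unit cochains_adjoint_cobar[OF fin]
    cunit_adjoint_cobar[OF fin], auto simp: pull_def)

theorem singular_cohomology_iso_adjoint_cotor:
  "graded_algebra_iso (singular_cohomology K L) (cohomology CG)"
proof -
  have "graded_algebra_iso (cohomology CG) (cohomology CL)"
  proof (rule cohomology_iso_if_deformation_retract[where f = pull and g = push])
    show "pull n (\<lambda>s. u s + v s) = (\<lambda>s. pull n u s + pull n v s)" for n u v
      by (auto simp: pull_def)
    show "pull n (\<lambda>s. c * u s) = (\<lambda>s. c * pull n u s)" for n c u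
      by (auto simp: pull_def)
    show "push n (\<lambda>_. 0) = (\<lambda>_. 0)" for n
      by (auto simp: push_def)
  qed (assumption | rule dga_adjoint_cobar dga_singular_cochains pull_cochain pull_diff pull_cup
      pull_unit push_cochain push_diff push_pull pull_push_homotopic)+
  then show ?thesis
    unfolding singular_cohomology_def by (rule dga.cohomology_iso_sym[OF dga_adjoint_cobar])
qed

end

end

section \<open>Lifting maps to a principal bundle with discrete group\<close>

lemma openin_prod_euclideanreal_rectangle:
  assumes "openin (prod_topology Z euclideanreal) V" "(z, x) \<in> V"
  obtains N J where "openin Z N" "open J" "z \<in> N" "x \<in> J" "N \<times> J \<subseteq> V"
proof -
  have "\<forall>z r. (z, r) \<in> V \<longrightarrow>
      (\<exists>N J. openin Z N \<and> openin euclideanreal J \<and> z \<in> N \<and> r \<in> J \<and> N \<times> J \<subseteq> V)"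
    by (rule iffD1[OF openin_prod_topology_alt assms(1)])
  then show thesis
    using assms(2) that by (metis open_openin)
qed

text \<open>The action of a discrete group for which the quotient map is a principal bundle: a small open set is
  disjoint from its translates by nontrivial elements.\<close>

locale principal_space =
  fixes G :: "('g, 'm) monoid_scheme" (structure) and E :: "'e topology" and \<phi> :: "'g \<Rightarrow> 'e \<Rightarrow> 'e"
  assumes is_group: "group G"
    and action: "group_action G (topspace E) \<phi>"
    and cont_action: "g \<in> carrier G \<Longrightarrow> continuous_map E E (\<phi> g)"
    and separated: "x \<in> topspace E \<Longrightarrow>
      \<exists>U. openin E U \<and> x \<in> U \<and> (\<forall>g\<in>carrier G. g \<noteq> \<one> \<longrightarrow> \<phi> g ` U \<inter> U = {})"
begin

sublocale group G
  by (rule is_group)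

abbreviation B :: "'e set topology" where
  "B \<equiv> orbit_space G E \<phi>"

abbreviation p :: "'e \<Rightarrow> 'e set" where
  "p \<equiv> orbit G \<phi>"

lemma act_in: "\<lbrakk>g \<in> carrier G; x \<in> topspace E\<rbrakk> \<Longrightarrow> \<phi> g x \<in> topspace E"
  using group_action.element_image[OF action] by blast

lemma act_unit: "x \<in> topspace E \<Longrightarrow> \<phi> \<one> x = x"
  using group_action.id_eq_one[OF action] by (metis restrict_apply')

lemma act_comp:
  "\<lbrakk>x \<in> topspace E; g \<in> carrier G; h \<in> carrier G\<rbrakk> \<Longrightarrow> \<phi> g (\<phi> h x) = \<phi> (g \<otimes> h) x"
  using group_action.composition_rule[OF action] by simp

lemma act_free:
  assumes "x \<in> topspace E" "g \<in> carrier G" "h \<in> carrier G" "\<phi> g x = \<phi> h x"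
  shows "g = h"
proof -
  have "\<phi> (inv h \<otimes> g) x = x"
    using assms by (metis act_comp act_unit inv_closed l_inv)
  moreover obtain U where "x \<in> U" "\<forall>g\<in>carrier G. g \<noteq> \<one> \<longrightarrow> \<phi> g ` U \<inter> U = {}"
    using separated[OF assms(1)] by blast
  ultimately have "inv h \<otimes> g = \<one>"
    using assms(2,3) by (metis IntI empty_iff image_eqI inv_closed m_closed)
  then show ?thesis
    using assms(2,3) by (metis inv_equality inv_inv inv_closed)
qed

lemma p_act: "\<lbrakk>g \<in> carrier G; x \<in> topspace E\<rbrakk> \<Longrightarrow> p (\<phi> g x) = p x"
  unfolding orbit_def
proof safe
  fix h assume "g \<in> carrier G" "x \<in> topspace E" "h \<in> carrier G"
  then show "\<exists>k. \<phi> h (\<phi> g x) = \<phi> k x \<and> k \<in> carrier G"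
    by (metis act_comp m_closed)
next
  fix h assume *: "g \<in> carrier G" "x \<in> topspace E" "h \<in> carrier G"
  then have "\<phi> h x = \<phi> (h \<otimes> inv g) (\<phi> g x)"
    by (simp add: act_comp m_assoc)
  with * show "\<exists>k. \<phi> h x = \<phi> k (\<phi> g x) \<and> k \<in> carrier G"
    by (meson inv_closed m_closed)
qed

lemma p_eq_iff:
  assumes "x \<in> topspace E" "y \<in> topspace E"
  shows "p x = p y \<longleftrightarrow> (\<exists>g\<in>carrier G. y = \<phi> g x)"
proof
  assume "p x = p y"
  moreover have "y \<in> p y"
    unfolding orbit_def using act_unit[OF assms(2)] by (force intro!: exI[of _ \<one>])
  ultimately have "y \<in> p x"
    by simp
  then show "\<exists>g\<in>carrier G. y = \<phi> g x"
    unfolding orbit_def by blast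
qed (use assms p_act in auto)

lemma continuous_p: "continuous_map E B p"
  by (rule quotient_imp_continuous_map[OF quotient_map_orbit])

lemma topspace_B: "topspace B = p ` topspace E"
  by (auto simp: topspace_orbit_space orbits_def)

lemma open_map_p:
  assumes U: "openin E U"
  shows "openin B (p ` U)"
proof -
  have U': "U \<subseteq> topspace E"
    by (rule openin_subset[OF U])
  have "{x \<in> topspace E. p x \<in> p ` U} = (\<Union>g\<in>carrier G. {x \<in> topspace E. \<phi> g x \<in> U})"
  proof (intro equalityI subsetI)
    fix x assume "x \<in> {x \<in> topspace E. p x \<in> p ` U}"
    then obtain u where "x \<in> topspace E" "u \<in> U" "p x = p u"
      by blast
    with U' p_eq_iff[of x u] show "x \<in> (\<Union>g\<in>carrier G. {x \<in> topspace E. \<phi> g x \<in> U})"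
      by auto
  next
    fix x assume "x \<in> (\<Union>g\<in>carrier G. {x \<in> topspace E. \<phi> g x \<in> U})"
    then obtain g where "g \<in> carrier G" "x \<in> topspace E" "\<phi> g x \<in> U"
      by blast
    with p_act[of g x] show "x \<in> {x \<in> topspace E. p x \<in> p ` U}"
      by (metis (mono_tags, lifting) image_eqI mem_Collect_eq)
  qed
  moreover have "openin E {x \<in> topspace E. \<phi> g x \<in> U}" if "g \<in> carrier G" for g
    by (rule openin_continuous_map_preimage[OF cont_action[OF that] U])
  ultimately have "openin E {x \<in> topspace E. p x \<in> p ` U}"
    by auto
  moreover have "p ` U \<subseteq> orbits G (topspace E) \<phi>"
    using U' by (auto simp: orbits_def)
  ultimately show ?thesis
    by (simp add: openin_orbit_space)
qed

text \<open>A separated open set \<open>U\<close> meets every orbit at most once, and the orbit map is open, so it restricts to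
  a homeomorphism from \<open>U\<close> to an open subset of the orbit space.\<close>

lemma ex_local_section:
  assumes "b \<in> topspace B"
  shows "\<exists>W s. openin B W \<and> b \<in> W \<and> continuous_map (subtopology B W) E s \<and> (\<forall>c\<in>W. p (s c) = c)"
proof -
  from assms obtain x where x: "x \<in> topspace E" "b = p x"
    by (auto simp: topspace_B)
  from separated[OF x(1)] obtain U where U: "openin E U" "x \<in> U"
      "\<And>g. \<lbrakk>g \<in> carrier G; g \<noteq> \<one>\<rbrakk> \<Longrightarrow> \<phi> g ` U \<inter> U = {}"
    by blast
  have sub: "U \<subseteq> topspace E"
    by (rule openin_subset[OF U(1)])
  have inj: "u = v" if "u \<in> U" "v \<in> U" "p u = p v" for u v
  proof -
    from that sub obtain g where g: "g \<in> carrier G" "v = \<phi> g u"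
      using p_eq_iff by blast
    with U(3)[OF g(1)] that have "g = \<one>"
      by blast
    with g that sub show ?thesis
      using act_unit by auto
  qed
  define s where "s = inv_into U p"
  have s: "s (p u) = u" if "u \<in> U" for u
    unfolding s_def using inj that by (intro inv_into_f_f) (auto simp: inj_on_def)
  have "openin B (p ` U)"
    by (rule open_map_p[OF U(1)])
  moreover have "continuous_map (subtopology B (p ` U)) E s"
    unfolding continuous_map_def
  proof (intro conjI allI impI)
    show "s \<in> topspace (subtopology B (p ` U)) \<rightarrow> topspace E"
      using s sub by auto
    fix V assume V: "openin E V"
    have "p ` (U \<inter> V) = {c \<in> topspace (subtopology B (p ` U)). s c \<in> V}"
      using s sub by (auto simp: topspace_B)
    moreover have "openin (subtopology B (p ` U)) (p ` U \<inter> p ` (U \<inter> V))"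
      using U(1) V by (intro openin_subtopology_Int2 open_map_p openin_Int)
    moreover have "p ` U \<inter> p ` (U \<inter> V) = p ` (U \<inter> V)"
      by blast
    ultimately show "openin (subtopology B (p ` U)) {c \<in> topspace (subtopology B (p ` U)). s c \<in> V}"
      by metis
  qed
  moreover have "\<forall>c\<in>p ` U. p (s c) = c"
    using s by auto
  ultimately show ?thesis
    using U(2) x(2) by blast
qed

text \<open>If \<open>f2 z = \<phi> g (f1 z)\<close> lies in a separated open set, then nearby both sides stay in it; they
  differ by a group element which must be \<open>\<one>\<close>.\<close>

lemma openin_lifts_agree:
  assumes f1: "continuous_map Z E f1" and f2: "continuous_map Z E f2"
    and eq: "\<And>z. z \<in> topspace Z \<Longrightarrow> p (f1 z) = p (f2 z)" and g: "g \<in> carrier G"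
  shows "openin Z {z \<in> topspace Z. f2 z = \<phi> g (f1 z)}"
proof (subst openin_subopen, safe)
  fix z assume z: "z \<in> topspace Z" "f2 z = \<phi> g (f1 z)"
  have in_E: "f1 w \<in> topspace E" "f2 w \<in> topspace E" if "w \<in> topspace Z" for w
    using that f1 f2 by (auto simp: continuous_map_def)
  from separated[OF in_E(2)[OF z(1)]] obtain U where U: "openin E U" "f2 z \<in> U"
      "\<And>h. \<lbrakk>h \<in> carrier G; h \<noteq> \<one>\<rbrakk> \<Longrightarrow> \<phi> h ` U \<inter> U = {}"
    by blast
  let ?N = "{w \<in> topspace Z. f2 w \<in> U} \<inter> {w \<in> topspace Z. (\<phi> g \<circ> f1) w \<in> U}"
  have "openin Z ?N"
    by (intro openin_Int openin_continuous_map_preimage[OF _ U(1)] f2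
        continuous_map_compose[OF f1 cont_action[OF g]])
  moreover have "z \<in> ?N"
    using z U(2) by simp
  moreover have "?N \<subseteq> {z \<in> topspace Z. f2 z = \<phi> g (f1 z)}"
  proof safe
    fix w assume w: "w \<in> topspace Z" "f2 w \<in> U" "(\<phi> g \<circ> f1) w \<in> U"
    then have "p (\<phi> g (f1 w)) = p (f2 w)"
      by (simp add: p_act g in_E eq)
    then obtain h where h: "h \<in> carrier G" "f2 w = \<phi> h (\<phi> g (f1 w))"
      using p_eq_iff w(1) in_E act_in g by meson
    with U(3)[OF h(1)] w have "h = \<one>"
      by auto
    with h show "f2 w = \<phi> g (f1 w)"
      using act_unit w(1) in_E act_in g by simp
  qed
  ultimately show "\<exists>T. openin Z T \<and> z \<in> T \<and> T \<subseteq> {z \<in> topspace Z. f2 z = \<phi> g (f1 z)}"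
    by blast
qed

text \<open>The sets on which \<open>f2 = \<phi> g \<circ> f1\<close>, for the various \<open>g\<close>, form a partition of \<open>Z\<close> into open sets.\<close>

lemma lifts_differ_by_group_element:
  assumes Z: "connected_space Z"
    and f1: "continuous_map Z E f1" and f2: "continuous_map Z E f2"
    and eq: "\<And>z. z \<in> topspace Z \<Longrightarrow> p (f1 z) = p (f2 z)"
  shows "\<exists>g\<in>carrier G. \<forall>z\<in>topspace Z. f2 z = \<phi> g (f1 z)"
proof (cases "topspace Z = {}")
  case False
  then obtain z where z: "z \<in> topspace Z"
    by blast
  have in_E: "f1 w \<in> topspace E" "f2 w \<in> topspace E" if "w \<in> topspace Z" for w
    using that f1 f2 by (auto simp: continuous_map_def)
  have ex: "\<exists>g\<in>carrier G. f2 w = \<phi> g (f1 w)" if "w \<in> topspace Z" for w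
    using eq[OF that] in_E[OF that] p_eq_iff by blast
  let ?S = "\<lambda>g. {w \<in> topspace Z. f2 w = \<phi> g (f1 w)}"
  from ex[OF z] obtain g where g: "g \<in> carrier G" "f2 z = \<phi> g (f1 z)"
    by blast
  have "topspace Z - ?S g = (\<Union>h\<in>carrier G - {g}. ?S h)"
  proof (intro equalityI subsetI)
    fix w assume "w \<in> topspace Z - ?S g"
    with ex show "w \<in> (\<Union>h\<in>carrier G - {g}. ?S h)"
      by force
  next
    fix w assume "w \<in> (\<Union>h\<in>carrier G - {g}. ?S h)"
    then show "w \<in> topspace Z - ?S g"
      using act_free[OF in_E(1), of w g] g(1) by auto
  qed
  moreover have "openin Z (?S h)" if "h \<in> carrier G" for h
    by (rule openin_lifts_agree[OF f1 f2 eq that])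
  ultimately have "closedin Z (?S g)" "openin Z (?S g)"
    using g(1) by (auto simp: closedin_def)
  with Z have "?S g = {} \<or> ?S g = topspace Z"
    using connected_space_clopen_in by blast
  with z g show ?thesis
    by blast
qed (auto intro: bexI[of _ \<one>])

text \<open>Lifts over a short time interval come from local sections, and lifts over adjacent intervals can be
  concatenated. Bisection of the unit interval therefore gives a lift over all of it, over a
  neighbourhood of \<open>z0\<close> that shrinks only finitely often.\<close>

lemma local_homotopy_lifting:
  fixes Z :: "'z topology"
  defines "ZR \<equiv> prod_topology Z euclideanreal"
  assumes F: "continuous_map (subtopology ZR (topspace Z \<times> {0..1})) B F"
    and l0: "continuous_map Z E l0" "\<And>z. z \<in> topspace Z \<Longrightarrow> p (l0 z) = F (z, 0)"
    and z0: "z0 \<in> topspace Z"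
  shows "\<exists>N l. openin Z N \<and> z0 \<in> N \<and> continuous_map (subtopology ZR (N \<times> {0..1})) E l \<and>
    (\<forall>z\<in>N. \<forall>r\<in>{0..1}. p (l (z, r)) = F (z, r)) \<and> (\<forall>z\<in>N. l (z, 0) = l0 z)"
proof -
  \<comment> \<open>A lift \<open>l\<close> over the time interval from \<open>a\<close> to \<open>b\<close> near \<open>z0\<close> with initial values \<open>f\<close>.\<close>
  define lift where "lift N l a b f \<longleftrightarrow> openin Z N \<and> z0 \<in> N \<and>
      continuous_map (subtopology ZR (N \<times> {a..b})) E l \<and>
      (\<forall>z\<in>N. \<forall>r\<in>{a..b}. p (l (z, r)) = F (z, r)) \<and> (\<forall>z\<in>N. l (z, a) = f z)" for N l a b f
  define P where "P a b \<longleftrightarrow> (0 \<le> a \<longrightarrow> b \<le> 1 \<longrightarrow> (\<forall>N f. openin Z N \<longrightarrow> z0 \<in> N \<longrightarrow>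
      continuous_map (subtopology Z N) E f \<longrightarrow> (\<forall>z\<in>N. p (f z) = F (z, a)) \<longrightarrow>
      (\<exists>N' l. N' \<subseteq> N \<and> lift N' l a b f)))" for a b :: real
  have PD: "\<exists>N' l. N' \<subseteq> N \<and> lift N' l a b f"
    if "P a b" "0 \<le> a" "b \<le> 1" "openin Z N" "z0 \<in> N" "continuous_map (subtopology Z N) E f"
      "\<forall>z\<in>N. p (f z) = F (z, a)" for a b N f
    using that unfolding P_def by blast
  have slice: "continuous_map (subtopology Z N) (subtopology ZR (N \<times> S)) (\<lambda>z. (z, r))"
    if "r \<in> S" for N r and S :: "real set"
    unfolding ZR_def continuous_map_in_subtopology
  proof (intro conjI continuous_map_pairedI)
    show "continuous_map (subtopology Z N) Z (\<lambda>z. z)"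
      by (rule continuous_map_id_subt[unfolded id_def])
  qed (use that in auto)
  have "P 0 1"
  proof (rule Bolzano[of 0 1 P])
    fix a b c assume Pab: "P a b" and Pbc: "P b c" and ab: "a \<le> b" "b \<le> c"
    show "P a c"
      unfolding P_def
    proof (intro impI allI)
      fix N f assume ac: "0 \<le> a" "c \<le> 1" and N: "openin Z N" "z0 \<in> N"
        "continuous_map (subtopology Z N) E f" "\<forall>z\<in>N. p (f z) = F (z, a)"
      have "b \<le> 1" "0 \<le> b"
        using ab ac by auto
      from PD[OF Pab ac(1) this(1) N] obtain N1 l1 where 1: "openin Z N1" "z0 \<in> N1" "N1 \<subseteq> N"
        "continuous_map (subtopology ZR (N1 \<times> {a..b})) E l1"
        "\<forall>z\<in>N1. \<forall>r\<in>{a..b}. p (l1 (z, r)) = F (z, r)" "\<forall>z\<in>N1. l1 (z, a) = f z"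
        unfolding lift_def by blast
      have b: "continuous_map (subtopology Z N1) E (\<lambda>z. l1 (z, b))"
        using continuous_map_compose[OF slice 1(4), of b] ab by (simp add: o_def)
      have "\<forall>z\<in>N1. p (l1 (z, b)) = F (z, b)"
        using 1(5) ab by auto
      from PD[OF Pbc \<open>0 \<le> b\<close> ac(2) 1(1,2) b this] obtain N2 l2 where 2: "openin Z N2" "z0 \<in> N2" "N2 \<subseteq> N1"
        "continuous_map (subtopology ZR (N2 \<times> {b..c})) E l2"
        "\<forall>z\<in>N2. \<forall>r\<in>{b..c}. p (l2 (z, r)) = F (z, r)" "\<forall>z\<in>N2. l2 (z, b) = l1 (z, b)"
        unfolding lift_def by blast
      define l where "l = (\<lambda>x. if snd x \<le> b then l1 x else l2 x)"
      have "continuous_map (subtopology ZR (N2 \<times> {a..c})) E l"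
        unfolding l_def
      proof (rule continuous_map_cases_le)
        show "continuous_map (subtopology ZR (N2 \<times> {a..c})) euclideanreal snd"
          unfolding ZR_def by (intro continuous_map_from_subtopology continuous_map_snd)
        show "continuous_map (subtopology (subtopology ZR (N2 \<times> {a..c}))
            {x \<in> topspace (subtopology ZR (N2 \<times> {a..c})). snd x \<le> b}) E l1"
          unfolding subtopology_subtopology using 2(3)
          by (intro continuous_map_from_subtopology_mono[OF 1(4)]) auto
        show "continuous_map (subtopology (subtopology ZR (N2 \<times> {a..c}))
            {x \<in> topspace (subtopology ZR (N2 \<times> {a..c})). b \<le> snd x}) E l2"
          unfolding subtopology_subtopology
          by (intro continuous_map_from_subtopology_mono[OF 2(4)]) auto
      qed (use 2(6) in auto)
      moreover have "\<forall>z\<in>N2. \<forall>r\<in>{a..c}. p (l (z, r)) = F (z, r)" "\<forall>z\<in>N2. l (z, a) = f z"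
        using 1 2 ab by (auto simp: l_def)
      ultimately show "\<exists>N' l. N' \<subseteq> N \<and> lift N' l a c f"
        unfolding lift_def by (intro exI[of _ N2] exI[of _ l] conjI) (use 1(3) 2(1-3) in auto)
    qed
  next
    fix x :: real assume x: "0 \<le> x" "x \<le> 1"
    have "F (z0, x) \<in> topspace B"
      using continuous_map_funspace[OF F] z0 x by (auto simp: ZR_def Pi_iff)
    then obtain W s where W: "openin B W" "F (z0, x) \<in> W" "continuous_map (subtopology B W) E s"
        "\<forall>c\<in>W. p (s c) = c"
      using ex_local_section by blast
    let ?V = "{w \<in> topspace (subtopology ZR (topspace Z \<times> {0..1})). F w \<in> W}"
    have "openin (subtopology ZR (topspace Z \<times> {0..1})) ?V"
      by (rule openin_continuous_map_preimage[OF F W(1)])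
    then obtain V where V: "openin ZR V" "?V = V \<inter> (topspace Z \<times> {0..1})"
      unfolding openin_subtopology by blast
    have "(z0, x) \<in> ?V"
      using z0 x W(2) by (simp add: ZR_def)
    then have z0x: "(z0, x) \<in> V"
      using V(2) by blast
    obtain N0 J where NJ: "openin Z N0" "open J" "z0 \<in> N0" "x \<in> J" "N0 \<times> J \<subseteq> V"
      by (rule openin_prod_euclideanreal_rectangle[OF V(1)[unfolded ZR_def] z0x])
    obtain d where d: "d > 0" "\<And>r. \<bar>r - x\<bar> < d \<Longrightarrow> r \<in> J"
      using NJ(2,4) by (metis open_real)
    have FW: "F (z, r) \<in> W" if "z \<in> N0" "\<bar>r - x\<bar> < d" "0 \<le> r" "r \<le> 1" for z r
    proof -
      have "(z, r) \<in> ?V"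
        unfolding V(2) using that NJ(5) d(2) openin_subset[OF NJ(1)] by auto
      then show ?thesis
        by simp
    qed
    show "\<exists>d>0. \<forall>a b. a \<le> x \<and> x \<le> b \<and> b - a < d \<longrightarrow> P a b"
    proof (intro exI[of _ d] conjI allI impI d(1), elim conjE)
      fix a b assume ab: "a \<le> x" "x \<le> b" "b - a < d"
      show "P a b"
        unfolding P_def
      proof (intro impI allI)
        fix N f assume ab': "0 \<le> a" "b \<le> 1" and N: "openin Z N" "z0 \<in> N"
          "continuous_map (subtopology Z N) E f" "\<forall>z\<in>N. p (f z) = F (z, a)"
        let ?M = "N \<inter> N0"
        have FW': "F (z, r) \<in> W" if "z \<in> N0" "r \<in> {a..b}" for z r
          using that ab ab' by (intro FW) auto
        have sub: "?M \<subseteq> topspace Z"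
          using openin_subset[OF N(1)] by auto
        have FB: "continuous_map (subtopology ZR (?M \<times> {a..b})) (subtopology B W) F"
          unfolding continuous_map_in_subtopology
        proof (intro conjI)
          show "continuous_map (subtopology ZR (?M \<times> {a..b})) B F"
            using sub ab' by (intro continuous_map_from_subtopology_mono[OF F]) auto
          show "F \<in> topspace (subtopology ZR (?M \<times> {a..b})) \<rightarrow> W"
            using FW' by auto
        qed
        note sF = continuous_map_compose[OF FB W(3)]
        have sFa: "continuous_map (subtopology Z ?M) E (\<lambda>z. s (F (z, a)))"
          using continuous_map_compose[OF slice sF, of a] ab by (simp add: o_def)
        have f': "continuous_map (subtopology Z ?M) E f"
          by (rule continuous_map_from_subtopology_mono[OF N(3)]) simp
        have eq: "p (s (F (z, a))) = p (f z)" if "z \<in> topspace (subtopology Z ?M)" for z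
          using that N(4) W(4) FW'[of z a] ab by auto
        have "f z0 \<in> topspace E" "s (F (z0, a)) \<in> topspace E"
          using continuous_map_funspace[OF sFa] continuous_map_funspace[OF f'] N(2) NJ(3) z0
          by (auto simp: Pi_iff)
        moreover have "p (s (F (z0, a))) = p (f z0)"
          using eq z0 N(2) NJ(3) by simp
        ultimately obtain g where g: "g \<in> carrier G" "f z0 = \<phi> g (s (F (z0, a)))"
          using p_eq_iff by blast
        let ?N' = "{z \<in> topspace (subtopology Z ?M). f z = \<phi> g (s (F (z, a)))}"
        have "openin (subtopology Z ?M) ?N'"
          by (rule openin_lifts_agree[OF sFa f' eq g(1)])
        then have "openin Z ?N'"
          by (rule openin_trans_full) (use N(1) NJ(1) in auto)
        moreover have "continuous_map (subtopology ZR (?N' \<times> {a..b})) E (\<lambda>w. \<phi> g (s (F w)))"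
          using continuous_map_from_subtopology_mono[OF continuous_map_compose[OF sF cont_action[OF g(1)]],
              of "?N' \<times> {a..b}"]
          unfolding o_def by (rule meta_mp) auto
        moreover have "p (\<phi> g (s (F (z, r)))) = F (z, r)" if "z \<in> ?N'" "r \<in> {a..b}" for z r
        proof -
          have "s (F (z, r)) \<in> topspace E"
            using continuous_map_funspace[OF W(3)] FW'[of z r] that openin_subset[OF W(1)]
            by (auto simp: Pi_iff)
          then show ?thesis
            using W(4) FW'[of z r] that by (simp add: p_act g(1))
        qed
        moreover have "z0 \<in> ?N'" "?N' \<subseteq> N"
          using g(2) z0 N(2) NJ(3) by auto
        ultimately show "\<exists>N' l. N' \<subseteq> N \<and> lift N' l a b f"
          unfolding lift_def
          by (intro exI[of _ ?N'] exI[of _ "\<lambda>w. \<phi> g (s (F w))"]) auto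
      qed
    qed
  qed simp
  from PD[OF this, of "topspace Z" l0] l0 z0 have "\<exists>N l. N \<subseteq> topspace Z \<and> lift N l 0 1 l0"
    by (simp add: subtopology_topspace)
  then show ?thesis
    unfolding lift_def by blast
qed

text \<open>The local lifts agree on overlaps, since along each path \<open>{z} \<times> [0, 1]\<close> they are lifts of the same
  path with the same starting point; so they paste to a global lift.\<close>

theorem homotopy_lifting:
  fixes Z :: "'z topology"
  defines "ZI \<equiv> subtopology (prod_topology Z euclideanreal) (topspace Z \<times> {0..1})"
  assumes F: "continuous_map ZI B F"
    and l0: "continuous_map Z E l0" "\<And>z. z \<in> topspace Z \<Longrightarrow> p (l0 z) = F (z, 0)"
  shows "\<exists>l. continuous_map ZI E l \<and> (\<forall>w\<in>topspace ZI. p (l w) = F w)"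
proof -
  let ?ZR = "prod_topology Z euclideanreal"
  define lift where "lift z0 N l \<longleftrightarrow> openin Z N \<and> z0 \<in> N \<and>
      continuous_map (subtopology ?ZR (N \<times> {0..1})) E l \<and>
      (\<forall>z\<in>N. \<forall>r\<in>{0..1}. p (l (z, r)) = F (z, r)) \<and> (\<forall>z\<in>N. l (z, 0) = l0 z)" for z0 N l
  have "\<forall>z0\<in>topspace Z. \<exists>N l. lift z0 N l"
    unfolding lift_def using local_homotopy_lifting[OF F[unfolded ZI_def] l0(1)] l0(2) by simp
  from bchoice[OF this] obtain N where "\<forall>z0\<in>topspace Z. \<exists>l. lift z0 (N z0) l"
    by blast
  from bchoice[OF this] obtain l where "\<forall>z0\<in>topspace Z. lift z0 (N z0) (l z0)"
    by blast
  then have N: "\<And>z0. z0 \<in> topspace Z \<Longrightarrow> openin Z (N z0)" "\<And>z0. z0 \<in> topspace Z \<Longrightarrow> z0 \<in> N z0"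
    and l: "\<And>z0. z0 \<in> topspace Z \<Longrightarrow> continuous_map (subtopology ?ZR (N z0 \<times> {0..1})) E (l z0)"
      "\<And>z0 z r. \<lbrakk>z0 \<in> topspace Z; z \<in> N z0; r \<in> {0..1}\<rbrakk> \<Longrightarrow> p (l z0 (z, r)) = F (z, r)"
      "\<And>z0 z. \<lbrakk>z0 \<in> topspace Z; z \<in> N z0\<rbrakk> \<Longrightarrow> l z0 (z, 0) = l0 z"
    unfolding lift_def by blast+
  have same: "l z1 (z, r) = l z2 (z, r)"
    if z: "z1 \<in> topspace Z" "z2 \<in> topspace Z" "z \<in> N z1" "z \<in> N z2" "r \<in> {0..1}" for z1 z2 z r
  proof -
    have zZ: "z \<in> topspace Z"
      using z N(1) openin_subset by blast
    have cont: "continuous_map (top_of_set {0..1}) E (\<lambda>r. l z0 (z, r))"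
      if "z0 \<in> topspace Z" "z \<in> N z0" for z0
    proof -
      have "continuous_map (top_of_set {0..1}) (subtopology ?ZR (N z0 \<times> {0..1})) (\<lambda>r. (z, r))"
        using that zZ by (auto simp: continuous_map_in_subtopology continuous_map_pairwise o_def)
      from continuous_map_compose[OF this l(1)[OF that(1)]] show ?thesis
        by (simp add: o_def)
    qed
    have "connected_space (top_of_set {0..1::real})"
      by (metis connected_Icc connectedin_def connectedin_iff_connected)
    from lifts_differ_by_group_element[OF this cont[OF z(1,3)] cont[OF z(2,4)]]
    obtain g where g: "g \<in> carrier G" "\<And>r. r \<in> {0..1} \<Longrightarrow> l z2 (z, r) = \<phi> g (l z1 (z, r))"
      using l(2) z by auto
    have "l0 z \<in> topspace E"
      using l0(1) zZ by (auto simp: continuous_map_def)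
    moreover have "\<phi> g (l0 z) = \<phi> \<one> (l0 z)"
      using g(2)[of 0] l(3) z calculation by (simp add: act_unit)
    ultimately have "g = \<one>"
      using act_free g(1) by blast
    moreover have "l z1 (z, r) \<in> topspace E"
      using cont[OF z(1,3)] z(5) by (auto simp: continuous_map_def)
    ultimately show ?thesis
      using g(2)[OF z(5)] by (simp add: act_unit)
  qed
  define m where "m w = l (fst w) w" for w
  have "continuous_map ZI E m"
  proof (rule pasting_lemma[where I = "topspace Z" and T = "\<lambda>z0. N z0 \<times> {0..1}" and f = l])
    fix z0 assume z0: "z0 \<in> topspace Z"
    then show "openin ZI (N z0 \<times> {0..1})"
      unfolding ZI_def openin_subtopology using N(1)[OF z0] openin_subset[OF N(1)[OF z0]]
      by (intro exI[of _ "N z0 \<times> UNIV"]) (auto simp: openin_prod_Times_iff)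
    show "continuous_map (subtopology ZI (N z0 \<times> {0..1})) E (l z0)"
      unfolding ZI_def subtopology_subtopology
      by (rule continuous_map_from_subtopology_mono[OF l(1)[OF z0]]) auto
  next
    fix w assume "w \<in> topspace ZI"
    then show "\<exists>j. j \<in> topspace Z \<and> w \<in> N j \<times> {0..1} \<and> m w = l j w"
      using N(2) by (intro exI[of _ "fst w"]) (auto simp: ZI_def m_def)
  next
    fix i j w assume "i \<in> topspace Z" "j \<in> topspace Z"
      "w \<in> topspace ZI \<inter> N i \<times> {0..1} \<inter> N j \<times> {0..1}"
    then show "l i w = l j w"
      using same[of i j "fst w" "snd w"] by auto
  qed
  moreover have "p (m w) = F w" if "w \<in> topspace ZI" for w
    using that l(2) N(2) by (auto simp: ZI_def m_def)
  ultimately show ?thesis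
    by blast
qed

text \<open>Run a contraction of \<open>Z\<close> backwards: this is a homotopy from a constant map, which lifts, to \<open>f\<close>.\<close>

corollary lift_from_contractible:
  assumes Z: "contractible_space Z" and f: "continuous_map Z B f"
  shows "\<exists>l. continuous_map Z E l \<and> (\<forall>z\<in>topspace Z. p (l z) = f z)"
proof (cases "topspace Z = {}")
  case True
  then show ?thesis
    by (metis continuous_map_on_empty empty_iff null_topspace_iff_trivial)
next
  case False
  from Z obtain a h where h: "continuous_map (prod_topology (top_of_set {0..1::real}) Z) Z h"
      "\<And>z. z \<in> topspace Z \<Longrightarrow> h (0, z) = z" "\<And>z. z \<in> topspace Z \<Longrightarrow> h (1, z) = a"
    unfolding contractible_space_def by (auto simp: homotopic_with)
  obtain z1 where "z1 \<in> topspace Z"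
    using False by blast
  with h have "a \<in> topspace Z"
    by (force simp: continuous_map_def Pi_iff)
  then obtain e where e: "e \<in> topspace E" "p e = f a"
    using f by (auto simp: continuous_map_def topspace_B Pi_iff)
  let ?ZI = "subtopology (prod_topology Z euclideanreal) (topspace Z \<times> {0..1})"
  have flip: "continuous_map ?ZI (prod_topology (top_of_set {0..1}) Z) (\<lambda>w. (1 - snd w, fst w))"
    by (auto simp: continuous_map_pairwise o_def continuous_map_in_subtopology
        intro!: continuous_intros continuous_map_from_subtopology continuous_map_fst continuous_map_snd
          continuous_map_diff)
  have "continuous_map ?ZI B (\<lambda>w. f (h (1 - snd w, fst w)))"
    using continuous_map_compose[OF continuous_map_compose[OF flip h(1)] f] by (simp add: o_def)
  moreover have "continuous_map Z E (\<lambda>z. e)"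
    using e(1) by simp
  moreover have "p e = f (h (1 - snd (z, 0), fst (z, 0)))" if "z \<in> topspace Z" for z
    using that h(3) e(2) by simp
  ultimately obtain l where l: "continuous_map ?ZI E l"
      "\<forall>w\<in>topspace ?ZI. p (l w) = f (h (1 - snd w, fst w))"
    using homotopy_lifting[of Z "\<lambda>w. f (h (1 - snd w, fst w))" "\<lambda>z. e"] by blast
  have "continuous_map Z ?ZI (\<lambda>z. (z, 1))"
    by (auto simp: continuous_map_in_subtopology continuous_map_pairwise o_def)
  from continuous_map_compose[OF this l(1)] l(2) h(2) show ?thesis
    by (intro exI[of _ "\<lambda>z. l (z, 1)"]) (auto simp: o_def)
qed

end

section \<open>The exponential law\<close>

text \<open>Continuity is tested on the subbasic sets of the compact-open topology, where it is the tube lemma.\<close>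

lemma continuous_map_into_mapping_space:
  assumes F: "continuous_map (prod_topology X S) Y F"
  shows "continuous_map X (mapping_space S Y) (\<lambda>x. \<lambda>s\<in>topspace S. F (x, s))"
proof -
  let ?f = "\<lambda>x. \<lambda>s\<in>topspace S. F (x, s)"
  let ?S = "{{f \<in> extensional (topspace S). continuous_map S Y f \<and> f ` C \<subseteq> U} | C U.
    compactin S C \<and> openin Y U}"
  have cont: "continuous_map S Y (?f x)" if "x \<in> topspace X" for x
  proof -
    have "continuous_map S (prod_topology X S) (\<lambda>s. (x, s))"
      using that by (intro continuous_map_pairedI) auto
    from continuous_map_compose[OF this F] show ?thesis
      by (rule continuous_map_eq) auto
  qed
  have in_space: "?f x \<in> topspace (mapping_space S Y)" if "x \<in> topspace X" for x
    unfolding topspace_mapping_space using cont[OF that] by simp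
  show ?thesis
    unfolding mapping_space_def
  proof (rule continuous_on_generated_topo)
    show "?f ` topspace X \<subseteq> \<Union> ?S"
      using in_space by (simp only: mapping_space_def topology_generated_by_topspace) blast
  next
    fix W assume "W \<in> ?S"
    then obtain C U where W: "W = {f \<in> extensional (topspace S). continuous_map S Y f \<and> f ` C \<subseteq> U}"
        and C: "compactin S C" and U: "openin Y U"
      by blast
    have CS: "C \<subseteq> topspace S"
      by (rule compactin_subset_topspace[OF C])
    have "?f -` W \<inter> topspace X = {x \<in> topspace X. \<forall>s\<in>C. F (x, s) \<in> U}"
      using cont CS unfolding W by (auto simp: image_subset_iff subset_iff)
    moreover have "openin X {x \<in> topspace X. \<forall>s\<in>C. F (x, s) \<in> U}"
    proof (subst openin_subopen, safe)
      fix x assume x: "x \<in> topspace X" "\<forall>s\<in>C. F (x, s) \<in> U"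
      let ?V = "{w \<in> topspace (prod_topology X S). F w \<in> U}"
      have "openin (prod_topology X S) ?V"
        by (rule openin_continuous_map_preimage[OF F U])
      moreover have "{x} \<times> C \<subseteq> ?V"
        using x CS by auto
      ultimately obtain M N where "openin X M" "x \<in> M" "C \<subseteq> N" "M \<times> N \<subseteq> ?V"
        using tube_lemma_right[OF _ C x(1)] by meson
      then show "\<exists>T. openin X T \<and> x \<in> T \<and> T \<subseteq> {x \<in> topspace X. \<forall>s\<in>C. F (x, s) \<in> U}"
        using openin_subset[of X M] by (intro exI[of _ M]) auto
    qed
    ultimately show "openin X (?f -` W \<inter> topspace X)"
      by simp
  qed
qed

text \<open>Near a point of \<open>S\<close>, a map sending that point into \<open>U\<close> sends a small closed ball into \<open>U\<close>, and this
  is an open condition in the compact-open topology.\<close>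

lemma continuous_map_from_mapping_space:
  fixes S :: "'s::heine_borel set"
  assumes S: "compact S" and f: "continuous_map X (mapping_space (top_of_set S) Y) f"
  shows "continuous_map (prod_topology X (top_of_set S)) Y (\<lambda>(x, s). f x s)"
  unfolding continuous_map_def
proof (intro conjI allI impI)
  have f_in: "f x \<in> extensional S" "continuous_map (top_of_set S) Y (f x)" if "x \<in> topspace X" for x
    using continuous_map_funspace[OF f] that by (auto simp: topspace_mapping_space Pi_iff)
  then show "(\<lambda>(x, s). f x s) \<in> topspace (prod_topology X (top_of_set S)) \<rightarrow> topspace Y"
    using continuous_map_funspace[OF f_in(2)] by (auto simp: Pi_iff)
  fix U assume U: "openin Y U"
  let ?W = "{w \<in> topspace (prod_topology X (top_of_set S)). (case w of (x, s) \<Rightarrow> f x s) \<in> U}"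
  show "openin (prod_topology X (top_of_set S)) ?W"
    unfolding openin_prod_topology_alt
  proof (intro allI impI)
    fix x s assume xs: "(x, s) \<in> ?W"
    then have x: "x \<in> topspace X" "s \<in> S" "f x s \<in> U"
      by auto
    have "openin (top_of_set S) {r \<in> topspace (top_of_set S). f x r \<in> U}"
      by (rule openin_continuous_map_preimage[OF f_in(2)[OF x(1)] U])
    with x obtain e where e: "e > 0" "cball s e \<inter> S \<subseteq> {r \<in> S. f x r \<in> U}"
      unfolding openin_contains_cball by auto
    let ?C = "cball s e \<inter> S"
    let ?A = "{g \<in> extensional S. continuous_map (top_of_set S) Y g \<and> g ` ?C \<subseteq> U}"
    have "compactin (top_of_set S) ?C"
      using S by (simp add: compactin_subtopology compact_Int_closed Int_commute)
    then have "openin (mapping_space (top_of_set S) Y) ?A"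
      unfolding mapping_space_def using U by (intro topology_generated_by_Basis) auto
    then have "openin X {y \<in> topspace X. f y \<in> ?A}"
      by (rule openin_continuous_map_preimage[OF f])
    moreover have "openin (top_of_set S) (ball s e \<inter> S)"
      by (simp add: Int_commute openin_open_Int)
    moreover have "x \<in> {y \<in> topspace X. f y \<in> ?A}"
      using x f_in[OF x(1)] e(2) by auto
    moreover have "{y \<in> topspace X. f y \<in> ?A} \<times> (ball s e \<inter> S) \<subseteq>
        ?W"
      by auto
    moreover have "s \<in> ball s e \<inter> S"
      using x(2) e(1) by simp
    ultimately show "\<exists>V W. openin X V \<and> openin (top_of_set S) W \<and> x \<in> V \<and> s \<in> W \<and>
        V \<times> W \<subseteq> ?W"
      by meson
  qed
qed

section \<open>Simplices of loops\<close>

text \<open>Loops are represented by paths on the unit interval, so a simplex of loops is a map on the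
  cylinder over the standard simplex. The circle is the quotient of the interval by \<open>circle_point\<close>,
  with \<open>angle\<close> as a (discontinuous) section.\<close>

definition cyl :: "nat \<Rightarrow> ((nat \<Rightarrow> real) \<times> real) set" where
  "cyl n = standard_simplex n \<times> {0..1}"

definition vertex :: "nat \<Rightarrow> nat \<Rightarrow> real" where
  "vertex i = (\<lambda>j. if j = i then 1 else 0)"

definition circle_point :: "real \<Rightarrow> complex" where
  "circle_point s = exp (2 * pi * s * \<i>)"

definition angle :: "complex \<Rightarrow> real" where
  "angle z = Arg2pi z / (2 * pi)"

lemma norm_circle_point [simp]: "norm (circle_point s) = 1"
  by (simp add: circle_point_def norm_exp_eq_Re)

lemma circle_point_1: "circle_point 1 = circle_point 0"
  by (simp add: circle_point_def)

lemma continuous_circle_point [continuous_intros]: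
  "continuous_on A f \<Longrightarrow> continuous_on A (\<lambda>x. circle_point (f x))"
  unfolding circle_point_def by (intro continuous_intros)

lemma angle_circle_point: "0 \<le> s \<Longrightarrow> s < 1 \<Longrightarrow> angle (circle_point s) = s"
  by (simp add: angle_def circle_point_def Arg2pi_exp)

lemma circle_point_angle: "z \<in> sphere 0 1 \<Longrightarrow> circle_point (angle z) = z"
  using Arg2pi_eq[of z] by (simp add: angle_def circle_point_def mult_ac)

lemma angle_range: "angle z \<in> {0..1}"
  using Arg2pi_ge_0[of z] Arg2pi_lt_2pi[of z] by (simp add: angle_def)

lemma compact_standard_simplex: "compact (standard_simplex n)"
  using compactin_standard_simplex[of n] by (simp add: euclidean_product_topology)

lemma compact_cyl: "compact (cyl n)"
  unfolding cyl_def by (intro compact_Times compact_standard_simplex compact_Icc)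

lemma vertex_in [simp]: "vertex i \<in> standard_simplex n \<longleftrightarrow> i \<le> n"
  unfolding vertex_def by (rule basis_in_standard_simplex)

lemma simplical_face_vertex: "simplical_face j (vertex i) = vertex (if i < j then i else Suc i)"
  by (auto simp: simplical_face_def vertex_def fun_eq_iff)

lemma contractible_cyl: "contractible_space (top_of_set (cyl n))"
proof -
  let ?h = "\<lambda>(r, (t, s)). ((\<lambda>i. (1 - r) * t i + r * vertex 0 i), (1 - r) * s)"
  have "?h ` ({0..1} \<times> cyl n) \<subseteq> cyl n"
    by (auto simp: cyl_def intro!: convex_standard_simplex mult_le_one)
  moreover have "continuous_on ({0..1} \<times> cyl n) ?h"
    unfolding split_def by (intro continuous_intros continuous_on_product_then_coordinatewise)
  ultimately have "continuous_map (prod_topology (top_of_set {0..1}) (top_of_set (cyl n))) (top_of_set (cyl n)) ?h"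
    by (simp add: continuous_map_in_subtopology image_subset_iff Pi_iff)
  then show ?thesis
    unfolding contractible_space_def
    by (intro exI[of _ "(vertex 0, 0)"]) (auto simp: homotopic_with intro!: exI[of _ ?h])
qed

lemma connected_cyl: "connected_space (top_of_set (cyl n))"
  by (rule contractible_imp_connected_space[OF contractible_cyl])

lemma connected_standard_simplex: "connected_space (top_of_set (standard_simplex n))"
  using connectedin_standard_simplex[of n] by (simp add: connectedin_def euclidean_product_topology)

lemma singular_simplex_iff:
  "singular_simplex n X f \<longleftrightarrow> continuous_map (top_of_set (standard_simplex n)) X f \<and>
    f \<in> extensional (standard_simplex n)"
  by (simp add: singular_simplex_def euclidean_product_topology)

text \<open>A continuous surjection from a compact space to a Hausdorff space is a quotient map. A map on
  the cylinder that agrees at both ends therefore descends to a continuous map on the product with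
  the circle.\<close>

lemma quotient_map_cyl:
  "quotient_map (top_of_set (cyl n)) (prod_topology (top_of_set (standard_simplex n)) (top_of_set (sphere 0 1)))
    (\<lambda>(t, s). (t, circle_point s))"
proof (rule T1_Spaces.continuous_imp_quotient_map)
  have "continuous_on (cyl n) (\<lambda>w. (fst w, circle_point (snd w)))"
    by (intro continuous_on_Pair continuous_on_fst continuous_circle_point continuous_on_snd
        continuous_on_id)
  then show "continuous_map (top_of_set (cyl n))
      (prod_topology (top_of_set (standard_simplex n)) (top_of_set (sphere 0 1))) (\<lambda>(t, s). (t, circle_point s))"
    by (auto simp: continuous_map_in_subtopology split_def cyl_def)
  show "compact_space (top_of_set (cyl n))"
    using compact_cyl by (simp add: compact_space_subtopology)
  show "(\<lambda>(t, s). (t, circle_point s)) ` topspace (top_of_set (cyl n)) =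
      topspace (prod_topology (top_of_set (standard_simplex n)) (top_of_set (sphere 0 1)))"
  proof (safe; clarsimp simp: cyl_def)
    fix t z assume "t \<in> standard_simplex n" "norm (z :: complex) = 1"
    then show "(t, z) \<in> (\<lambda>(t, s). (t, circle_point s)) ` (standard_simplex n \<times> {0..1})"
      using angle_range[of z] circle_point_angle[of z] by (intro image_eqI[of _ _ "(t, angle z)"]) auto
  qed
qed (simp add: Hausdorff_space_subtopology)

text \<open>A contraction \<open>H\<close> of the total space onto \<open>e0\<close> and an equivariant map of sets to the
  group.\<close>

locale loop_bundle = principal_space G E \<phi>
  for G :: "('g, 'm) monoid_scheme" (structure) and E :: "'e topology" and \<phi> +
  fixes H :: "real \<times> 'e \<Rightarrow> 'e" and e0 :: 'e and colour :: "'e \<Rightarrow> 'g"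
  assumes continuous_H: "continuous_map (prod_topology (top_of_set {0..1}) E) E H"
    and H_0: "x \<in> topspace E \<Longrightarrow> H (0, x) = x"
    and H_1: "x \<in> topspace E \<Longrightarrow> H (1, x) = e0"
    and e0_in: "e0 \<in> topspace E"
    and colour_closed: "x \<in> topspace E \<Longrightarrow> colour x \<in> carrier G"
    and colour_act: "\<lbrakk>x \<in> topspace E; g \<in> carrier G\<rbrakk> \<Longrightarrow> colour (\<phi> g x) = g \<otimes> colour x"
    and colour_e0: "colour e0 = \<one>"
begin

abbreviation LB :: "(complex \<Rightarrow> 'e set) topology" where
  "LB \<equiv> free_loop_space B"

lemma continuous_map_H:
  assumes "continuous_map Z E y" "continuous_map Z euclideanreal \<rho>" "\<And>z. z \<in> topspace Z \<Longrightarrow> \<rho> z \<in> {0..1}"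
  shows "continuous_map Z E (\<lambda>z. H (\<rho> z, y z))"
proof -
  have "continuous_map Z (prod_topology (top_of_set {0..1}) E) (\<lambda>z. (\<rho> z, y z))"
    using assms by (intro continuous_map_pairedI) (auto simp: continuous_map_in_subtopology)
  from continuous_map_compose[OF this continuous_H] show ?thesis
    by (simp add: o_def)
qed

lemma H_in: "\<lbrakk>r \<in> {0..1}; x \<in> topspace E\<rbrakk> \<Longrightarrow> H (r, x) \<in> topspace E"
  using continuous_map_funspace[OF continuous_H] by (auto simp: Pi_iff)

lemma continuous_map_act:
  "\<lbrakk>g \<in> carrier G; continuous_map Z E y\<rbrakk> \<Longrightarrow> continuous_map Z E (\<lambda>z. \<phi> g (y z))"
  using continuous_map_compose[of Z E y E "\<phi> g"] cont_action by (simp add: o_def)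

text \<open>The contraction \<open>H\<close> moves the end points of a path \<open>\<gamma>\<close> with \<open>\<gamma> 1 = \<phi> g (\<gamma> 0)\<close> in a way that is not
  compatible with \<open>g\<close>. This is repaired by appending two tracks of \<open>H\<close>. At time \<open>r\<close>, with \<open>r' = 0\<close>,
  the path runs through \<open>H (r, \<gamma> a)\<close>, then from \<open>H (r, \<phi> g x)\<close> back to \<open>\<phi> g x\<close>, and then along the translated
  track to \<open>\<phi> g (H (r, x))\<close>, where \<open>x = \<gamma> 0\<close>; the parameter \<open>a\<close> runs from \<open>0\<close> to \<open>1 + 2 r\<close>. Once \<open>r = 1\<close> the
  path depends on \<open>\<gamma>\<close> only through \<open>x\<close>, which a second contraction with parameter \<open>r'\<close> moves to
  \<open>e0\<close>. This contracts the space of all such paths \<open>\<gamma>\<close> to a single one.\<close>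

definition spread :: "'g \<Rightarrow> (real \<Rightarrow> 'e) \<Rightarrow> real \<Rightarrow> real \<Rightarrow> real \<Rightarrow> 'e" where
  "spread g \<gamma> r r' s = (let a = s * (1 + 2 * r) in
     if a \<le> 1 then H (r, \<gamma> a)
     else if a \<le> 1 + r then H (1 + r - a, \<phi> g (H (r', \<gamma> 0)))
     else \<phi> g (H (a - 1 - r, H (r', \<gamma> 0))))"

lemma spread_0: "spread g \<gamma> r r' 0 = H (r, \<gamma> 0)"
  by (simp add: spread_def)

lemma spread_1:
  assumes "g \<in> carrier G" "r \<in> {0..1}" "\<gamma> 0 \<in> topspace E" "r = 1 \<or> r' = 0 \<and> \<gamma> 1 = \<phi> g (\<gamma> 0)" "r' \<in> {0..1}"
  shows "spread g \<gamma> r r' 1 = \<phi> g (spread g \<gamma> r r' 0)"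
  using assms by (auto simp: spread_def Let_def H_0 H_1 act_in H_in)

lemma spread_start: "\<lbrakk>s \<in> {0..1}; \<gamma> s \<in> topspace E\<rbrakk> \<Longrightarrow> spread g \<gamma> 0 0 s = \<gamma> s"
  by (simp add: spread_def H_0)

lemma spread_end:
  assumes "\<And>s. s \<in> {0..1} \<Longrightarrow> \<gamma> s \<in> topspace E" "s \<in> {0..1}"
  shows "spread g \<gamma> 1 1 s = spread g (\<lambda>_. e0) 1 1 s"
  using assms by (auto simp: spread_def Let_def H_1 e0_in)

lemma spread_cong:
  assumes "\<And>s. s \<in> {0..1} \<Longrightarrow> \<gamma> s = \<gamma>' s" "s \<in> {0..1}" "r \<in> {0..1}"
  shows "spread g \<gamma> r r' s = spread g \<gamma>' r r' s"
  using assms by (auto simp: spread_def Let_def)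

text \<open>The three pieces match at \<open>a = 1\<close> because either \<open>r = 1\<close>, when both sides are \<open>e0\<close>, or \<open>r' = 0\<close>, when
  both are \<open>H (r, \<phi> g x)\<close>; at \<open>a = 1 + r\<close> both are \<open>\<phi> g (H (r', x))\<close>.\<close>

lemma continuous_map_spread:
  fixes Z :: "'z topology"
  assumes g: "g \<in> carrier G"
    and r: "continuous_map Z euclideanreal r" "\<And>z. z \<in> topspace Z \<Longrightarrow> r z \<in> {0..1}"
    and r': "continuous_map Z euclideanreal r'" "\<And>z. z \<in> topspace Z \<Longrightarrow> r' z \<in> {0..1}"
    and s: "continuous_map Z euclideanreal s" "\<And>z. z \<in> topspace Z \<Longrightarrow> s z \<in> {0..1}"
    and \<gamma>: "\<And>A a. \<lbrakk>continuous_map (subtopology Z A) euclideanreal a;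
        \<And>z. z \<in> topspace Z \<inter> A \<Longrightarrow> a z \<in> {0..1}\<rbrakk> \<Longrightarrow> continuous_map (subtopology Z A) E (\<lambda>z. \<gamma> z (a z))"
    and match: "\<And>z. z \<in> topspace Z \<Longrightarrow> r z = 1 \<or> r' z = 0 \<and> \<gamma> z 1 = \<phi> g (\<gamma> z 0)"
  shows "continuous_map Z E (\<lambda>z. spread g (\<gamma> z) (r z) (r' z) (s z))"
proof -
  define a where "a z = s z * (1 + 2 * r z)" for z
  have a: "continuous_map Z euclideanreal a"
    unfolding a_def by (intro continuous_intros r s)
  have a_range: "0 \<le> a z" "a z \<le> 1 + 2 * r z" if "z \<in> topspace Z" for z
    using s(2)[OF that] r(2)[OF that] mult_right_mono[of "s z" 1 "1 + 2 * r z"] by (auto simp: a_def)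
  have \<gamma>0: "continuous_map Z E (\<lambda>z. \<gamma> z c)" if "c \<in> {0..1}" for c
  proof -
    have "continuous_map (subtopology Z UNIV) E (\<lambda>z. \<gamma> z c)"
      by (rule \<gamma>) (use that in auto)
    then show ?thesis
      by simp
  qed
  then have x: "continuous_map Z E (\<lambda>z. \<gamma> z 0)"
    by simp
  have x_in: "\<gamma> z 0 \<in> topspace E" "\<gamma> z 1 \<in> topspace E" if "z \<in> topspace Z" for z
    using continuous_map_funspace[OF x] continuous_map_funspace[OF \<gamma>0[of 1]] that
    by (auto simp: Pi_iff)
  have x': "continuous_map Z E (\<lambda>z. H (r' z, \<gamma> z 0))"
    by (rule continuous_map_H[OF x r'])
  have x'_in: "H (r' z, \<gamma> z 0) \<in> topspace E" if "z \<in> topspace Z" for z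
    using continuous_map_funspace[OF x'] that by (auto simp: Pi_iff)
  let ?f3 = "\<lambda>z. \<phi> g (H (a z - 1 - r z, H (r' z, \<gamma> z 0)))"
  let ?f2 = "\<lambda>z. H (1 + r z - a z, \<phi> g (H (r' z, \<gamma> z 0)))"
  let ?f1 = "\<lambda>z. H (r z, \<gamma> z (a z))"
  let ?Z2 = "{z \<in> topspace Z. 1 \<le> a z}"
  have "continuous_map Z E (\<lambda>z. if a z \<le> 1 then ?f1 z else if a z \<le> 1 + r z then ?f2 z else ?f3 z)"
  proof (rule continuous_map_cases_le)
    show "continuous_map Z euclideanreal a"
      by (rule a)
    show "continuous_map (subtopology Z {z \<in> topspace Z. a z \<le> 1}) E ?f1"
      using a_range r(2) by (intro continuous_map_H \<gamma> continuous_map_from_subtopology a r(1)) auto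
    show "continuous_map (subtopology Z ?Z2) E (\<lambda>z. if a z \<le> 1 + r z then ?f2 z else ?f3 z)"
    proof (rule continuous_map_cases_le)
      have r_bound: "r z \<le> 1" if "z \<in> topspace Z" for z
        using r(2)[OF that] by simp
      show "continuous_map (subtopology (subtopology Z ?Z2) {z \<in> topspace (subtopology Z ?Z2). a z \<le> 1 + r z}) E ?f2"
        using r_bound
        by (intro continuous_map_H continuous_map_act g x' continuous_map_from_subtopology continuous_intros a r(1))
          (auto, smt (verit) r_bound)
      show "continuous_map (subtopology (subtopology Z ?Z2) {z \<in> topspace (subtopology Z ?Z2). 1 + r z \<le> a z}) E ?f3"
        using a_range r_bound
        by (intro continuous_map_H continuous_map_act g x' continuous_map_from_subtopology continuous_intros a r(1))
          (auto, smt (verit) r_bound a_range)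
      show "continuous_map (subtopology Z ?Z2) euclideanreal a"
          "continuous_map (subtopology Z ?Z2) euclideanreal (\<lambda>z. 1 + r z)"
        by (intro continuous_map_from_subtopology continuous_intros a r(1))+
      show "?f2 z = ?f3 z" if "z \<in> topspace (subtopology Z ?Z2)" "a z = 1 + r z" for z
        using that x'_in by (simp add: H_0 act_in g)
    qed
    show "?f1 z = (if a z \<le> 1 + r z then ?f2 z else ?f3 z)" if "z \<in> topspace Z" "a z = 1" for z
      using match[OF that(1)] r(2)[OF that(1)] that x_in[OF that(1)] x'_in[OF that(1)]
      by (auto simp: H_1 H_0 act_in g)
  qed simp
  then show ?thesis
    by (simp add: spread_def Let_def flip: a_def)
qed

end

lemma restrict_cyl_eqI:
  assumes "\<And>t s. \<lbrakk>t \<in> standard_simplex n; 0 \<le> s; s \<le> 1\<rbrakk> \<Longrightarrow> f (t, s) = f' (t, s)"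
  shows "restrict f (cyl n) = restrict f' (cyl n)"
  using assms by (intro restrict_ext) (auto simp: cyl_def)

lemma mem_cyl [simp]: "(t, s) \<in> cyl n \<longleftrightarrow> t \<in> standard_simplex n \<and> 0 \<le> s \<and> s \<le> 1"
  by (auto simp: cyl_def)

lemma continuous_on_simplical_face:
  "continuous_on A (\<lambda>t :: nat \<Rightarrow> real. simplical_face i t)"
proof (rule continuous_on_coordinatewise_then_product)
  fix j
  have "continuous_on A (\<lambda>t :: nat \<Rightarrow> real. t k)" for k
    by (rule continuous_on_product_then_coordinatewise[OF continuous_on_id])
  then show "continuous_on A (\<lambda>t :: nat \<Rightarrow> real. simplical_face i t j)"
    by (cases "j < i"; cases "j = i") (simp_all add: simplical_face_def)
qed

text \<open>The point of the opposite face on the ray from vertex 0 through \<open>t\<close>.\<close>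

definition link :: "(nat \<Rightarrow> real) \<Rightarrow> nat \<Rightarrow> real" where
  "link t = (\<lambda>i. t (Suc i) / (1 - t 0))"

definition clamp :: "real \<Rightarrow> real" where
  "clamp r = max 0 (min 1 r)"

lemma clamp_range [simp]: "0 \<le> clamp r" "clamp r \<le> 1"
  by (auto simp: clamp_def)

lemma link_in:
  assumes t: "t \<in> standard_simplex (Suc n)" and t0: "t 0 < 1"
  shows "link t \<in> standard_simplex n"
proof -
  have sum: "(\<Sum>i\<le>n. t (Suc i)) = 1 - t 0"
    using t by (simp add: standard_simplex_def sum.atMost_Suc_shift del: sum.atMost_Suc)
  have nonneg: "0 \<le> t i" for i
    using t by (simp add: standard_simplex_def)
  have "t (Suc i) \<le> 1 - t 0" for i
  proof (cases "i \<le> n")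
    case True
    then have "t (Suc i) \<le> (\<Sum>i\<le>n. t (Suc i))"
      using nonneg by (intro member_le_sum) auto
    then show ?thesis
      by (simp add: sum)
  next
    case False
    then show ?thesis
      using t t0 by (simp add: standard_simplex_def)
  qed
  moreover have "(\<Sum>i\<le>n. t (Suc i) / (1 - t 0)) = 1"
    using t0 by (simp add: sum flip: sum_divide_distrib)
  ultimately show ?thesis
    using t t0 nonneg by (auto simp: standard_simplex_def link_def)
qed

lemma link_simplical_face_0: "link (simplical_face 0 t) = t" if "t \<in> standard_simplex n"
  by (simp add: link_def simplical_face_def)

lemma link_simplical_face_Suc: "link (simplical_face (Suc i) t) = simplical_face i (link t)"
  by (auto simp: link_def simplical_face_def fun_eq_iff)

lemma continuous_on_link:
  assumes "\<And>t. t \<in> A \<Longrightarrow> t 0 \<noteq> 1"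
  shows "continuous_on A link"
  unfolding link_def
proof (rule continuous_on_coordinatewise_then_product)
  fix j
  have "continuous_on A (\<lambda>t :: nat \<Rightarrow> real. t k)" for k
    by (rule continuous_on_product_then_coordinatewise[OF continuous_on_id])
  then show "continuous_on A (\<lambda>t. t (Suc j) / (1 - t 0))"
    using assms by (intro continuous_on_divide continuous_on_diff continuous_on_const) force+
qed

context loop_bundle
begin

text \<open>Lifts of singular simplices of the free loop space, each with its monodromy. The monodromy is
  determined by the lift, but carrying it along makes it available as a function.\<close>

definition simplices :: "nat \<Rightarrow> ('g \<times> ((nat \<Rightarrow> real) \<times> real \<Rightarrow> 'e)) set" where
  "simplices n = {(g, \<sigma>). g \<in> carrier G \<and> \<sigma> \<in> extensional (cyl n) \<and>
     continuous_map (top_of_set (cyl n)) E \<sigma> \<and> (\<forall>t\<in>standard_simplex n. \<sigma> (t, 1) = \<phi> g (\<sigma> (t, 0)))}"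

definition loop_face where
  "loop_face n i = (\<lambda>(g :: 'g, \<sigma> :: (nat \<Rightarrow> real) \<times> real \<Rightarrow> 'e).
     (g, restrict (\<lambda>(t, s). \<sigma> (simplical_face i t, s)) (cyl (n - 1))))"

definition loop_act where
  "loop_act n h = (\<lambda>(g, \<sigma>). (conj h g, restrict (\<lambda>w. \<phi> h (\<sigma> w)) (cyl n)))"

definition loop_col where
  "loop_col i = (\<lambda>(g :: 'g, \<sigma>). colour (\<sigma> (vertex i, 0 :: real)))"

text \<open>The contraction of paths, applied to the simplex seen from vertex 0, with time the barycentric
  coordinate \<open>t 0\<close>. Both stages are finished at \<open>t 0 = 1 / 2\<close>. From there on the value depends
  neither on \<open>\<sigma>\<close> nor on \<open>link t\<close>, which makes continuity at vertex 0 evident.\<close>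

definition cone_map where
  "cone_map g \<sigma> = (\<lambda>(t, s). if t 0 \<le> 1 / 2
     then spread g (\<lambda>a. \<sigma> (link t, a)) (clamp (4 * t 0)) (clamp (4 * t 0 - 1)) s
     else spread g (\<lambda>_. e0) 1 1 s)"

definition loop_cone where
  "loop_cone n = (\<lambda>(g, \<sigma>). (g, restrict (cone_map g \<sigma>) (cyl (Suc n))))"

definition loop_apex :: "'g \<Rightarrow> 'g \<times> ((nat \<Rightarrow> real) \<times> real \<Rightarrow> 'e)" where
  "loop_apex g = (g, restrict (\<lambda>(t, s). spread g (\<lambda>_. e0) 1 1 s) (cyl 0))"

definition loop_proj where
  "loop_proj n = (\<lambda>(g :: 'g, \<sigma>).
     \<lambda>t\<in>standard_simplex n. \<lambda>z\<in>sphere 0 1. p (\<sigma> (t :: nat \<Rightarrow> real, angle z)))"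

lemma restrict_in_simplices:
  assumes "g \<in> carrier G" "continuous_map (top_of_set (cyl n)) E f"
    "\<And>t. t \<in> standard_simplex n \<Longrightarrow> f (t, 1) = \<phi> g (f (t, 0))"
  shows "(g, restrict f (cyl n)) \<in> simplices n"
proof -
  have "continuous_map (top_of_set (cyl n)) E (restrict f (cyl n))"
    by (rule continuous_map_eq[OF assms(2)]) simp
  with assms show ?thesis
    by (simp add: simplices_def)
qed

lemma simplex_in:
  assumes "(g, \<sigma>) \<in> simplices n" "w \<in> cyl n"
  shows "\<sigma> w \<in> topspace E"
  using assms continuous_map_funspace[of "top_of_set (cyl n)" E \<sigma>] by (auto simp: simplices_def Pi_iff)

lemma continuous_map_simplex:
  assumes "(g, \<sigma>) \<in> simplices n" "continuous_map Z euclidean u" "\<And>z. z \<in> topspace Z \<Longrightarrow> u z \<in> cyl n"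
  shows "continuous_map Z E (\<lambda>z. \<sigma> (u z))"
proof -
  have "continuous_map Z (top_of_set (cyl n)) u"
    using assms(2,3) by (auto simp: continuous_map_in_subtopology)
  from continuous_map_compose[OF this, of E \<sigma>] assms(1) show ?thesis
    by (simp add: simplices_def o_def)
qed

lemma face_in:
  assumes x: "(g, \<sigma>) \<in> simplices (Suc n)" and i: "i \<le> Suc n"
  shows "loop_face (Suc n) i (g, \<sigma>) \<in> simplices n"
proof -
  have "continuous_on (cyl n) (\<lambda>w. (simplical_face i (fst w), snd w))"
    by (intro continuous_on_Pair continuous_on_snd continuous_on_id
        continuous_on_compose2[OF continuous_on_simplical_face[of UNIV]] continuous_on_fst) auto
  then have "continuous_map (top_of_set (cyl n)) E (\<lambda>w. \<sigma> (simplical_face i (fst w), snd w))"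
    using i by (intro continuous_map_simplex[OF x]) (auto simp: simplical_face_simplex)
  moreover have "\<sigma> (simplical_face i t, 1) = \<phi> g (\<sigma> (simplical_face i t, 0))" if "t \<in> standard_simplex n" for t
    using x i that by (simp add: simplices_def simplical_face_simplex)
  ultimately show ?thesis
    using x unfolding loop_face_def by (auto simp: split_def simplices_def intro!: restrict_in_simplices)
qed

lemma act_in_simplices:
  assumes x: "(g, \<sigma>) \<in> simplices n" and h: "h \<in> carrier G"
  shows "loop_act n h (g, \<sigma>) \<in> simplices n"
proof -
  have g: "g \<in> carrier G" and c: "continuous_map (top_of_set (cyl n)) E \<sigma>"
    using x by (auto simp: simplices_def)
  have "\<phi> h (\<sigma> (t, 1)) = \<phi> (conj h g) (\<phi> h (\<sigma> (t, 0)))" if "t \<in> standard_simplex n" for t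
  proof -
    have "\<sigma> (t, 0) \<in> topspace E" "\<sigma> (t, 1) = \<phi> g (\<sigma> (t, 0))"
      using x that by (auto simp: simplices_def intro: simplex_in[OF x])
    then show ?thesis
      using g h by (simp add: act_comp conj_def m_assoc)
  qed
  with g h c show ?thesis
    unfolding loop_act_def by (auto intro!: restrict_in_simplices continuous_map_act)
qed

lemma clamp_match: "clamp (4 * r) = 1 \<or> clamp (4 * r - 1) = 0"
  by (auto simp: clamp_def)

lemma continuous_cone_map:
  assumes x: "(g, \<sigma>) \<in> simplices n"
  shows "continuous_map (top_of_set (cyl (Suc n))) E (cone_map g \<sigma>)"
proof -
  have g: "g \<in> carrier G"
    using x by (simp add: simplices_def)
  let ?Z = "top_of_set (cyl (Suc n))"
  have coord: "continuous_on A (\<lambda>w :: (nat \<Rightarrow> real) \<times> real. fst w 0)" for A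
    by (intro continuous_on_product_then_coordinatewise[OF continuous_on_fst] continuous_on_id)
  have clamp: "continuous_on A (\<lambda>w. clamp (f w))" if "continuous_on A f"
    for A :: "((nat \<Rightarrow> real) \<times> real) set" and f
    unfolding clamp_def by (intro continuous_intros that)
  have snd: "continuous_on A snd" for A :: "((nat \<Rightarrow> real) \<times> real) set"
    by (intro continuous_on_snd continuous_on_id)
  let ?f1 = "\<lambda>w. spread g (\<lambda>a. \<sigma> (link (fst w), a)) (clamp (4 * fst w 0)) (clamp (4 * fst w 0 - 1)) (snd w)"
  let ?f2 = "\<lambda>w. spread g (\<lambda>_. e0) 1 1 (snd w)"
  have "continuous_map ?Z E (\<lambda>w. if fst w 0 \<le> 1 / 2 then ?f1 w else ?f2 w)"
  proof (rule continuous_map_cases_le)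
    let ?A = "cyl (Suc n) \<inter> {w \<in> topspace ?Z. fst w 0 \<le> 1 / 2}"
    have "continuous_map (top_of_set ?A) E ?f1"
    proof (rule continuous_map_spread[OF g])
      fix T a
      assume a: "continuous_map (subtopology (top_of_set ?A) T) euclideanreal a"
        "\<And>w. w \<in> topspace (top_of_set ?A) \<inter> T \<Longrightarrow> a w \<in> {0..1}"
      have "continuous_on (?A \<inter> T) (\<lambda>w. link (fst w))"
        by (rule continuous_on_compose2[OF continuous_on_link[of "{t. t 0 \<noteq> 1}"] continuous_on_fst[OF continuous_on_id]])
          auto
      then have "continuous_on (?A \<inter> T) (\<lambda>w. (link (fst w), a w))"
        using a(1) by (intro continuous_on_Pair) (simp_all add: subtopology_subtopology)
      then show "continuous_map (subtopology (top_of_set ?A) T) E (\<lambda>w. \<sigma> (link (fst w), a w))"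
        using a(2) unfolding subtopology_subtopology
        by (intro continuous_map_simplex[OF x]) (auto simp: cyl_def intro!: link_in)
    next
      fix w assume "w \<in> topspace (top_of_set ?A)"
      then have "link (fst w) \<in> standard_simplex n"
        by (auto simp: cyl_def intro!: link_in)
      then show "clamp (4 * fst w 0) = 1 \<or> clamp (4 * fst w 0 - 1) = 0 \<and>
          \<sigma> (link (fst w), 1) = \<phi> g (\<sigma> (link (fst w), 0))"
        using clamp_match x by (auto simp: simplices_def)
    qed (auto simp: cyl_def intro!: clamp coord snd continuous_on_mult continuous_on_diff continuous_on_const)
    then show "continuous_map (subtopology ?Z {w \<in> topspace ?Z. fst w 0 \<le> 1 / 2}) E ?f1"
      unfolding subtopology_subtopology .
  next
    let ?A = "cyl (Suc n) \<inter> {w \<in> topspace ?Z. 1 / 2 \<le> fst w 0}"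
    have "continuous_map (top_of_set ?A) E ?f2"
      by (rule continuous_map_spread[OF g]) (auto simp: cyl_def e0_in intro!: snd)
    then show "continuous_map (subtopology ?Z {w \<in> topspace ?Z. 1 / 2 \<le> fst w 0}) E ?f2"
      unfolding subtopology_subtopology .
  next
    fix w assume w: "w \<in> topspace ?Z" "fst w 0 = 1 / 2"
    then have "link (fst w) \<in> standard_simplex n"
      by (auto simp: cyl_def intro!: link_in)
    then have "spread g (\<lambda>a. \<sigma> (link (fst w), a)) 1 1 (snd w) = spread g (\<lambda>_. e0) 1 1 (snd w)"
      using w(1) by (intro spread_end) (auto simp: cyl_def intro!: simplex_in[OF x])
    moreover have "clamp (4 * fst w 0) = 1" "clamp (4 * fst w 0 - 1) = 1"
      using w(2) by (simp_all add: clamp_def)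
    ultimately show "?f1 w = ?f2 w"
      by simp
  qed (simp_all add: coord)
  then show ?thesis
    by (simp add: cone_map_def split_def)
qed

lemma cone_in:
  assumes x: "(g, \<sigma>) \<in> simplices n"
  shows "loop_cone n (g, \<sigma>) \<in> simplices (Suc n)"
proof -
  have g: "g \<in> carrier G"
    using x by (simp add: simplices_def)
  have "cone_map g \<sigma> (t, 1) = \<phi> g (cone_map g \<sigma> (t, 0))" if t: "t \<in> standard_simplex (Suc n)" for t
  proof (cases "t 0 \<le> 1 / 2")
    case True
    then have "link t \<in> standard_simplex n"
      using t by (intro link_in) auto
    then have "\<sigma> (link t, 0) \<in> topspace E" "\<sigma> (link t, 1) = \<phi> g (\<sigma> (link t, 0))"
      using x by (auto simp: simplices_def intro: simplex_in[OF x])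
    with True show ?thesis
      using clamp_match by (auto simp: cone_map_def intro!: spread_1 g)
  qed (auto simp: cone_map_def e0_in intro!: spread_1 g)
  with g show ?thesis
    unfolding loop_cone_def by (simp add: restrict_in_simplices continuous_cone_map[OF x])
qed

lemma apex_in:
  assumes g: "g \<in> carrier G"
  shows "loop_apex g \<in> simplices 0"
proof -
  have "continuous_on (cyl 0) snd"
    by (intro continuous_on_snd continuous_on_id)
  then have "continuous_map (top_of_set (cyl 0)) E (\<lambda>w. spread g (\<lambda>_. e0) 1 1 (snd w))"
    by (intro continuous_map_spread[OF g]) (auto simp: cyl_def e0_in)
  then show ?thesis
    unfolding loop_apex_def split_def
    by (intro restrict_in_simplices g) (auto simp: e0_in intro!: spread_1 g)
qed

lemma face_0_loop_cone:
  assumes x: "(g, \<sigma>) \<in> simplices n"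
  shows "loop_face (Suc n) 0 (loop_cone n (g, \<sigma>)) = (g, \<sigma>)"
proof -
  have "restrict (\<lambda>(t, s). restrict (cone_map g \<sigma>) (cyl (Suc n)) (simplical_face 0 t, s)) (cyl n) =
      restrict \<sigma> (cyl n)"
  proof (rule restrict_cyl_eqI)
    fix t s assume ts: "t \<in> standard_simplex n" "0 \<le> s" "s \<le> (1 :: real)"
    moreover have "simplical_face 0 t 0 = 0"
      by (simp add: simplical_face_def)
    moreover have "clamp 0 = 0" "clamp (-1) = 0"
      by (simp_all add: clamp_def)
    ultimately show "(case (t, s) of (t, s) \<Rightarrow> restrict (cone_map g \<sigma>) (cyl (Suc n)) (simplical_face 0 t, s)) = \<sigma> (t, s)"
      by (simp add: simplical_face_simplex cone_map_def link_simplical_face_0[OF ts(1)] spread_start simplex_in[OF x])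
  qed
  moreover have "restrict \<sigma> (cyl n) = \<sigma>"
    using x by (simp add: simplices_def extensional_restrict)
  ultimately show ?thesis
    by (simp add: loop_cone_def loop_face_def)
qed

lemma face_Suc_loop_cone:
  assumes i: "i \<le> Suc n"
  shows "loop_face (Suc (Suc n)) (Suc i) (loop_cone (Suc n) (g, \<sigma>)) = loop_cone n (loop_face (Suc n) i (g, \<sigma>))"
proof -
  have "restrict (\<lambda>(t, s). restrict (cone_map g \<sigma>) (cyl (Suc (Suc n))) (simplical_face (Suc i) t, s)) (cyl (Suc n)) =
      restrict (cone_map g (restrict (\<lambda>(t, s). \<sigma> (simplical_face i t, s)) (cyl n))) (cyl (Suc n))"
  proof (rule restrict_cyl_eqI)
    fix t s assume ts: "t \<in> standard_simplex (Suc n)" "0 \<le> s" "s \<le> (1 :: real)"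
    have t0: "simplical_face (Suc i) t 0 = t 0"
      by (simp add: simplical_face_def)
    have "cone_map g \<sigma> (simplical_face (Suc i) t, s) =
        cone_map g (restrict (\<lambda>(t, s). \<sigma> (simplical_face i t, s)) (cyl n)) (t, s)"
    proof (cases "t 0 \<le> 1 / 2")
      case True
      then have "link t \<in> standard_simplex n"
        using ts by (intro link_in) auto
      with True ts show ?thesis
        by (auto simp: cone_map_def t0 link_simplical_face_Suc intro!: spread_cong)
    qed (simp add: cone_map_def t0)
    with ts i show "(case (t, s) of (t, s) \<Rightarrow> restrict (cone_map g \<sigma>) (cyl (Suc (Suc n))) (simplical_face (Suc i) t, s)) =
        cone_map g (restrict (\<lambda>(t, s). \<sigma> (simplical_face i t, s)) (cyl n)) (t, s)"
      by (simp add: simplical_face_simplex)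
  qed
  then show ?thesis
    by (simp add: loop_cone_def loop_face_def)
qed

lemma face_1_loop_cone:
  "loop_face (Suc 0) (Suc 0) (loop_cone 0 (g, \<sigma>)) = loop_apex g"
proof -
  have "restrict (\<lambda>(t, s). restrict (cone_map g \<sigma>) (cyl (Suc 0)) (simplical_face (Suc 0) t, s)) (cyl 0) =
      restrict (\<lambda>(t, s). spread g (\<lambda>_. e0) 1 1 s) (cyl 0)"
  proof (rule restrict_cyl_eqI)
    fix t s assume ts: "t \<in> standard_simplex 0" "0 \<le> s" "s \<le> (1 :: real)"
    then have "simplical_face (Suc 0) t 0 = 1"
      by (simp add: simplical_face_def standard_simplex_0)
    with ts show "(case (t, s) of (t, s) \<Rightarrow> restrict (cone_map g \<sigma>) (cyl (Suc 0)) (simplical_face (Suc 0) t, s)) =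
        (case (t, s) of (t, s) \<Rightarrow> spread g (\<lambda>_. e0) 1 1 s)"
      by (simp add: simplical_face_simplex cone_map_def)
  qed
  then show ?thesis
    by (simp add: loop_cone_def loop_face_def loop_apex_def)
qed

lemma proj_apply:
  "\<lbrakk>t \<in> standard_simplex n; norm z = 1\<rbrakk> \<Longrightarrow> loop_proj n (g, \<sigma>) t z = p (\<sigma> (t, angle z))"
  by (simp add: loop_proj_def)

text \<open>The lift takes values in the same orbit at both ends of the cylinder, so its projection descends to
  the product with the circle, and the exponential law applies.\<close>

lemma loop_proj_simplex:
  assumes x: "(g, \<sigma>) \<in> simplices n"
  shows "singular_simplex n LB (loop_proj n (g, \<sigma>))"
proof -
  let ?F = "\<lambda>(t, z). p (\<sigma> (t, angle z))"
  have "p (\<sigma> (t, angle (circle_point s))) = p (\<sigma> (t, s))" if "t \<in> standard_simplex n" "0 \<le> s" "s \<le> 1" for t s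
  proof (cases "s = 1")
    case True
    have "\<sigma> (t, 0) \<in> topspace E"
      using that by (intro simplex_in[OF x]) simp
    with True that x show ?thesis
      by (simp add: circle_point_1 angle_circle_point simplices_def p_act)
  qed (use that in \<open>simp add: angle_circle_point\<close>)
  moreover have "continuous_map (top_of_set (cyl n)) B (\<lambda>w. p (\<sigma> w))"
    using continuous_map_compose[OF _ continuous_p, of "top_of_set (cyl n)" \<sigma>] x
    by (simp add: simplices_def o_def)
  ultimately have "continuous_map (top_of_set (cyl n)) B (?F \<circ> (\<lambda>(t, s). (t, circle_point s)))"
    by (elim continuous_map_eq) (auto simp: cyl_def)
  then have "continuous_map (prod_topology (top_of_set (standard_simplex n)) (top_of_set (sphere 0 1))) B ?F"
    by (rule continuous_compose_quotient_map[OF quotient_map_cyl])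
  from continuous_map_into_mapping_space[OF this]
  have "continuous_map (top_of_set (standard_simplex n)) LB (loop_proj n (g, \<sigma>))"
    unfolding free_loop_space_def by (rule continuous_map_eq) (simp add: loop_proj_def)
  then show ?thesis
    by (simp add: singular_simplex_iff loop_proj_def)
qed

text \<open>The cylinder is contractible, so the map on it lifts. The restrictions of the lift to the two ends
  of the cylinder lift the same map on the simplex, which is connected; hence they differ by a single
  group element.\<close>

lemma loop_proj_surj:
  assumes \<tau>: "singular_simplex n LB \<tau>"
  shows "\<exists>x\<in>simplices n. loop_proj n x = \<tau>"
proof -
  have \<tau>': "continuous_map (top_of_set (standard_simplex n)) (mapping_space (top_of_set (sphere 0 1)) B) \<tau>"
      and ext: "\<tau> \<in> extensional (standard_simplex n)"
    using \<tau> by (simp_all add: singular_simplex_iff free_loop_space_def)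
  have ext': "\<tau> t \<in> extensional (sphere 0 1)" if "t \<in> standard_simplex n" for t
    using continuous_map_funspace[OF \<tau>'] that by (auto simp: topspace_mapping_space Pi_iff)
  define F where "F = (\<lambda>(t, s). \<tau> t (circle_point s))"
  have "continuous_map (top_of_set (cyl n)) B
      ((\<lambda>(t, z). \<tau> t z) \<circ> (\<lambda>(t, s). (t, circle_point s)))"
    by (rule continuous_map_compose[OF quotient_imp_continuous_map[OF quotient_map_cyl]
        continuous_map_from_mapping_space[OF compact_sphere \<tau>']])
  then have F: "continuous_map (top_of_set (cyl n)) B F"
    by (simp add: F_def o_def split_def)
  from lift_from_contractible[OF contractible_cyl F] obtain l where
    l: "continuous_map (top_of_set (cyl n)) E l" "\<And>w. w \<in> cyl n \<Longrightarrow> p (l w) = F w"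
    by auto
  have slice: "continuous_map (top_of_set (standard_simplex n)) E (\<lambda>t. l (t, s))" if "s \<in> {0..1}" for s
  proof -
    have "continuous_on (standard_simplex n) (\<lambda>t. (t, s))"
      by (intro continuous_on_Pair continuous_on_id continuous_on_const)
    then have "continuous_map (top_of_set (standard_simplex n)) (top_of_set (cyl n)) (\<lambda>t. (t, s))"
      using that by (auto simp: continuous_map_in_subtopology)
    from continuous_map_compose[OF this l(1)] show ?thesis
      by (simp add: o_def)
  qed
  have "p (l (t, 0)) = p (l (t, 1))" if "t \<in> standard_simplex n" for t
    using l(2)[of "(t, 0)"] l(2)[of "(t, 1)"] that by (simp add: F_def circle_point_1)
  then obtain g where g: "g \<in> carrier G" "\<And>t. t \<in> standard_simplex n \<Longrightarrow> l (t, 1) = \<phi> g (l (t, 0))"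
    using lifts_differ_by_group_element[OF connected_standard_simplex slice[of 0] slice[of 1]] by auto
  have "loop_proj n (g, restrict l (cyl n)) = \<tau>"
  proof
    fix t
    show "loop_proj n (g, restrict l (cyl n)) t = \<tau> t"
    proof (cases "t \<in> standard_simplex n")
      case True
      show ?thesis
      proof
        fix z
        show "loop_proj n (g, restrict l (cyl n)) t z = \<tau> t z"
          using True l(2)[of "(t, angle z)"] angle_range[of z] circle_point_angle[of z] ext'[OF True]
          by (cases "norm z = 1") (simp_all add: loop_proj_def F_def extensional_def)
      qed
    next
      case False
      with ext show ?thesis
        by (simp add: loop_proj_def extensional_def)
    qed
  qed
  then show ?thesis
    using restrict_in_simplices[OF g(1) l(1) g(2)] by blast
qed

text \<open>Lifts of the same map differ by some \<open>h\<close>. Comparing the ends of the cylinder, freeness of the action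
  yields \<open>g' h = h g\<close>.\<close>

lemma loop_proj_eq_imp:
  assumes x: "(g, \<sigma>) \<in> simplices n" and y: "(g', \<sigma>') \<in> simplices n"
    and eq: "loop_proj n (g, \<sigma>) = loop_proj n (g', \<sigma>')"
  shows "\<exists>h\<in>carrier G. (g', \<sigma>') = loop_act n h (g, \<sigma>)"
proof -
  have in_E: "\<sigma> w \<in> topspace E" "\<sigma>' w \<in> topspace E" if "w \<in> cyl n" for w
    using that simplex_in x y by blast+
  have g: "g \<in> carrier G" "g' \<in> carrier G"
    using x y by (auto simp: simplices_def)
  have ends: "\<sigma> (t, 1) = \<phi> g (\<sigma> (t, 0))" "\<sigma>' (t, 1) = \<phi> g' (\<sigma>' (t, 0))" if "t \<in> standard_simplex n" for t
    using x y that by (auto simp: simplices_def)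
  have less: "p (\<sigma> (t, s)) = p (\<sigma>' (t, s))" if "t \<in> standard_simplex n" "0 \<le> s" "s < 1" for t s
  proof -
    have "loop_proj n (g, \<sigma>) t (circle_point s) = loop_proj n (g', \<sigma>') t (circle_point s)"
      by (simp add: eq)
    with that show ?thesis
      by (simp add: proj_apply angle_circle_point)
  qed
  have "p (\<sigma> w) = p (\<sigma>' w)" if "w \<in> topspace (top_of_set (cyl n))" for w
  proof -
    obtain t s where w: "w = (t, s)" "t \<in> standard_simplex n" "0 \<le> s" "s \<le> 1"
      using \<open>w \<in> _\<close> by (auto simp: cyl_def)
    show ?thesis
    proof (cases "s = 1")
      case True
      with w show ?thesis
        using less[of t 0] in_E by (simp add: ends p_act g)
    qed (use w less in auto)
  qed
  moreover have "continuous_map (top_of_set (cyl n)) E \<sigma>" "continuous_map (top_of_set (cyl n)) E \<sigma>'"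
    using x y by (auto simp: simplices_def)
  ultimately obtain h where "h \<in> carrier G" "\<forall>w\<in>topspace (top_of_set (cyl n)). \<sigma>' w = \<phi> h (\<sigma> w)"
    using lifts_differ_by_group_element[OF connected_cyl] by metis
  then have h: "h \<in> carrier G" "\<And>w. w \<in> cyl n \<Longrightarrow> \<sigma>' w = \<phi> h (\<sigma> w)"
    by auto
  have "\<sigma>' = restrict (\<lambda>w. \<phi> h (\<sigma> w)) (cyl n)"
    using y h(2) by (auto simp: simplices_def extensional_def fun_eq_iff)
  moreover have "g' = conj h g"
  proof -
    let ?v = "vertex 0"
    have v: "(?v, 0) \<in> cyl n" "(?v, 1) \<in> cyl n" "?v \<in> standard_simplex n"
      by simp_all
    have "\<phi> (g' \<otimes> h) (\<sigma> (?v, 0)) = \<phi> (h \<otimes> g) (\<sigma> (?v, 0))"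
      using h(2)[OF v(1)] h(2)[OF v(2)] ends[OF v(3)] in_E v(1) g h(1)
      by (simp flip: act_comp)
    then have "g' \<otimes> h = h \<otimes> g"
      using act_free in_E(1)[OF v(1)] g h(1) by blast
    then show ?thesis
      using g h(1) by (simp add: conj_def inv_solve_right)
  qed
  ultimately show ?thesis
    using h(1) by (auto simp: loop_act_def)
qed

sublocale loops: coned_cover G LB simplices loop_face loop_act fst loop_col loop_cone loop_apex loop_proj
proof
  fix x :: "'g \<times> ((nat \<Rightarrow> real) \<times> real \<Rightarrow> 'e)" and n i
  obtain g \<sigma> where x: "x = (g, \<sigma>)"
    by fastforce
  show "loop_face (Suc n) i x \<in> simplices n" if "x \<in> simplices (Suc n)" "i \<le> Suc n"
    using that face_in by (simp add: x)
  show "loop_face (Suc n) 0 (loop_face (Suc (Suc n)) (Suc i) x) = loop_face (Suc n) i (loop_face (Suc (Suc n)) 0 x)"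
    if "i \<le> Suc n"
  proof -
    have "simplical_face (Suc i) (simplical_face 0 t) = simplical_face 0 (simplical_face i t)" for t :: "nat \<Rightarrow> real"
      by (auto simp: simplical_face_def fun_eq_iff)
    with that show ?thesis
      by (auto simp: x loop_face_def simplical_face_simplex intro!: restrict_cyl_eqI)
  qed
  show "fst x \<in> carrier G" if "x \<in> simplices n"
    using that by (simp add: x simplices_def)
  show "fst (loop_face (Suc n) i x) = fst x"
    by (simp add: x loop_face_def)
  show "loop_col i x \<in> carrier G" if "x \<in> simplices n" "i \<le> n"
    using that by (auto simp: x loop_col_def intro!: colour_closed simplex_in)
  show "loop_cone n x \<in> simplices (Suc n)" if "x \<in> simplices n"
    using that cone_in by (simp add: x)
  show "fst (loop_cone n x) = fst x"
    by (simp add: x loop_cone_def)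
  show "loop_face (Suc n) 0 (loop_cone n x) = x" if "x \<in> simplices n"
    using that face_0_loop_cone by (simp add: x)
  show "loop_face (Suc (Suc n)) (Suc i) (loop_cone (Suc n) x) = loop_cone n (loop_face (Suc n) i x)" if "i \<le> Suc n"
    using that face_Suc_loop_cone by (simp add: x)
  show "loop_face (Suc 0) (Suc 0) (loop_cone 0 x) = loop_apex (fst x)"
    using face_1_loop_cone by (simp add: x)
  show "loop_col 0 (loop_cone n x) = \<one>"
    by (simp add: x loop_col_def loop_cone_def cone_map_def spread_0 H_1 e0_in colour_e0 vertex_def)
  show "singular_simplex n LB (loop_proj n x)" if "x \<in> simplices n"
    using that loop_proj_simplex by (simp add: x)
  show "loop_proj n (loop_face (Suc n) i x) = singular_face (Suc n) i (loop_proj (Suc n) x)"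
    if "i \<le> Suc n"
    using that angle_range
    by (auto simp: x loop_proj_def loop_face_def singular_face_def simplical_face_simplex fun_eq_iff restrict_def)
  show "loop_col i (loop_face (Suc n) j x) = loop_col (if i < j then i else Suc i) x" if "i \<le> n" for j
    using that by (simp add: x loop_col_def loop_face_def simplical_face_vertex)
  fix h assume h: "h \<in> carrier G"
  show "loop_act n h x \<in> simplices n" if "x \<in> simplices n"
    using that h act_in_simplices by (simp add: x)
  show "fst (loop_act n h x) = conj h (fst x)"
    by (simp add: x loop_act_def)
  show "loop_act n h (loop_act n k x) = loop_act n (h \<otimes> k) x" if "x \<in> simplices n" "k \<in> carrier G" for k
    using that h simplex_in[of g \<sigma> n]
    by (auto simp: x loop_act_def conj_conj act_comp simplices_def intro!: restrict_cyl_eqI)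
  show "loop_face (Suc n) i (loop_act (Suc n) h x) = loop_act n h (loop_face (Suc n) i x)" if "i \<le> Suc n"
    using that by (auto simp: x loop_face_def loop_act_def simplical_face_simplex intro!: restrict_cyl_eqI)
  show "loop_col i (loop_act n h x) = h \<otimes> loop_col i x" if "x \<in> simplices n" "i \<le> n"
    using that h simplex_in[of g \<sigma> n "(vertex i, 0)"]
    by (simp add: x loop_col_def loop_act_def colour_act)
  show "loop_proj n (loop_act n h x) = loop_proj n x" if "x \<in> simplices n"
    using that h angle_range simplex_in[of g \<sigma> n]
    by (auto simp: x loop_proj_def loop_act_def p_act intro!: restrict_ext)
next
  fix x :: "'g \<times> ((nat \<Rightarrow> real) \<times> real \<Rightarrow> 'e)" and n
  assume "x \<in> simplices n"
  then show "loop_act n \<one> x = x"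
    using simplex_in by (auto simp: simplices_def loop_act_def fun_eq_iff extensional_def act_unit)
next
  fix x y :: "'g \<times> ((nat \<Rightarrow> real) \<times> real \<Rightarrow> 'e)" and n
  assume "x \<in> simplices n" "y \<in> simplices n" "loop_proj n x = loop_proj n y"
  then show "\<exists>g\<in>carrier G. y = loop_act n g x"
    using loop_proj_eq_imp by (metis surj_pair)
qed (simp_all add: apex_in loop_proj_surj, simp add: loop_apex_def)

end

section \<open>Abelian groups\<close>

text \<open>For an abelian group the nerve of the conjugation action is a disjoint union of copies of the nerve
  of \<open>G\<close>, indexed by the object \<open>y\<close>. A cochain on it is a family of cochains on \<open>G\<close>.\<close>

definition slice :: "'g \<Rightarrow> ('g list \<times> 'g \<Rightarrow> 'k) \<Rightarrow> 'g list \<Rightarrow> 'k" where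
  "slice y u = (\<lambda>hs. u (hs, y))"

definition assemble ::
  "('g, 'm) monoid_scheme \<Rightarrow> ('g \<Rightarrow> 'g list \<Rightarrow> 'k::zero) \<Rightarrow> 'g list \<times> 'g \<Rightarrow> 'k" where
  "assemble G w = (\<lambda>(hs, y). if y \<in> carrier G then w y hs else 0)"

locale finite_comm_group = comm_group G for G (structure) +
  fixes K :: "'k::field itself"
  assumes fin: "finite (carrier G)"
begin

abbreviation "CG \<equiv> adjoint_cobar K G"
abbreviation "CT \<equiv> group_cochains K G"

lemma conj_trivial: "\<lbrakk>h \<in> carrier G; y \<in> carrier G\<rbrakk> \<Longrightarrow> conj h y = y"
  unfolding conj_def by (metis inv_closed inv_solve_right' m_closed m_comm)

lemma mem_cochains_CT: "u \<in> cochains CT n \<longleftrightarrow> (\<forall>hs. \<not> (length hs = n \<and> set hs \<subseteq> carrier G) \<longrightarrow> u hs = 0)"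
  by (simp add: group_cochains_def)

lemma mem_cochains_CG: "u \<in> cochains CG n \<longleftrightarrow> (\<forall>s. s \<notin> bar_simplices G n \<longrightarrow> u s = 0)"
  by (simp add: cochains_adjoint_cobar[OF fin])

lemma slice_cochain: "u \<in> cochains CG n \<Longrightarrow> slice y u \<in> cochains CT n"
  by (auto simp: mem_cochains_CT mem_cochains_CG slice_def bar_simplices_def)

lemma slice_diff:
  assumes u: "u \<in> cochains CG n" and y: "y \<in> carrier G"
  shows "slice y (diff CG n u) = diff CT n (slice y u)"
proof
  fix hs
  have "conj_coface G n i (hs, y) = (group_coface G n i hs, y)"
    if "length hs = Suc n" "set hs \<subseteq> carrier G" for i
  proof -
    have "last hs \<in> carrier G"
      using that by (metis last_in_set list.size(3) nat.distinct(1) subsetD)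
    then show ?thesis
      using conj_trivial[of "last hs" y] y by (simp add: conj_coface_def conj_def)
  qed
  with y show "slice y (diff CG n u) hs = diff CT n (slice y u) hs"
    by (simp add: slice_def diff_adjoint_cobar[OF fin u] group_cochains_def bar_simplices_def
        del: sum.atMost_Suc)
qed

lemma slice_cup:
  assumes u: "u \<in> cochains CG p" and v: "v \<in> cochains CG q" and y: "y \<in> carrier G"
  shows "slice y (cup CG p q u v) = cup CT p q (slice y u) (slice y v)"
proof
  fix hs
  show "slice y (cup CG p q u v) hs = cup CT p q (slice y u) (slice y v) hs"
  proof (cases "set hs \<subseteq> carrier G")
    case True
    then have "conj (gprod (drop p hs)) y = y"
      using y set_drop_subset[of p hs] by (intro conj_trivial gprod_closed) auto
    with True y show ?thesis
      by (simp add: slice_def cup_adjoint_cobar[OF fin u v] group_cochains_def bar_simplices_def)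
  next
    case False
    then have "\<not> set (take p hs) \<subseteq> carrier G \<or> \<not> set (drop p hs) \<subseteq> carrier G"
      by (metis Un_subset_iff append_take_drop_id set_append)
    moreover have "u (ks, y) = 0" "v (ks, y) = 0" if "\<not> set ks \<subseteq> carrier G" for ks
      using u v that by (simp_all add: mem_cochains_CG bar_simplices_def)
    ultimately have "u (take p hs, y) * v (drop p hs, y) = 0"
      by auto
    with False show ?thesis
      by (simp add: slice_def cup_adjoint_cobar[OF fin u v] group_cochains_def bar_simplices_def)
  qed
qed

lemma slice_unit: "y \<in> carrier G \<Longrightarrow> slice y (cunit CG) = cunit CT"
  by (auto simp: slice_def cunit_adjoint_cobar[OF fin] group_cochains_def bar_simplices_def)

lemma assemble_cochain:
  "(\<And>y. y \<in> carrier G \<Longrightarrow> w y \<in> cochains CT n) \<Longrightarrow> assemble G w \<in> cochains CG n"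
  by (auto simp: mem_cochains_CT mem_cochains_CG assemble_def bar_simplices_def)

lemma slice_assemble: "y \<in> carrier G \<Longrightarrow> slice y (assemble G w) = w y"
  by (simp add: slice_def assemble_def)

lemma cochain_eqI:
  assumes "u \<in> cochains CG n" "v \<in> cochains CG n" "\<And>y. y \<in> carrier G \<Longrightarrow> slice y u = slice y v"
  shows "u = v"
proof
  fix s :: "'a list \<times> 'a"
  obtain hs y where s: "s = (hs, y)"
    by fastforce
  show "u s = v s"
  proof (cases "y \<in> carrier G")
    case True
    from fun_cong[OF assms(3)[OF this], of hs] show ?thesis
      by (simp add: slice_def s)
  next
    case False
    with assms(1,2) show ?thesis
      by (simp add: mem_cochains_CG bar_simplices_def s)
  qed
qed

context
  assumes dga_CG: "dga CG"
begin

interpretation C: dga CG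
  by (rule dga_CG)

text \<open>Cochains of \<open>G\<close> embed into the cobar complex as the functions that do not depend on \<open>y\<close>.\<close>

lemma dga_group_cochains: "dga CT"
proof (rule dga_pullback[where D = CG and f = "\<lambda>n w. assemble G (\<lambda>_. w)"])
  have const_cochain: "assemble G (\<lambda>_. w) \<in> cochains CG n" if "w \<in> cochains CT n" for w n
    using that by (rule assemble_cochain)
  show "inj_on (\<lambda>w. assemble G (\<lambda>_. w)) (cochains CT n)" for n
    by (rule inj_on_inverseI[where g = "slice \<one>"]) (simp add: slice_assemble)
  show "assemble G (\<lambda>_. w) \<in> cochains CG n" if "w \<in> cochains CT n" for w n
    by (rule const_cochain[OF that])
  show diff: "diff CT n w \<in> cochains CT (Suc n)" if "w \<in> cochains CT n" for n w
    by (simp add: group_cochains_def)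
  show cup: "cup CT p q u v \<in> cochains CT (p + q)" if "u \<in> cochains CT p" "v \<in> cochains CT q" for p q u v
    using slice_cochain[OF C.cup_cochain[OF const_cochain[OF that(1)] const_cochain[OF that(2)]], of \<one>]
      slice_cup[OF const_cochain[OF that(1)] const_cochain[OF that(2)], of \<one>]
    by (simp add: slice_assemble)
  show "assemble G (\<lambda>_. diff CT n w) = diff CG n (assemble G (\<lambda>_. w))" if "w \<in> cochains CT n" for n w
    using that by (intro cochain_eqI[of _ "Suc n"])
      (simp_all add: const_cochain diff C.diff_cochain slice_diff slice_assemble)
  show "assemble G (\<lambda>_. cup CT p q u v) = cup CG p q (assemble G (\<lambda>_. u)) (assemble G (\<lambda>_. v))"
    if "u \<in> cochains CT p" "v \<in> cochains CT q" for p q u v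
    using that by (intro cochain_eqI[of _ "p + q"])
      (simp_all add: const_cochain cup C.cup_cochain slice_cup slice_assemble)
  show "cunit CT \<in> cochains CT 0"
    by (simp add: group_cochains_def)
  then show "assemble G (\<lambda>_. cunit CT) = cunit CG"
    using C.cunit_cocycle
    by (intro cochain_eqI[of _ 0]) (simp_all add: const_cochain slice_unit slice_assemble cocycles_def)
qed (auto simp: dga_CG mem_cochains_CT assemble_def)

interpretation T: dga CT
  by (rule dga_group_cochains)

lemma slice_cocycle: "\<lbrakk>u \<in> cocycles CG n; y \<in> carrier G\<rbrakk> \<Longrightarrow> slice y u \<in> cocycles CT n"
  by (simp add: cocycles_def slice_cochain flip: slice_diff) (simp add: slice_def)

lemma assemble_cocycle:
  assumes "\<And>y. y \<in> carrier G \<Longrightarrow> w y \<in> cocycles CT n"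
  shows "assemble G w \<in> cocycles CG n"
proof -
  have c: "assemble G w \<in> cochains CG n"
    using assms by (intro assemble_cochain T.cocycle_cochain)
  moreover have "diff CG n (assemble G w) = (\<lambda>_. 0)"
  proof (rule cochain_eqI[of _ "Suc n"])
    fix y assume y: "y \<in> carrier G"
    then show "slice y (diff CG n (assemble G w)) = slice y (\<lambda>_. 0)"
      using assms[OF y] by (simp add: slice_diff[OF c] slice_assemble cocycles_def) (simp add: slice_def)
  qed (simp_all add: c C.diff_cochain C.zero_cochain)
  ultimately show ?thesis
    by (simp add: cocycles_def)
qed

text \<open>Primitives can be chosen for each \<open>y\<close> separately.\<close>

lemma coboundary_iff_slices:
  assumes d: "d \<in> cochains CG n"
  shows "d \<in> coboundaries CG n \<longleftrightarrow> (\<forall>y\<in>carrier G. slice y d \<in> coboundaries CT n)"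
proof (cases n)
  case 0
  have "d = (\<lambda>_. 0) \<longleftrightarrow> (\<forall>y\<in>carrier G. slice y d = (\<lambda>_. 0))"
    using cochain_eqI[OF d C.zero_cochain] by (auto simp: slice_def)
  with 0 show ?thesis
    by (simp add: coboundaries_def)
next
  case (Suc m)
  show ?thesis
  proof
    assume "d \<in> coboundaries CG n"
    then show "\<forall>y\<in>carrier G. slice y d \<in> coboundaries CT n"
      by (auto simp: Suc coboundaries_def slice_diff slice_cochain)
  next
    assume "\<forall>y\<in>carrier G. slice y d \<in> coboundaries CT n"
    then have "\<forall>y\<in>carrier G. \<exists>b. b \<in> cochains CT m \<and> slice y d = diff CT m b"
      by (auto simp: Suc coboundaries_def)
    from bchoice[OF this] obtain b where
      b: "\<And>y. y \<in> carrier G \<Longrightarrow> b y \<in> cochains CT m" "\<And>y. y \<in> carrier G \<Longrightarrow> slice y d = diff CT m (b y)"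
      by blast
    have c: "assemble G b \<in> cochains CG m"
      by (rule assemble_cochain[OF b(1)])
    have "d = diff CG m (assemble G b)"
      by (rule cochain_eqI[of _ n])
        (use d c in \<open>simp_all add: Suc C.diff_cochain slice_diff slice_assemble b(2)\<close>)
    with c show "d \<in> coboundaries CG n"
      by (auto simp: Suc coboundaries_def)
  qed
qed

theorem adjoint_cobar_iso_power:
  "graded_algebra_iso (cohomology CG) (graded_power (order G) (group_cohomology K G))"
proof -
  obtain e where "bij_betw e {0..<card (carrier G)} (carrier G)"
    using ex_bij_betw_nat_finite[OF fin] by blast
  then have e: "bij_betw e {..<order G} (carrier G)"
    by (simp add: order_def atLeast0LessThan)
  then have e_in: "e i \<in> carrier G" if "i < order G" for i
    using that by (auto simp: bij_betw_def)
  have e_all: "(\<forall>y\<in>carrier G. P y) \<longleftrightarrow> (\<forall>i\<in>{..<order G}. P (e i))" for P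
    by (simp flip: bij_betw_imp_surj_on[OF e])
  let ?k = "{..<order G}" and ?B = "graded_power (order G) (group_cohomology K G)"
  let ?\<phi> = "\<lambda>n u. \<lambda>i\<in>?k. cohomology_class CT n (slice (e i) u)"
  have slice_add: "slice y (\<lambda>s. u s + v s) = (\<lambda>hs. slice y u hs + slice y v hs)"
    and slice_minus: "slice y (\<lambda>s. u s - v s) = (\<lambda>hs. slice y u hs - slice y v hs)"
    and slice_scale: "slice y (\<lambda>s. c * u s) = (\<lambda>hs. c * slice y u hs)"
    for y :: 'a and u v :: "'a list \<times> 'a \<Rightarrow> 'k" and c
    by (simp_all add: slice_def)
  show ?thesis
  proof (rule C.cohomology_iso_if_presented[where \<phi> = ?\<phi>])
    fix n
    show "?\<phi> n ` cocycles CG n = component ?B n"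
    proof (intro equalityI subsetI)
      fix x assume "x \<in> ?\<phi> n ` cocycles CG n"
      then show "x \<in> component ?B n"
        by (auto simp: graded_power_def group_cohomology_def T.component_cohomology slice_cocycle e_in)
    next
      fix x assume "x \<in> component ?B n"
      then have x: "x \<in> ?k \<rightarrow>\<^sub>E cohomology_class CT n ` cocycles CT n"
        by (simp add: graded_power_def group_cohomology_def T.component_cohomology)
      then have "\<forall>i\<in>?k. \<exists>w. w \<in> cocycles CT n \<and> x i = cohomology_class CT n w"
        by (auto simp: PiE_iff)
      from bchoice[OF this] obtain w where
        w: "\<And>i. i \<in> ?k \<Longrightarrow> w i \<in> cocycles CT n" "\<And>i. i \<in> ?k \<Longrightarrow> x i = cohomology_class CT n (w i)"
        by blast
      let ?u = "assemble G (\<lambda>y. w (inv_into ?k e y))"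
      have "?u \<in> cocycles CG n"
        by (intro assemble_cocycle w(1) inv_into_into) (simp add: bij_betw_imp_surj_on[OF e])
      moreover have "?\<phi> n ?u = x"
      proof
        fix i
        show "?\<phi> n ?u i = x i"
          using x w(2) e by (cases "i \<in> ?k")
            (auto simp: slice_assemble e_in bij_betw_def inv_into_f_f PiE_def extensional_def)
      qed
      ultimately show "x \<in> ?\<phi> n ` cocycles CG n"
        by blast
    qed
  next
    fix n u v assume uv: "u \<in> cocycles CG n" "v \<in> cocycles CG n"
    have "(\<lambda>s. u s - v s) \<in> cochains CG n"
      using C.add_cochain[OF C.cocycle_cochain[OF uv(1)] C.scale_cochain[OF C.cocycle_cochain[OF uv(2)], of "-1"]]
      by simp
    moreover have "?\<phi> n u = ?\<phi> n v \<longleftrightarrow>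
        (\<forall>i\<in>{..< order G}. (\<lambda>hs. slice (e i) u hs - slice (e i) v hs) \<in> coboundaries CT n)"
      by (auto simp: T.cohomology_class_eq_iff[symmetric] fun_eq_iff restrict_def)
    ultimately show "?\<phi> n u = ?\<phi> n v \<longleftrightarrow> (\<lambda>s. u s - v s) \<in> coboundaries CG n"
      by (simp add: coboundary_iff_slices e_all slice_minus)
  qed (auto simp: graded_power_def group_cohomology_def T.gadd_cohomology T.gscale_cohomology
      T.gmult_cohomology T.gone_cohomology slice_add slice_scale slice_cup slice_unit slice_cocycle
      C.cocycle_cochain e_in intro!: restrict_ext)
qed

end

end

section \<open>The free loop space of a classifying space\<close>

text \<open>Choose a representative in every orbit, namely \<open>e0\<close> in its own, and colour a point by the unique group
  element that moves the representative to it.\<close>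

lemma (in principal_space) ex_equivariant_colouring:
  assumes "e0 \<in> topspace E"
  shows "\<exists>c. (\<forall>x\<in>topspace E. c x \<in> carrier G) \<and>
    (\<forall>x\<in>topspace E. \<forall>g\<in>carrier G. c (\<phi> g x) = g \<otimes> c x) \<and> c e0 = \<one>"
proof -
  define rep where "rep b = (if b = p e0 then e0 else SOME x. x \<in> topspace E \<and> p x = b)" for b
  have rep: "rep (p x) \<in> topspace E \<and> p (rep (p x)) = p x" if "x \<in> topspace E" for x
    using assms that someI[of "\<lambda>y. y \<in> topspace E \<and> p y = p x" x] by (auto simp: rep_def)
  define c where "c x = (SOME g. g \<in> carrier G \<and> x = \<phi> g (rep (p x)))" for x
  have c: "c x \<in> carrier G \<and> x = \<phi> (c x) (rep (p x))" if "x \<in> topspace E" for x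
  proof -
    have "\<exists>g. g \<in> carrier G \<and> x = \<phi> g (rep (p x))"
      using rep[OF that] p_eq_iff[of "rep (p x)" x] that by blast
    then show ?thesis
      unfolding c_def by (rule someI_ex)
  qed
  have "c (\<phi> g x) = g \<otimes> c x" if x: "x \<in> topspace E" and g: "g \<in> carrier G" for g x
  proof (rule act_free[of "rep (p x)"])
    have "\<phi> (c (\<phi> g x)) (rep (p x)) = \<phi> g x"
      using c[OF act_in[OF g x]] by (simp add: p_act[OF g x])
    also have "\<dots> = \<phi> (g \<otimes> c x) (rep (p x))"
      using c[OF x] rep[OF x] g by (metis act_comp)
    finally show "\<phi> (c (\<phi> g x)) (rep (p x)) = \<phi> (g \<otimes> c x) (rep (p x))" .
  qed (use rep[OF x] c[OF x] c[OF act_in[OF g x]] g in auto)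
  moreover have "c e0 = \<one>"
    using c[OF assms] assms by (intro act_free[of e0]) (auto simp: rep_def act_unit)
  ultimately show ?thesis
    using c by blast
qed

theorem proposition5p9:
  fixes G :: "('g, 'm) monoid_scheme"
    and K :: "'k::field itself"
    and EG :: "'e topology"
    and \<phi> :: "'g \<Rightarrow> 'e \<Rightarrow> 'e"
  assumes "group G" and "finite (carrier G)"
    and "universal_space G EG \<phi>"
  defines "LBG \<equiv> free_loop_space (orbit_space G EG \<phi>)"
  shows "graded_algebra_iso (singular_cohomology K LBG)
           (Cotor (dual_hopf_algebra (group_algebra K G)) (adjoint_dual K G)) \<and>
         (comm_group G \<longrightarrow>
           graded_algebra_iso (singular_cohomology K LBG)
             (graded_power (order G) (group_cohomology K G)))"
proof -
  interpret P: principal_space G EG \<phi>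
    using assms(1,3) by (simp add: principal_space_def universal_space_def)
  obtain x where x: "x \<in> topspace EG"
    using assms(3) unfolding universal_space_def by blast
  obtain e0 H where H: "continuous_map (prod_topology (top_of_set {0..1::real}) EG) EG H"
      "\<And>x. x \<in> topspace EG \<Longrightarrow> H (0, x) = x" "\<And>x. x \<in> topspace EG \<Longrightarrow> H (1, x) = e0"
    using assms(3) unfolding universal_space_def contractible_space_def by (auto simp: homotopic_with)
  then have e0: "e0 \<in> topspace EG"
    using x continuous_map_funspace[OF H(1)] by (force simp: Pi_iff)
  from P.ex_equivariant_colouring[OF this] obtain c where
    c: "\<And>x. x \<in> topspace EG \<Longrightarrow> c x \<in> carrier G"
      "\<And>x g. \<lbrakk>x \<in> topspace EG; g \<in> carrier G\<rbrakk> \<Longrightarrow> c (\<phi> g x) = g \<otimes>\<^bsub>G\<^esub> c x" "c e0 = \<one>\<^bsub>G\<^esub>"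
    by blast
  interpret L: loop_bundle G EG \<phi> H e0 c
    by unfold_locales (use H e0 c in auto)
  have iso: "graded_algebra_iso (singular_cohomology K LBG) (cohomology (adjoint_cobar K G))"
    unfolding LBG_def by (rule L.loops.singular_cohomology_iso_adjoint_cotor[OF assms(2)])
  moreover have "graded_algebra_iso (singular_cohomology K LBG) (graded_power (order G) (group_cohomology K G))"
    if "comm_group G"
  proof -
    interpret finite_comm_group G K
      using that assms(2) by (simp add: finite_comm_group_def finite_comm_group_axioms_def)
    show ?thesis
      by (rule graded_algebra_iso_trans[OF iso
          adjoint_cobar_iso_power[OF L.loops.dga_adjoint_cobar[OF assms(2)]]])
  qed
  ultimately show ?thesis
    by (simp add: Cotor_def)
qed

end
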